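(* Let $\Omega\subset\mathbb{R}^N$, $N\ge2$, be an open set, $p\in(1,p_N)$, and let $w_n\in C^2(\Omega)$ solve $-\Delta w_n=[w_n-1]_+^p$ in $\Omega$ with $\|[w_n]_-\|_{L^1(\Omega)}\le C$. Then $[w_n]_-$ is locally uniformly bounded, and there is a subsequence such that either (i) $w_n\to+\infty$ locally uniformly in $\Omega$, or (ii) $w_n\to w$ in $C^2_{\rm loc}(\Omega)$ for some $w$. Moreover, (ii) occurs if and only if $[w_n-1]_+^p$ is bounded in $L^1_{\rm loc}(\Omega)$.
   Context: $p_N=+\infty$ if $N=2$ and $p_N=\frac N{N-2}$ if $N\ge3$; $[t]_+=\max\{t,0\}$, $[t]_-=\max\{-t,0\}$. *)

theory Defs
  imports "HOL-Analysis.Analysis"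
begin

definition crit_exp :: "nat \<Rightarrow> ereal" where
  "crit_exp N = (if N = 2 then \<infinity> else ereal (real N / (real N - 2)))"

definition pdiff :: "'n::finite \<Rightarrow> (real^'n \<Rightarrow> real) \<Rightarrow> real^'n \<Rightarrow> real" where
  "pdiff i f x = deriv (\<lambda>t. f (x + t *\<^sub>R axis i 1)) 0"

definition has_pdiff_on :: "(real^'n::finite) set \<Rightarrow> (real^'n \<Rightarrow> real) \<Rightarrow> bool" where
  "has_pdiff_on \<Omega> f \<longleftrightarrow>
     (\<forall>i. \<forall>x\<in>\<Omega>. (\<lambda>t. f (x + t *\<^sub>R axis i 1)) field_differentiable (at 0))"

definition C2_on :: "(real^'n::finite) set \<Rightarrow> (real^'n \<Rightarrow> real) \<Rightarrow> bool" where
  "C2_on \<Omega> f \<longleftrightarrow> continuous_on \<Omega> f \<and> has_pdiff_on \<Omega> f \<and>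
     (\<forall>i. continuous_on \<Omega> (pdiff i f) \<and> has_pdiff_on \<Omega> (pdiff i f)) \<and>
     (\<forall>i j. continuous_on \<Omega> (pdiff j (pdiff i f)))"

definition laplacian :: "(real^'n::finite \<Rightarrow> real) \<Rightarrow> real^'n \<Rightarrow> real" where
  "laplacian f x = (\<Sum>i\<in>UNIV. pdiff i (pdiff i f) x)"

definition C2_loc_conv :: "(real^'n::finite) set \<Rightarrow> (nat \<Rightarrow> real^'n \<Rightarrow> real) \<Rightarrow> (real^'n \<Rightarrow> real) \<Rightarrow> bool" where
  "C2_loc_conv \<Omega> u v \<longleftrightarrow> C2_on \<Omega> v \<and>
     (\<forall>K. compact K \<and> K \<subseteq> \<Omega> \<longrightarrow>
        uniform_limit K u v sequentially \<and>
        (\<forall>i. uniform_limit K (\<lambda>n. pdiff i (u n)) (pdiff i v) sequentially) \<and>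
        (\<forall>i j. uniform_limit K (\<lambda>n. pdiff j (pdiff i (u n))) (pdiff j (pdiff i v)) sequentially))"

definition L1loc_bounded :: "(real^'n::finite) set \<Rightarrow> (nat \<Rightarrow> real^'n \<Rightarrow> real) \<Rightarrow> bool" where
  "L1loc_bounded \<Omega> g \<longleftrightarrow>
     (\<forall>K. compact K \<and> K \<subseteq> \<Omega> \<longrightarrow>
        (\<exists>M::real. \<forall>n. (\<integral>\<^sup>+ x\<in>K. ennreal \<bar>g n x\<bar> \<partial>lborel) \<le> ennreal M))"

end

theory Submission
  imports Defs "HOL-Complex_Analysis.Great_Picard"
begin

text \<open>
  Since \<open>p > 1\<close>, testing the equation with a high power of a cut-off function absorbs the linear
  term and bounds \<open>[w\<^sub>n - 1]\<^sub>+\<^sup>p\<close> in \<open>L\<^sup>1\<close> locally once \<open>w\<^sub>n\<close> is bounded below, which the mean value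
  inequality for superharmonic functions provides. Hence alternative (ii) always holds, also when
  \<open>\<Omega>\<close> is disconnected.

  The fundamental solution is replaced by the averages of \<open>u\<close> with weight \<open>(\<rho>\<^sup>2 - |y - x|\<^sup>2)\<^sub>+\<^sup>2\<close>, normalised
  by \<open>\<rho>\<^bsup>N+4\<^esup>\<close>: by Green's identity their derivative in \<open>\<rho>\<close> is the integral of the Laplacian of \<open>u\<close>
  against the third power of the same weight, so every estimate reduces to comparing a derivative in
  \<open>\<rho>\<close>. Subcriticality enters through interpolating the integral of \<open>[w\<^sub>n - 1]\<^sub>+\<^sup>p\<close> over a ball of radius
  \<open>\<rho>\<close> between its \<open>L\<^sup>1\<close> and \<open>L\<^sup>\<infinity>\<close> bounds with exponent \<open>1/s\<close>, \<open>p < s < N/(N-2)\<close>: the result is integrable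
  in \<open>\<rho>\<close> and sublinear in the supremum, which is therefore bounded. Second derivatives are controlled by
  the same Lipschitz estimate applied to difference quotients, because the nonlinearity is \<open>C\<^sup>1\<close>;
  applied to \<open>w\<^sub>n - w\<^sub>m\<close> it makes all derivatives locally uniformly Cauchy.
\<close>

section \<open>Integration by parts against compactly supported functions\<close>

text \<open>The third power is the lowest power of b = (\<rho>^2 - |y - x|^2)_+ that is C^2 across
  the sphere, so Green's identity applies to it classically and without boundary terms. Inside the
  ball its Laplacian is 24 |y - x|^2 b - 6 N b^2 = 6 (4 \<rho>^2 b - (N + 4) b^2). The integral of
  b^2 scales as \<rho>^(N + 4), and the bracket divided by \<rho>^(N + 5) is exactly the
  \<rho>-derivative of b^2 / \<rho>^(N + 4); this coincidence is the source of both exponents.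

  The obstacle to the pointwise bound is that the estimate at a point involves the supremum over a
  neighbourhood, which could be far larger than the value at the point. The solution is therefore
  maximised after multiplication by a power of the distance to the sphere. The interpolated
  derivative of the averages is of order \<rho>^(1 - N + N/s), integrable at 0 exactly when N - 2 <
  N/s, and it carries the supremum to the power p/s < 1.\<close>

definition pderiv_on ::
    "(real^'n::finite) set \<Rightarrow> 'n \<Rightarrow> (real^'n \<Rightarrow> real) \<Rightarrow> (real^'n \<Rightarrow> real) \<Rightarrow> bool" where
  "pderiv_on S i u u' \<longleftrightarrow> continuous_on S u \<and> continuous_on S u' \<and>
     (\<forall>x\<in>S. ((\<lambda>t. u (x + t *\<^sub>R axis i 1)) has_real_derivative u' x) (at 0))"

lemma pderiv_onI:
  assumes "continuous_on S u" "continuous_on S u'"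
    "\<And>x. x \<in> S \<Longrightarrow> ((\<lambda>t. u (x + t *\<^sub>R axis i 1)) has_real_derivative u' x) (at 0)"
  shows "pderiv_on S i u u'"
  using assms unfolding pderiv_on_def by blast

lemma pderiv_onD:
  assumes "pderiv_on S i u u'"
  shows "continuous_on S u" "continuous_on S u'"
    "x \<in> S \<Longrightarrow> ((\<lambda>t. u (x + t *\<^sub>R axis i 1)) has_real_derivative u' x) (at 0)"
  using assms unfolding pderiv_on_def by blast+

lemma pderiv_on_DERIV:
  assumes "pderiv_on S i u u'" "x + t *\<^sub>R axis i 1 \<in> S"
  shows "((\<lambda>t. u (x + t *\<^sub>R axis i 1)) has_real_derivative u' (x + t *\<^sub>R axis i 1)) (at t)"
proof -
  have "((\<lambda>s. u ((x + t *\<^sub>R axis i 1) + s *\<^sub>R axis i 1)) has_real_derivative u' (x + t *\<^sub>R axis i 1)) (at 0)"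
    using assms by (auto simp: pderiv_on_def)
  then show ?thesis
    using DERIV_shift[of "\<lambda>t. u (x + t *\<^sub>R axis i 1)" "u' (x + t *\<^sub>R axis i 1)" 0 t]
    by (simp add: algebra_simps)
qed

lemma pderiv_on_mono: "pderiv_on S i u u' \<Longrightarrow> T \<subseteq> S \<Longrightarrow> pderiv_on T i u u'"
  by (auto simp: pderiv_on_def intro: continuous_on_subset)

lemma pderiv_on_diff:
  "pderiv_on S i u u' \<Longrightarrow> pderiv_on S i v v' \<Longrightarrow> pderiv_on S i (\<lambda>x. u x - v x) (\<lambda>x. u' x - v' x)"
  by (intro pderiv_onI continuous_on_diff DERIV_diff; (rule pderiv_onD; assumption))

lemma pderiv_on_cmult:
  "pderiv_on S i u u' \<Longrightarrow> pderiv_on S i (\<lambda>x. c * u x) (\<lambda>x. c * u' x)"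
  by (intro pderiv_onI continuous_on_mult_left DERIV_cmult; (rule pderiv_onD; assumption))

lemma pderiv_on_mult:
  assumes "pderiv_on S i u u'" "pderiv_on S i v v'"
  shows "pderiv_on S i (\<lambda>x. u x * v x) (\<lambda>x. u' x * v x + u x * v' x)"
proof -
  have "((\<lambda>t. u (x + t *\<^sub>R axis i 1) * v (x + t *\<^sub>R axis i 1)) has_real_derivative u' x * v x + u x * v' x) (at 0)"
    if "x \<in> S" for x
  proof -
    have "((\<lambda>t. u (x + t *\<^sub>R axis i 1)) has_real_derivative u' x) (at 0)"
      "((\<lambda>t. v (x + t *\<^sub>R axis i 1)) has_real_derivative v' x) (at 0)"
      using assms that by (auto simp: pderiv_on_def)
    from DERIV_mult[OF this] show ?thesis by (simp add: ac_simps)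
  qed
  then show ?thesis
    by (intro pderiv_onI continuous_on_add continuous_on_mult) (use assms pderiv_onD in blast)+
qed

lemma pderiv_on_translate:
  assumes "pderiv_on S i u u'" "\<And>x. x \<in> T \<Longrightarrow> x + a \<in> S"
  shows "pderiv_on T i (\<lambda>x. u (x + a)) (\<lambda>x. u' (x + a))"
proof -
  have "((\<lambda>t. u (x + t *\<^sub>R axis i 1 + a)) has_real_derivative u' (x + a)) (at 0)" if "x \<in> T" for x
  proof -
    have "((\<lambda>t. u ((x + a) + t *\<^sub>R axis i 1)) has_real_derivative u' (x + a)) (at 0)"
      using assms(1) assms(2)[OF that] unfolding pderiv_on_def by blast
    moreover have "(\<lambda>t. (x + a) + t *\<^sub>R axis i 1) = (\<lambda>t. x + t *\<^sub>R axis i 1 + a)"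
      by (simp add: fun_eq_iff)
    ultimately show ?thesis by metis
  qed
  moreover have "continuous_on T (\<lambda>x. v (x + a))" if "continuous_on S v" for v :: "_ \<Rightarrow> real"
    by (rule continuous_on_compose2[OF that continuous_on_add[OF continuous_on_id continuous_on_const]])
      (simp add: image_subset_iff assms(2))
  ultimately show ?thesis using pderiv_onD(1,2)[OF assms(1)] by (intro pderiv_onI) simp_all
qed

lemma pderiv_on_eq_pdiff:
  assumes "pderiv_on S i u u'" "x \<in> S"
  shows "pdiff i u x = u' x"
  unfolding pdiff_def by (rule DERIV_imp_deriv[OF pderiv_onD(3)[OF assms]])

lemma C2_on_pderiv_on:
  assumes "C2_on S u"
  shows "pderiv_on S i u (pdiff i u)" "pderiv_on S j (pdiff i u) (pdiff j (pdiff i u))"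
proof -
  have D: "((\<lambda>t. v (x + t *\<^sub>R axis k 1)) has_real_derivative pdiff k v x) (at 0)"
    if "has_pdiff_on S v" "x \<in> S" for v k x
    using that unfolding has_pdiff_on_def pdiff_def by (simp add: DERIV_deriv_iff_field_differentiable)
  show "pderiv_on S i u (pdiff i u)" "pderiv_on S j (pdiff i u) (pdiff j (pdiff i u))"
    by (rule pderiv_onI; use assms D in \<open>simp add: C2_on_def\<close>)+
qed

lemma integral_translate:
  fixes f :: "'a::euclidean_space \<Rightarrow> real"
  assumes "f \<in> borel_measurable borel"
  shows "(\<integral>x. f (x + a) \<partial>lborel) = (\<integral>x. f x \<partial>lborel)"
proof -
  have "(\<integral>x. f x \<partial>lborel) = (\<integral>x. f x \<partial>distr lborel borel ((+) a))"
    by (simp add: lborel_distr_plus)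
  also have "\<dots> = (\<integral>x. f (a + x) \<partial>lborel)"
    by (rule integral_distr) (use assms in auto)
  finally show ?thesis by (simp add: add.commute)
qed

lemma integrable_continuous_compact_support:
  fixes f :: "'a::euclidean_space \<Rightarrow> real"
  assumes "continuous_on UNIV f" "compact K" "\<And>x. x \<notin> K \<Longrightarrow> f x = 0"
  shows "integrable lborel f"
proof -
  have "integrable lborel (\<lambda>x. indicator K x *\<^sub>R f x)"
    by (rule borel_integrable_compact) (use assms in \<open>auto intro: continuous_on_subset\<close>)
  moreover have "(\<lambda>x. indicator K x *\<^sub>R f x) = f"
    using assms(3) by (auto simp: indicator_def fun_eq_iff)
  ultimately show ?thesis by simp
qed

lemma eventually_line_mem:
  fixes x e :: "'a::real_normed_vector"
  assumes "open U" "x \<in> U"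
  shows "eventually (\<lambda>t. x + t *\<^sub>R e \<in> U) (nhds (0::real))"
proof (rule topological_tendstoD[OF _ assms(1)])
  have "((\<lambda>t. x + t *\<^sub>R e) \<longlongrightarrow> x + 0 *\<^sub>R e) (nhds (0::real))"
    by (intro tendsto_intros filterlim_ident)
  then show "((\<lambda>t. x + t *\<^sub>R e) \<longlongrightarrow> x) (nhds (0::real))" by simp
qed (rule assms(2))

lemma pderiv_on_zero_outside:
  assumes "pderiv_on UNIV i h h'" "closed K" "\<And>y. y \<notin> K \<Longrightarrow> h y = 0" "y \<notin> K"
  shows "h' y = 0"
proof -
  have "eventually (\<lambda>t. y + t *\<^sub>R axis i 1 \<in> - K) (nhds (0::real))"
    by (rule eventually_line_mem) (use assms in auto)
  then have "eventually (\<lambda>t. h (y + t *\<^sub>R axis i 1) = 0) (nhds (0::real))"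
    by eventually_elim (simp add: assms(3))
  moreover have "((\<lambda>t. h (y + t *\<^sub>R axis i 1)) has_real_derivative h' y) (at 0)"
    by (rule pderiv_onD(3)[OF assms(1)]) simp
  ultimately have "((\<lambda>t. 0) has_real_derivative h' y) (at (0::real))"
    by (rule DERIV_cong_ev[OF refl _ refl, THEN iffD1])
  then show ?thesis using DERIV_const DERIV_unique by blast
qed

text \<open>Translation invariance makes the integral of every difference quotient of
  \<open>h\<close> vanish, and dominated convergence carries this over to the derivative.\<close>

lemma integral_pderiv_zero:
  assumes h: "pderiv_on UNIV i h h'" and K: "compact K" and z: "\<And>y. y \<notin> K \<Longrightarrow> h y = 0"
  shows "(\<integral>y. h' y \<partial>lborel) = 0"
proof -
  let ?e = "axis i (1::real)"
  have ch: "continuous_on UNIV h" "continuous_on UNIV h'" using h by (auto simp: pderiv_on_def)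
  have z': "h' y = 0" if "y \<notin> K" for y
    using pderiv_on_zero_outside[OF h _ z that] K by (simp add: compact_imp_closed)
  obtain R where R: "\<And>y. y \<in> K \<Longrightarrow> norm y \<le> R"
    using compact_imp_bounded[OF K] by (auto simp: bounded_iff)
  have "bounded (h' ` K)"
    by (rule compact_imp_bounded, rule compact_continuous_image) (use ch K in \<open>auto intro: continuous_on_subset\<close>)
  then obtain B0 where B0: "\<And>y. y \<in> K \<Longrightarrow> \<bar>h' y\<bar> \<le> B0" by (auto simp: bounded_iff)
  define B where "B = max B0 0"
  have B: "\<bar>h' y\<bar> \<le> B" for y using B0[of y] z'[of y] by (cases "y \<in> K") (auto simp: B_def)
  define s where "s k y = (h (y + inverse (real (Suc k)) *\<^sub>R ?e) - h y) / inverse (real (Suc k))" for k y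
  have int: "integrable lborel h"
    using integrable_continuous_compact_support[OF ch(1) K z] by auto
  have meas: "h \<in> borel_measurable borel" "h' \<in> borel_measurable borel"
    using ch by (auto intro: borel_measurable_continuous_onI)
  \<comment> \<open>The increments have length at most 1, so off the ball of radius
    \<open>R + 1\<close> both points of the quotient lie outside \<open>K\<close>; elsewhere the
    mean value theorem bounds it by \<open>B\<close>.\<close>
  have "(\<lambda>k. \<integral>y. s k y \<partial>lborel) \<longlonglongrightarrow> (\<integral>y. h' y \<partial>lborel)"
  proof (rule integral_dominated_convergence[where w = "\<lambda>y. B * indicator (cball 0 (R + 1)) y"])
    show "h' \<in> borel_measurable lborel" "\<And>k. s k \<in> borel_measurable lborel"
      using meas unfolding s_def by auto
    show "integrable lborel (\<lambda>y. B * indicator (cball 0 (R + 1)) y)"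
      by (intro integrable_mult_right integrable_real_indicator) (use emeasure_lborel_cball_finite[of 0 "R + 1"] in auto)
    show "AE y in lborel. (\<lambda>k. s k y) \<longlonglongrightarrow> h' y"
    proof (rule AE_I2)
      fix y
      have "((\<lambda>t. (h (y + t *\<^sub>R ?e) - h y) / t) \<longlongrightarrow> h' y) (at 0)"
        using h by (auto simp: pderiv_on_def has_field_derivative_iff)
      then show "(\<lambda>k. s k y) \<longlonglongrightarrow> h' y"
        unfolding s_def
        by (rule filterlim_compose) (use LIMSEQ_inverse_real_of_nat in \<open>auto simp: filterlim_at\<close>)
    qed
    show "AE y in lborel. norm (s k y) \<le> B * indicator (cball 0 (R + 1)) y" for k
    proof (rule AE_I2)
      fix y
      let ?t = "inverse (real (Suc k))"
      have t: "0 < ?t" "?t \<le> 1" by (auto simp: inverse_le_1_iff)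
      obtain \<xi> where "h (y + ?t *\<^sub>R ?e) - h (y + 0 *\<^sub>R ?e) = (?t - 0) * h' (y + \<xi> *\<^sub>R ?e)"
        using MVT2[of 0 ?t "\<lambda>t. h (y + t *\<^sub>R ?e)" "\<lambda>t. h' (y + t *\<^sub>R ?e)"] t pderiv_on_DERIV[OF h]
        by auto
      then have 1: "s k y = h' (y + \<xi> *\<^sub>R ?e)" unfolding s_def using t by (simp add: field_simps)
      show "norm (s k y) \<le> B * indicator (cball 0 (R + 1)) y"
      proof (cases "norm y \<le> R + 1")
        case True then show ?thesis using B 1 by simp
      next
        case False
        have "norm (y + ?t *\<^sub>R ?e) \<ge> norm y - norm (?t *\<^sub>R ?e)" using norm_triangle_ineq2[of y "- (?t *\<^sub>R ?e)"] by simp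
        moreover have "norm (?t *\<^sub>R ?e) \<le> 1" using t by simp
        ultimately have "y \<notin> K" "y + ?t *\<^sub>R ?e \<notin> K" using False R by fastforce+
        then show ?thesis using z unfolding s_def B_def by auto
      qed
    qed
  qed
  moreover have "(\<integral>y. s k y \<partial>lborel) = 0" for k
  proof -
    let ?a = "inverse (real (Suc k)) *\<^sub>R ?e"
    have i2: "integrable lborel (\<lambda>y. h (y + ?a))"
    proof (rule integrable_continuous_compact_support)
      show "continuous_on UNIV (\<lambda>y. h (y + ?a))"
        using ch(1) by (intro continuous_on_compose2[OF ch(1)] continuous_intros) auto
      show "compact ((\<lambda>x. x - ?a) ` K)"
        using K by (intro compact_continuous_image continuous_intros)
      show "h (y + ?a) = 0" if "y \<notin> (\<lambda>x. x - ?a) ` K" for y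
        using that by (intro z) (auto simp: image_iff dest!: bspec[where x="y + ?a"])
    qed
    show ?thesis unfolding s_def
      using int i2 integral_translate[OF meas(1), of ?a] by simp
  qed
  ultimately show ?thesis by (simp add: LIMSEQ_const_iff)
qed

text \<open>Nothing is known of \<open>u\<close> outside \<Omega>, but the open sets \<Omega> and
  \<open>- K\<close> cover the space, and on the second one the product is 0.\<close>

lemma continuous_on_mult_support:
  fixes u \<phi> :: "'a::t2_space \<Rightarrow> real"
  assumes "open \<Omega>" "continuous_on \<Omega> u" "continuous_on UNIV \<phi>" "compact K" "K \<subseteq> \<Omega>" "\<And>y. y \<notin> K \<Longrightarrow> \<phi> y = 0"
  shows "continuous_on UNIV (\<lambda>y. u y * \<phi> y)"
proof -
  have "continuous_on \<Omega> (\<lambda>y. u y * \<phi> y)"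
    using assms by (intro continuous_intros) (auto intro: continuous_on_subset)
  moreover have "continuous_on (- K) (\<lambda>y. u y * \<phi> y)"
    using assms by (subst continuous_on_cong[OF refl, of _ _ "\<lambda>_. 0"]) auto
  ultimately have "continuous_on (\<Omega> \<union> - K) (\<lambda>y. u y * \<phi> y)"
    using assms by (intro continuous_on_open_Un) (auto simp: compact_imp_closed)
  moreover have "\<Omega> \<union> - K = UNIV" using assms by auto
  ultimately show ?thesis by simp
qed

lemma integrable_mult_support:
  fixes u \<phi> :: "'a::euclidean_space \<Rightarrow> real"
  assumes "open \<Omega>" "continuous_on \<Omega> u" "continuous_on UNIV \<phi>" "compact K" "K \<subseteq> \<Omega>" "\<And>y. y \<notin> K \<Longrightarrow> \<phi> y = 0"
  shows "integrable lborel (\<lambda>y. u y * \<phi> y)"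
  by (rule integrable_continuous_compact_support[OF continuous_on_mult_support[OF assms]])
    (use assms in auto)

text \<open>The product of \<open>u\<close> and \<open>\<phi>\<close> is partially differentiable on
  the whole space, because it vanishes near every point outside \<Omega>; hence its derivative
  integrates to 0.\<close>

lemma integration_by_parts:
  assumes \<Omega>: "open \<Omega>" and u: "pderiv_on \<Omega> i u u'" and \<phi>: "pderiv_on UNIV i \<phi> \<phi>'"
    and K: "compact K" "K \<subseteq> \<Omega>" "\<And>y. y \<notin> K \<Longrightarrow> \<phi> y = 0"
  shows "(\<integral>y. u' y * \<phi> y \<partial>lborel) = - (\<integral>y. u y * \<phi>' y \<partial>lborel)"
proof -
  have z': "\<phi>' y = 0" if "y \<notin> K" for y
    using pderiv_on_zero_outside[OF \<phi> _ K(3) that] K by (simp add: compact_imp_closed)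
  have c: "continuous_on \<Omega> u" "continuous_on \<Omega> u'" "continuous_on UNIV \<phi>" "continuous_on UNIV \<phi>'"
    using u \<phi> by (auto simp: pderiv_on_def)
  have "pderiv_on UNIV i (\<lambda>y. u y * \<phi> y) (\<lambda>y. u' y * \<phi> y + u y * \<phi>' y)"
    unfolding pderiv_on_def
  proof (intro conjI ballI)
    show "continuous_on UNIV (\<lambda>y. u y * \<phi> y)"
      by (rule continuous_on_mult_support[OF \<Omega> c(1,3) K])
    show "continuous_on UNIV (\<lambda>y. u' y * \<phi> y + u y * \<phi>' y)"
      by (intro continuous_on_add continuous_on_mult_support[OF \<Omega> c(2,3) K] continuous_on_mult_support[OF \<Omega> c(1,4) K(1,2) z'])
    fix x
    show "((\<lambda>t. u (x + t *\<^sub>R axis i 1) * \<phi> (x + t *\<^sub>R axis i 1)) has_real_derivative u' x * \<phi> x + u x * \<phi>' x) (at 0)"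
    proof (cases "x \<in> \<Omega>")
      case True
      have "pderiv_on \<Omega> i \<phi> \<phi>'" using \<phi> pderiv_on_mono by blast
      from pderiv_on_mult[OF u this] True show ?thesis by (auto simp: pderiv_on_def)
    next
      case False
      then have x: "x \<in> - K" using K by auto
      have "eventually (\<lambda>t. x + t *\<^sub>R axis i 1 \<in> - K) (nhds (0::real))"
        by (rule eventually_line_mem) (use K x in \<open>auto simp: compact_imp_closed\<close>)
      then have "eventually (\<lambda>t. u (x + t *\<^sub>R axis i 1) * \<phi> (x + t *\<^sub>R axis i 1) = 0) (nhds (0::real))"
        by eventually_elim (use K in auto)
      moreover have "u' x * \<phi> x + u x * \<phi>' x = 0" using x K z' by auto
      ultimately show ?thesis by (subst DERIV_cong_ev[OF refl _ refl, where g="\<lambda>_. 0"]) auto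
    qed
  qed
  from integral_pderiv_zero[OF this K(1)] K(3)
  have "(\<integral>y. u' y * \<phi> y + u y * \<phi>' y \<partial>lborel) = 0" by simp
  moreover have "integrable lborel (\<lambda>y. u' y * \<phi> y)" "integrable lborel (\<lambda>y. u y * \<phi>' y)"
    using integrable_mult_support[OF \<Omega> c(2,3) K] integrable_mult_support[OF \<Omega> c(1,4) K(1,2) z'] by auto
  ultimately show ?thesis by simp
qed

section \<open>Functions with continuous pure second derivatives, and Green's identity\<close>

text \<open>The derivatives are existentially quantified witnesses rather than values of
  \<open>pdiff\<close>, which makes the class visibly closed under restriction, differences,
  multiples and translations. Pure second derivatives are what Green's identity consumes.\<close>

definition has_laplacian_on ::
    "(real^'n::finite) set \<Rightarrow> (real^'n \<Rightarrow> real) \<Rightarrow> (real^'n \<Rightarrow> real) \<Rightarrow> bool" where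
  "has_laplacian_on S u g \<longleftrightarrow> (\<exists>U V. (\<forall>i. pderiv_on S i u (U i) \<and> pderiv_on S i (U i) (V i)) \<and>
      (\<forall>x\<in>S. g x = (\<Sum>i\<in>UNIV. V i x)))"

lemma has_laplacian_onI:
  assumes "\<And>i. pderiv_on S i u (U i)" "\<And>i. pderiv_on S i (U i) (V i)"
    "\<And>x. x \<in> S \<Longrightarrow> g x = (\<Sum>i\<in>UNIV. V i x)"
  shows "has_laplacian_on S u g"
  unfolding has_laplacian_on_def
  by (rule exI[of _ U], rule exI[of _ V]) (simp add: assms)

lemma has_laplacian_onE:
  assumes "has_laplacian_on S u g"
  obtains U V where "\<And>i. pderiv_on S i u (U i)" "\<And>i. pderiv_on S i (U i) (V i)"
    "\<And>x. x \<in> S \<Longrightarrow> g x = (\<Sum>i\<in>UNIV. V i x)"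
proof -
  obtain U V where "(\<forall>i. pderiv_on S i u (U i) \<and> pderiv_on S i (U i) (V i)) \<and>
      (\<forall>x\<in>S. g x = (\<Sum>i\<in>UNIV. V i x))"
    using assms unfolding has_laplacian_on_def by (elim exE)
  then show ?thesis by (intro that[of U V]) simp_all
qed

lemma C2_on_has_laplacian_on: "C2_on S u \<Longrightarrow> has_laplacian_on S u (laplacian u)"
  by (rule has_laplacian_onI[of _ _ "\<lambda>i. pdiff i u" "\<lambda>i. pdiff i (pdiff i u)"])
    (simp_all add: C2_on_pderiv_on laplacian_def)

lemma has_laplacian_on_mono:
  assumes "has_laplacian_on S u g" "T \<subseteq> S"
  shows "has_laplacian_on T u g"
proof -
  obtain U V where *: "\<And>i. pderiv_on S i u (U i)" "\<And>i. pderiv_on S i (U i) (V i)"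
      "\<And>x. x \<in> S \<Longrightarrow> g x = (\<Sum>i\<in>UNIV. V i x)"
    using has_laplacian_onE[OF assms(1)] by blast
  show ?thesis
    by (rule has_laplacian_onI[of _ _ U V]) (use * assms(2) in \<open>auto intro: pderiv_on_mono[where S=S]\<close>)
qed

lemma has_laplacian_on_cong:
  assumes "has_laplacian_on S u g" "\<And>x. x \<in> S \<Longrightarrow> g x = h x"
  shows "has_laplacian_on S u h"
proof -
  obtain U V where *: "\<And>i. pderiv_on S i u (U i)" "\<And>i. pderiv_on S i (U i) (V i)"
      "\<And>x. x \<in> S \<Longrightarrow> g x = (\<Sum>i\<in>UNIV. V i x)"
    using has_laplacian_onE[OF assms(1)] by blast
  show ?thesis
    by (rule has_laplacian_onI[of _ _ U V]) (simp_all add: * flip: assms(2))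
qed

lemma has_laplacian_on_diff:
  assumes "has_laplacian_on S u g" "has_laplacian_on S v h"
  shows "has_laplacian_on S (\<lambda>x. u x - v x) (\<lambda>x. g x - h x)"
proof -
  obtain U V where *: "\<And>i. pderiv_on S i u (U i)" "\<And>i. pderiv_on S i (U i) (V i)"
      "\<And>x. x \<in> S \<Longrightarrow> g x = (\<Sum>i\<in>UNIV. V i x)"
    using has_laplacian_onE[OF assms(1)] by blast
  obtain U' V' where **: "\<And>i. pderiv_on S i v (U' i)" "\<And>i. pderiv_on S i (U' i) (V' i)"
      "\<And>x. x \<in> S \<Longrightarrow> h x = (\<Sum>i\<in>UNIV. V' i x)"
    using has_laplacian_onE[OF assms(2)] by blast
  show ?thesis
    by (rule has_laplacian_onI[of _ _ "\<lambda>i x. U i x - U' i x" "\<lambda>i x. V i x - V' i x"])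
      (simp_all add: * ** sum_subtractf pderiv_on_diff)
qed

lemma has_laplacian_on_cmult:
  assumes "has_laplacian_on S u g"
  shows "has_laplacian_on S (\<lambda>x. c * u x) (\<lambda>x. c * g x)"
proof -
  obtain U V where *: "\<And>i. pderiv_on S i u (U i)" "\<And>i. pderiv_on S i (U i) (V i)"
      "\<And>x. x \<in> S \<Longrightarrow> g x = (\<Sum>i\<in>UNIV. V i x)"
    using has_laplacian_onE[OF assms(1)] by blast
  show ?thesis
    by (rule has_laplacian_onI[of _ _ "\<lambda>i x. c * U i x" "\<lambda>i x. c * V i x"])
      (simp_all add: * sum_distrib_left pderiv_on_cmult)
qed

lemma has_laplacian_on_translate:
  assumes "has_laplacian_on S u g" "\<And>x. x \<in> T \<Longrightarrow> x + a \<in> S"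
  shows "has_laplacian_on T (\<lambda>x. u (x + a)) (\<lambda>x. g (x + a))"
proof -
  obtain U V where *: "\<And>i. pderiv_on S i u (U i)" "\<And>i. pderiv_on S i (U i) (V i)"
      "\<And>x. x \<in> S \<Longrightarrow> g x = (\<Sum>i\<in>UNIV. V i x)"
    using has_laplacian_onE[OF assms(1)] by blast
  show ?thesis
    by (rule has_laplacian_onI[of _ _ "\<lambda>i x. U i (x + a)" "\<lambda>i x. V i (x + a)"])
      (simp_all add: * assms(2) pderiv_on_translate[where S=S and T=T])
qed

lemma has_laplacian_on_continuous:
  assumes "has_laplacian_on S u g"
  shows "continuous_on S u" "continuous_on S g"
proof -
  obtain U V where *: "\<And>i. pderiv_on S i u (U i)" "\<And>i. pderiv_on S i (U i) (V i)"
      "\<And>x. x \<in> S \<Longrightarrow> g x = (\<Sum>i\<in>UNIV. V i x)"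
    using has_laplacian_onE[OF assms(1)] by blast
  show "continuous_on S u" using pderiv_onD(1)[OF *(1)] .
  have "continuous_on S (\<lambda>x. \<Sum>i\<in>UNIV. V i x)"
    by (intro continuous_on_sum pderiv_onD(2)[OF *(2)])
  then show "continuous_on S g" using *(3) by (simp cong: continuous_on_cong)
qed

text \<open>Each coordinate is integrated by parts twice; the derivatives of \<open>\<phi>\<close>
  vanish off the same compact set, so the second step is as free of boundary terms as the
  first.\<close>

lemma Green_identity:
  assumes \<Omega>: "open \<Omega>" and u: "has_laplacian_on \<Omega> u g"
    and \<phi>: "\<And>i. pderiv_on UNIV i \<phi> (\<phi>' i)" "\<And>i. pderiv_on UNIV i (\<phi>' i) (\<phi>'' i)"
    and K: "compact K" "K \<subseteq> \<Omega>" "\<And>y. y \<notin> K \<Longrightarrow> \<phi> y = 0"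
  shows "(\<integral>y. g y * \<phi> y \<partial>lborel) = (\<integral>y. u y * (\<Sum>i\<in>UNIV. \<phi>'' i y) \<partial>lborel)"
proof -
  obtain U V where *: "\<And>i. pderiv_on \<Omega> i u (U i)" "\<And>i. pderiv_on \<Omega> i (U i) (V i)" "\<And>x. x \<in> \<Omega> \<Longrightarrow> g x = (\<Sum>i\<in>UNIV. V i x)"
    using has_laplacian_onE[OF u] by blast
  have c: "continuous_on \<Omega> u" "\<And>i. continuous_on \<Omega> (V i)" "continuous_on UNIV \<phi>" "\<And>i. continuous_on UNIV (\<phi>'' i)"
    using *(1,2) \<phi> pderiv_onD by blast+
  have z: "\<phi>' i y = 0" if "y \<notin> K" for y i
    using pderiv_on_zero_outside[OF \<phi>(1) _ K(3) that] K by (simp add: compact_imp_closed)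
  have zz: "\<phi>'' i y = 0" if "y \<notin> K" for y i
    using pderiv_on_zero_outside[OF \<phi>(2) _ z that] K by (simp add: compact_imp_closed)
  have "(\<integral>y. g y * \<phi> y \<partial>lborel) = (\<integral>y. (\<Sum>i\<in>UNIV. V i y * \<phi> y) \<partial>lborel)"
  proof (rule Bochner_Integration.integral_cong[OF refl])
    show "g y * \<phi> y = (\<Sum>i\<in>UNIV. V i y * \<phi> y)" for y
      using *(3)[of y] K by (cases "y \<in> K") (auto simp: sum_distrib_right)
  qed
  also have "\<dots> = (\<Sum>i\<in>UNIV. \<integral>y. V i y * \<phi> y \<partial>lborel)"
    by (rule Bochner_Integration.integral_sum) (rule integrable_mult_support[OF \<Omega> c(2,3) K])
  also have "\<dots> = (\<Sum>i\<in>UNIV. \<integral>y. u y * \<phi>'' i y \<partial>lborel)"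
    using integration_by_parts[OF \<Omega> *(2) \<phi>(1) K] integration_by_parts[OF \<Omega> *(1) \<phi>(2) K(1,2) z] by simp
  also have "\<dots> = (\<integral>y. (\<Sum>i\<in>UNIV. u y * \<phi>'' i y) \<partial>lborel)"
    by (rule Bochner_Integration.integral_sum[symmetric]) (rule integrable_mult_support[OF \<Omega> c(1,4) K(1,2) zz])
  finally show ?thesis by (simp add: sum_distrib_left)
qed

section \<open>Weighted averages over balls\<close>

text \<open>A polynomial cut off at 0: its derivatives in space and in the radius are explicit, and
  for R > 0 its m-th power is of class C^(m - 1) across the sphere.\<close>

definition bump :: "real \<Rightarrow> real^'n::finite \<Rightarrow> real^'n \<Rightarrow> real" where
  "bump R x y = max (R\<^sup>2 - (dist x y)\<^sup>2) 0"

lemma bump_nonneg: "0 \<le> bump R x y"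
  by (simp add: bump_def)

lemma bump_le: "bump R x y \<le> R\<^sup>2"
  by (simp add: bump_def)

lemma bump_eq_0: "0 \<le> R \<Longrightarrow> y \<notin> ball x R \<Longrightarrow> bump R x y = 0"
  by (simp add: bump_def)

lemma continuous_on_bump: "continuous_on A (bump R x)"
  unfolding bump_def by (intro continuous_intros)

text \<open>The exponent is at least 2, so that the kink disappears: at 0 the Caratheodory slope is
  \<open>max z 0 ^ Suc k\<close>, continuous with value 0.\<close>

lemma DERIV_pos_part_power:
  "((\<lambda>t::real. max t 0 ^ Suc (Suc k)) has_real_derivative real (Suc (Suc k)) * max t 0 ^ Suc k) (at t)"
proof (cases t "0::real" rule: linorder_cases)
  case less
  have "eventually (\<lambda>s. s \<in> {..<0}) (nhds t)" using less by (intro eventually_nhds_in_open) auto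
  then have "eventually (\<lambda>s. max s 0 ^ Suc (Suc k) = 0) (nhds t)" by eventually_elim (simp add: max_def)
  then have "((\<lambda>t. max t 0 ^ Suc (Suc k)) has_real_derivative 0) (at t)"
    by (rule DERIV_cong_ev[OF refl _ refl, THEN iffD2]) simp
  moreover have "max t 0 = 0" using less by simp
  ultimately show ?thesis by simp
next
  case greater
  have "eventually (\<lambda>s. s \<in> {0<..}) (nhds t)" using greater by (intro eventually_nhds_in_open) auto
  then have "eventually (\<lambda>s. max s 0 ^ Suc (Suc k) = s ^ Suc (Suc k)) (nhds t)" by eventually_elim (simp add: max_def)
  moreover have "((\<lambda>s. s ^ Suc (Suc k)) has_real_derivative real (Suc (Suc k)) * t ^ Suc k) (at t)"
    using DERIV_pow[of "Suc (Suc k)" t] by simp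
  moreover have "max t 0 = t" using greater by simp
  ultimately show ?thesis using DERIV_cong_ev[OF refl _ refl, THEN iffD2] by metis
next
  case equal
  have "isCont (\<lambda>z::real. max z 0 ^ Suc k) 0" by (intro continuous_intros)
  moreover have "max z 0 ^ Suc (Suc k) = max z 0 ^ Suc k * z" for z :: real
    by (cases "z \<ge> 0") (simp_all add: max_def)
  ultimately show ?thesis unfolding equal
    by (subst CARAT_DERIV) (auto intro!: exI[of _ "\<lambda>z. max z 0 ^ Suc k"])
qed

lemma dist_sq_vec: "(dist x y)\<^sup>2 = (\<Sum>i\<in>UNIV. ((y - x) $ i)\<^sup>2)" for x y :: "real^'n::finite"
  by (simp add: dist_norm norm_vec_def L2_set_def sum_nonneg power2_commute)

lemma DERIV_bump_arg:
  "((\<lambda>t. R\<^sup>2 - (dist x (y + t *\<^sub>R axis i 1))\<^sup>2) has_real_derivative - 2 * (y - x) $ i) (at 0)"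
  for x y :: "real^'n::finite"
proof -
  have eq: "R\<^sup>2 - (dist x (y + t *\<^sub>R axis i 1))\<^sup>2 = R\<^sup>2 - (dist x y)\<^sup>2 - 2 * t * ((y - x) $ i) - t\<^sup>2" for t
  proof -
    have "(dist x (y + t *\<^sub>R axis i 1))\<^sup>2 = ((y - x) + t *\<^sub>R axis i 1) \<bullet> ((y - x) + t *\<^sub>R axis i 1)"
      by (subst dist_commute) (simp add: dist_norm power2_norm_eq_inner algebra_simps)
    also have "\<dots> = (y - x) \<bullet> (y - x) + 2 * t * ((y - x) $ i) + t\<^sup>2"
      by (simp add: inner_add_left inner_add_right inner_axis inner_axis_axis inner_commute power2_eq_square algebra_simps)
    also have "(y - x) \<bullet> (y - x) = (dist x y)\<^sup>2"
      by (subst dist_commute) (simp add: dist_norm power2_norm_eq_inner)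
    finally show ?thesis by simp
  qed
  show ?thesis unfolding eq by (auto intro!: derivative_eq_intros)
qed

lemma pderiv_on_bump_power:
  "pderiv_on UNIV i (\<lambda>y. bump R x y ^ Suc (Suc k))
     (\<lambda>y. real (Suc (Suc k)) * bump R x y ^ Suc k * (- 2 * (y - x) $ i))"
proof (rule pderiv_onI)
  fix y
  show "((\<lambda>t. bump R x (y + t *\<^sub>R axis i 1) ^ Suc (Suc k)) has_real_derivative
      real (Suc (Suc k)) * bump R x y ^ Suc k * (- 2 * (y - x) $ i)) (at 0)"
    using DERIV_chain2[OF DERIV_pos_part_power DERIV_bump_arg] by (simp add: bump_def)
qed (intro continuous_intros continuous_on_bump)+

lemma pderiv_on_bump_power2:
  "pderiv_on UNIV i (\<lambda>y. real (Suc (Suc (Suc k))) * bump R x y ^ Suc (Suc k) * (- 2 * (y - x) $ i))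
     (\<lambda>y. real (Suc (Suc (Suc k))) * (real (Suc (Suc k)) * bump R x y ^ Suc k * (- 2 * (y - x) $ i) * (- 2 * (y - x) $ i)
           - 2 * bump R x y ^ Suc (Suc k)))"
proof (rule pderiv_onI)
  fix y
  let ?e = "axis i (1::real)"
  let ?m = "real (Suc (Suc (Suc k)))"
  have 1: "((\<lambda>t. bump R x (y + t *\<^sub>R ?e) ^ Suc (Suc k)) has_real_derivative
      real (Suc (Suc k)) * bump R x y ^ Suc k * (- 2 * (y - x) $ i)) (at 0)"
    by (rule pderiv_onD(3)[OF pderiv_on_bump_power]) simp
  have 2: "((\<lambda>t. - 2 * (y + t *\<^sub>R ?e - x) $ i) has_real_derivative - 2) (at 0)"
    by (auto intro!: derivative_eq_intros)
  have "((\<lambda>t. ?m * (bump R x (y + t *\<^sub>R ?e) ^ Suc (Suc k) * (- 2 * (y + t *\<^sub>R ?e - x) $ i))) has_real_derivative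
     ?m * (real (Suc (Suc k)) * bump R x y ^ Suc k * (- 2 * (y - x) $ i) * (- 2 * (y - x) $ i)
         - 2 * bump R x y ^ Suc (Suc k))) (at 0)"
    using DERIV_cmult[OF DERIV_mult[OF 1 2], where c="?m"] by simp
  then show "((\<lambda>t. ?m * bump R x (y + t *\<^sub>R ?e) ^ Suc (Suc k) * (- 2 * (y + t *\<^sub>R ?e - x) $ i)) has_real_derivative
     ?m * (real (Suc (Suc k)) * bump R x y ^ Suc k * (- 2 * (y - x) $ i) * (- 2 * (y - x) $ i)
         - 2 * bump R x y ^ Suc (Suc k))) (at 0)"
    by (simp only: mult.assoc)
qed (intro continuous_intros continuous_on_bump)+

text \<open>For b = \<open>bump R x\<close>, \<Delta>(b^m) = m (m - 1) b^(m - 2) |grad b|^2 + m b^(m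
  - 1) \<Delta>b, where grad b = - 2 (y - x) and \<Delta>b = - 2 N inside the ball. The shift by 3
  keeps the test function of class C^2.\<close>

lemma Green_bump:
  fixes x :: "real^'n::finite" and k :: nat
  assumes \<Omega>: "open \<Omega>" and u: "has_laplacian_on \<Omega> u g" and R: "0 \<le> R" "cball x R \<subseteq> \<Omega>"
  defines "m \<equiv> real (k + 3)"
  shows "(\<integral>y. g y * bump R x y ^ (k + 3) \<partial>lborel) =
    (\<integral>y. u y * (4 * m * (m - 1) * (dist x y)\<^sup>2 * bump R x y ^ (k + 1) - 2 * m * CARD('n) * bump R x y ^ (k + 2)) \<partial>lborel)"
proof -
  have "(\<integral>y. g y * bump R x y ^ Suc (Suc (Suc k)) \<partial>lborel) =
    (\<integral>y. u y * (\<Sum>i\<in>UNIV. real (Suc (Suc (Suc k))) * (real (Suc (Suc k)) * bump R x y ^ Suc k * (- 2 * (y - x) $ i) * (- 2 * (y - x) $ i)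
           - 2 * bump R x y ^ Suc (Suc k))) \<partial>lborel)"
    by (rule Green_identity[OF \<Omega> u pderiv_on_bump_power pderiv_on_bump_power2 _ R(2)])
      (use R in \<open>auto simp: bump_eq_0\<close>)
  moreover have "(\<Sum>i\<in>UNIV. real (Suc (Suc (Suc k))) * (real (Suc (Suc k)) * bump R x y ^ Suc k * (- 2 * (y - x) $ i) * (- 2 * (y - x) $ i)
           - 2 * bump R x y ^ Suc (Suc k))) =
     4 * m * (m - 1) * (dist x y)\<^sup>2 * bump R x y ^ (k + 1) - 2 * m * CARD('n) * bump R x y ^ (k + 2)" for y
  proof -
    have eq: "real (Suc (Suc (Suc k))) * (real (Suc (Suc k)) * bump R x y ^ Suc k * (- 2 * (y - x) $ i) * (- 2 * (y - x) $ i)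
           - 2 * bump R x y ^ Suc (Suc k))
      = 4 * m * (m - 1) * bump R x y ^ (k + 1) * ((y - x) $ i)\<^sup>2 - 2 * m * bump R x y ^ (k + 2)" for i
      unfolding m_def by (simp add: power2_eq_square algebra_simps del: vector_minus_component)
    show ?thesis
      unfolding eq dist_sq_vec sum_subtractf sum_distrib_left[symmetric] sum_constant by simp
  qed
  ultimately show ?thesis by (simp add: numeral_3_eq_3 numeral_2_eq_2)
qed

lemma lebesgue_integral_eq_cbox:
  fixes h :: "'a::euclidean_space \<Rightarrow> real"
  assumes "continuous_on UNIV h" "\<And>y. y \<notin> cbox a b \<Longrightarrow> h y = 0"
  shows "(\<integral>y. h y \<partial>lborel) = integral (cbox a b) h"
proof -
  have "integrable lborel h"
    by (rule integrable_continuous_compact_support[OF assms(1) compact_cbox assms(2)])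
  then have "(\<integral>y. h y \<partial>lborel) = integral UNIV h" by (simp add: integral_lborel)
  also have "\<dots> = integral UNIV (\<lambda>y. if y \<in> cbox a b then h y else 0)"
    by (rule arg_cong[where f="integral UNIV"]) (use assms(2) in auto)
  also have "\<dots> = integral (cbox a b) h" by (rule integral_restrict_UNIV)
  finally show ?thesis .
qed

text \<open>The moving sphere contributes nothing, because the squared weight is C^1 in the radius
  even where it is cut off; its derivative is 2 b times 2 \<rho>.\<close>

lemma DERIV_integral_bump:
  fixes x :: "real^'n::finite"
  assumes u: "continuous_on \<Omega> u" and R: "ball x R \<subseteq> \<Omega>" and \<rho>: "0 < \<rho>" "\<rho> < R"
  shows "((\<lambda>\<rho>. \<integral>y. u y * bump \<rho> x y ^ 2 \<partial>lborel) has_real_derivative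
     4 * \<rho> * (\<integral>y. u y * bump \<rho> x y \<partial>lborel)) (at \<rho>)"
proof -
  \<comment> \<open>The closed ball of radius \<open>R'\<close> lies in \<Omega> and contains the
    supports for all radii near \<open>\<rho>\<close>, so one domain of integration serves a
    neighbourhood of \<open>\<rho>\<close>.\<close>
  define R' where "R' = (\<rho> + R) / 2"
  have R': "0 < R'" "\<rho> < R'" "cball x R' \<subseteq> \<Omega>" using \<rho> R unfolding R'_def by (auto simp: subset_iff)
  \<comment> \<open>a continuous extension to the whole space, as the Leibniz rule is available on boxes only\<close>
  define v where "v y = u (closest_point (cball x R') y)" for y
  have ne: "cball x R' \<noteq> {}" using R' by auto
  have cv: "continuous_on UNIV v"
    unfolding v_def
  proof (rule continuous_on_compose2[OF continuous_on_subset[OF u R'(3)]])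
    show "continuous_on UNIV (closest_point (cball x R'))"
      by (rule continuous_on_closest_point[OF convex_cball closed_cball ne])
    show "closest_point (cball x R') ` UNIV \<subseteq> cball x R'"
      using closest_point_in_set[OF closed_cball ne] by auto
  qed
  have veq: "v y = u y" if "y \<in> cball x R'" for y
    unfolding v_def using that by (simp add: closest_point_self)
  obtain a b where ab: "cball x R' \<subseteq> cbox a b"
    using bounded_subset_cbox_symmetric[OF bounded_cball] by blast
  have eq: "(\<integral>y. u y * bump \<sigma> x y ^ k \<partial>lborel) = integral (cbox a b) (\<lambda>y. v y * bump \<sigma> x y ^ k)"
    if "\<sigma> \<in> {0<..<R'}" "k > 0" for \<sigma> k
  proof -
    have z: "bump \<sigma> x y = 0" if "y \<notin> cball x R'" for y
      using that \<open>\<sigma> \<in> _\<close> by (intro bump_eq_0) auto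
    have "(\<integral>y. u y * bump \<sigma> x y ^ k \<partial>lborel) = (\<integral>y. v y * bump \<sigma> x y ^ k \<partial>lborel)"
    proof (rule Bochner_Integration.integral_cong[OF refl])
      show "u y * bump \<sigma> x y ^ k = v y * bump \<sigma> x y ^ k" for y
        using veq[of y] z[of y] that by (cases "y \<in> cball x R'") auto
    qed
    also have "\<dots> = integral (cbox a b) (\<lambda>y. v y * bump \<sigma> x y ^ k)"
    proof (rule lebesgue_integral_eq_cbox)
      show "continuous_on UNIV (\<lambda>y. v y * bump \<sigma> x y ^ k)"
        by (intro continuous_intros cv continuous_on_bump)
      show "v y * bump \<sigma> x y ^ k = 0" if "y \<notin> cbox a b" for y
        using z[OF contra_subsetD[OF ab that]] \<open>k > 0\<close> by simp
    qed
    finally show ?thesis .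
  qed
  have D: "((\<lambda>\<sigma>. integral (cbox a b) (\<lambda>y. v y * bump \<sigma> x y ^ 2)) has_real_derivative
      integral (cbox a b) (\<lambda>y. v y * (2 * bump \<rho> x y * (2 * \<rho>)))) (at \<rho> within {0<..<R'})"
  proof (rule leibniz_rule_field_derivative)
    fix \<sigma> y
    have "((\<lambda>\<sigma>. \<sigma>\<^sup>2 - (dist x y)\<^sup>2) has_real_derivative 2 * \<sigma>) (at \<sigma>)"
      by (auto intro!: derivative_eq_intros)
    from DERIV_chain2[OF DERIV_pos_part_power[of 0] this]
    have "((\<lambda>\<sigma>. bump \<sigma> x y ^ 2) has_real_derivative 2 * bump \<sigma> x y * (2 * \<sigma>)) (at \<sigma>)"
      by (simp add: bump_def numeral_2_eq_2)
    then show "((\<lambda>\<sigma>. v y * bump \<sigma> x y ^ 2) has_real_derivative v y * (2 * bump \<sigma> x y * (2 * \<sigma>))) (at \<sigma> within {0<..<R'})"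
      by (rule has_field_derivative_at_within[OF DERIV_cmult])
  next
    show "(\<lambda>y. v y * (bump \<sigma> x y)\<^sup>2) integrable_on cbox a b" for \<sigma>
      by (intro integrable_continuous continuous_intros continuous_on_bump continuous_on_subset[OF cv]) auto
    show "continuous_on ({0<..<R'} \<times> cbox a b) (\<lambda>(\<sigma>, y). v y * (2 * bump \<sigma> x y * (2 * \<sigma>)))"
      unfolding bump_def case_prod_beta
      by (intro continuous_intros continuous_on_compose2[OF cv]) auto
  qed (use \<rho> R' in auto)
  have "((\<lambda>\<sigma>. \<integral>y. u y * bump \<sigma> x y ^ 2 \<partial>lborel) has_real_derivative
      integral (cbox a b) (\<lambda>y. v y * (2 * bump \<rho> x y * (2 * \<rho>)))) (at \<rho> within {0<..<R'})"
    by (rule has_field_derivative_transform_within[OF D, of "1"]) (use \<rho> R' eq[of _ 2] in auto)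
  moreover have "at \<rho> within {0<..<R'} = at \<rho>" using \<rho> R' by (intro at_within_open) auto
  moreover have "integral (cbox a b) (\<lambda>y. v y * (2 * bump \<rho> x y * (2 * \<rho>))) = 4 * \<rho> * (\<integral>y. u y * bump \<rho> x y \<partial>lborel)"
  proof -
    have "(\<lambda>y. v y * (2 * bump \<rho> x y * (2 * \<rho>))) = (\<lambda>y. (4 * \<rho>) * (v y * bump \<rho> x y ^ 1))" by (auto simp: fun_eq_iff)
    then show ?thesis using eq[of \<rho> 1] \<rho> R' by simp
  qed
  ultimately show ?thesis by simp
qed

section \<open>The averages and their derivative in the radius\<close>

text \<open>Under rescaling to the unit ball b contributes \<rho>^2 and the volume \<rho>^N, so the
  quotient is constant in \<rho> > 0 for constant \<open>u\<close>. The mass of the unit weight is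
  not divided out; it reappears as the factor \<open>bump_mass\<close> in the limit at radius
  0.\<close>

definition avg :: "(real^'n::finite \<Rightarrow> real) \<Rightarrow> real^'n \<Rightarrow> real \<Rightarrow> real" where
  "avg u x \<rho> = (\<integral>y. u y * bump \<rho> x y ^ 2 \<partial>lborel) / \<rho> ^ (CARD('n) + 4)"

lemma integrable_mult_bump:
  assumes "open \<Omega>" "continuous_on \<Omega> u" "0 \<le> R" "cball x R \<subseteq> \<Omega>" "0 < k"
  shows "integrable lborel (\<lambda>y. u y * bump R x y ^ k)"
  by (rule integrable_mult_support[OF assms(1,2) continuous_on_power[OF continuous_on_bump] compact_cball assms(4)])
    (use assms in \<open>simp add: bump_eq_0\<close>)

lemma DERIV_avg:
  fixes x :: "real^'n::finite"
  assumes \<Omega>: "open \<Omega>" and u: "has_laplacian_on \<Omega> u g" and R: "ball x R \<subseteq> \<Omega>" and \<rho>: "0 < \<rho>" "\<rho> < R"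
  shows "(avg u x has_real_derivative (\<integral>y. g y * bump \<rho> x y ^ 3 \<partial>lborel) / (6 * \<rho> ^ (CARD('n) + 5))) (at \<rho>)"
proof -
  have cu: "continuous_on \<Omega> u" using has_laplacian_on_continuous[OF u] by simp
  have sub: "cball x \<rho> \<subseteq> \<Omega>" using R \<rho> by (auto simp: subset_iff)
  let ?N = "CARD('n)"
  define J1 where "J1 = (\<integral>y. u y * bump \<rho> x y \<partial>lborel)"
  define J2 where "J2 = (\<integral>y. u y * bump \<rho> x y ^ 2 \<partial>lborel)"
  have i: "integrable lborel (\<lambda>y. u y * bump \<rho> x y)" "integrable lborel (\<lambda>y. u y * bump \<rho> x y ^ 2)"
    using integrable_mult_bump[OF \<Omega> cu _ sub, of 1] integrable_mult_bump[OF \<Omega> cu _ sub, of 2] \<rho> by auto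
  \<comment> \<open>On the ball this is |x - y|^2 = \<rho>^2 - b multiplied by b, and off it both
    sides are 0. It reduces the Laplacian of b^3 to a combination of b and b^2.\<close>
  have db: "(dist x y)\<^sup>2 * bump \<rho> x y = \<rho>\<^sup>2 * bump \<rho> x y - bump \<rho> x y ^ 2" for y
    unfolding bump_def by (cases "\<rho>\<^sup>2 - (dist x y)\<^sup>2 \<ge> 0") (auto simp: max_def power2_eq_square algebra_simps)
  have "(\<integral>y. g y * bump \<rho> x y ^ 3 \<partial>lborel)
     = (\<integral>y. u y * (4 * 3 * (3 - 1) * (dist x y)\<^sup>2 * bump \<rho> x y ^ 1 - 2 * 3 * ?N * bump \<rho> x y ^ 2) \<partial>lborel)"
    using Green_bump[OF \<Omega> u _ sub, of 0] \<rho> by (simp add: power2_eq_square)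
  also have "\<dots> = (\<integral>y. 24 * \<rho>\<^sup>2 * (u y * bump \<rho> x y) - (24 + 6 * ?N) * (u y * bump \<rho> x y ^ 2) \<partial>lborel)"
  proof (rule Bochner_Integration.integral_cong[OF refl])
    fix y
    have "u y * (4 * 3 * (3 - 1) * (dist x y)\<^sup>2 * bump \<rho> x y ^ 1 - 2 * 3 * ?N * bump \<rho> x y ^ 2)
      = u y * (24 * ((dist x y)\<^sup>2 * bump \<rho> x y) - 6 * ?N * bump \<rho> x y ^ 2)" by simp
    also have "\<dots> = 24 * \<rho>\<^sup>2 * (u y * bump \<rho> x y) - (24 + 6 * ?N) * (u y * bump \<rho> x y ^ 2)"
      unfolding db by (simp add: algebra_simps)
    finally show "u y * (4 * 3 * (3 - 1) * (dist x y)\<^sup>2 * bump \<rho> x y ^ 1 - 2 * 3 * ?N * bump \<rho> x y ^ 2) = \<dots>" .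
  qed
  also have "\<dots> = 24 * \<rho>\<^sup>2 * J1 - (24 + 6 * ?N) * J2"
    unfolding J1_def J2_def using i by (simp add: Bochner_Integration.integral_diff)
  finally have g: "(\<integral>y. g y * bump \<rho> x y ^ 3 \<partial>lborel) = 24 * \<rho>\<^sup>2 * J1 - (24 + 6 * ?N) * J2" .
  have D1: "((\<lambda>\<rho>. \<rho> ^ (?N + 4)) has_real_derivative real (?N + 4) * \<rho> ^ (?N + 3)) (at \<rho>)"
    using DERIV_pow[of "?N + 4" \<rho>] by (simp add: eval_nat_numeral)
  have "(avg u x has_real_derivative
     (4 * \<rho> * J1 * \<rho> ^ (?N + 4) - J2 * (real (?N + 4) * \<rho> ^ (?N + 3))) / (\<rho> ^ (?N + 4) * \<rho> ^ (?N + 4))) (at \<rho>)"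
    unfolding avg_def[abs_def]
    using DERIV_divide[OF DERIV_integral_bump[OF cu R \<rho>] D1] \<rho> by (simp add: J1_def J2_def)
  moreover have "(4 * \<rho> * J1 * \<rho> ^ (?N + 4) - J2 * (real (?N + 4) * \<rho> ^ (?N + 3))) / (\<rho> ^ (?N + 4) * \<rho> ^ (?N + 4))
    = (24 * \<rho>\<^sup>2 * J1 - (24 + 6 * ?N) * J2) / (6 * \<rho> ^ (?N + 5))"
    using \<rho> by (simp add: field_simps power_add eval_nat_numeral)
  ultimately show ?thesis using g by simp
qed

section \<open>Mean value inequality and interior derivative estimates\<close>

definition bump_mass :: "'n::finite itself \<Rightarrow> real" where
  "bump_mass _ = (\<integral>y. bump 1 (0::real^'n) y ^ 2 \<partial>lborel)"

lemma borel_measurable_bump: "bump R x \<in> borel_measurable borel"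
  by (rule borel_measurable_continuous_onI[OF continuous_on_bump])

lemma integrable_bump:
  assumes "0 \<le> R" "0 < k"
  shows "integrable lborel (\<lambda>y. bump R x y ^ k)"
  by (rule integrable_continuous_compact_support[OF continuous_on_power[OF continuous_on_bump] compact_cball[of x R]])
    (use assms in \<open>simp add: bump_eq_0\<close>)

lemma integral_bump_sq:
  fixes x :: "real^'n::finite"
  assumes "0 < \<rho>"
  shows "(\<integral>y. bump \<rho> x y ^ 2 \<partial>lborel) = bump_mass TYPE('n) * \<rho> ^ (CARD('n) + 4)"
proof -
  let ?f = "\<lambda>y. bump \<rho> x y ^ 2"
  have meas: "?f \<in> borel_measurable borel" using borel_measurable_bump by measurable
  have "(\<integral>y. ?f y \<partial>lborel) =
      (\<integral>y. ?f y \<partial>density (distr lborel borel (\<lambda>z. x + \<rho> *\<^sub>R z)) (\<lambda>_. ennreal (\<bar>\<rho>\<bar> ^ DIM(real^'n))))"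
    using lborel_affine[of \<rho> x] assms by simp
  also have "\<dots> = (\<integral>y. \<bar>\<rho>\<bar> ^ DIM(real^'n) *\<^sub>R ?f y \<partial>distr lborel borel (\<lambda>z. x + \<rho> *\<^sub>R z))"
    by (rule integral_density) (use meas in auto)
  also have "\<dots> = (\<integral>z. \<bar>\<rho>\<bar> ^ DIM(real^'n) *\<^sub>R ?f (x + \<rho> *\<^sub>R z) \<partial>lborel)"
    by (rule integral_distr) (use meas in auto)
  also have "\<dots> = (\<integral>z. \<rho> ^ (CARD('n) + 4) * bump 1 (0::real^'n) z ^ 2 \<partial>lborel)"
  proof (rule Bochner_Integration.integral_cong[OF refl])
    fix z :: "real^'n"
    have "bump \<rho> x (x + \<rho> *\<^sub>R z) = max (\<rho>\<^sup>2 * (1 - (norm z)\<^sup>2)) (\<rho>\<^sup>2 * 0)"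
      unfolding bump_def using assms by (simp add: dist_norm power_mult_distrib algebra_simps)
    also have "\<dots> = \<rho>\<^sup>2 * bump 1 0 z"
      by (simp add: bump_def max_mult_distrib_left)
    finally show "\<bar>\<rho>\<bar> ^ DIM(real^'n) *\<^sub>R ?f (x + \<rho> *\<^sub>R z) = \<rho> ^ (CARD('n) + 4) * bump 1 0 z ^ 2"
      using assms by (simp add: power_mult_distrib power_add)
  qed
  finally show ?thesis by (simp add: bump_mass_def)
qed

lemma bump_mass_pos: "0 < bump_mass TYPE('n::finite)"
proof -
  let ?B = "ball (0::real^'n) (1/2)"
  \<comment> \<open>On the ball of radius 1/2 the unit weight is at least 3/4, with square
    9/16.\<close>
  have "0 < (9/16) * measure lborel ?B" by simp
  also have "\<dots> = (\<integral>y. (9/16) * indicator ?B y \<partial>lborel)" by simp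
  also have "\<dots> \<le> (\<integral>y. bump 1 (0::real^'n) y ^ 2 \<partial>lborel)"
  proof (rule integral_mono)
    show "integrable lborel (\<lambda>y. (9/16) * indicator ?B y :: real)"
      using emeasure_lborel_ball_finite[of "0::real^'n" "1/2"]
      by (intro integrable_mult_right integrable_real_indicator) auto
    show "(9/16) * indicator ?B y \<le> bump 1 0 y ^ 2" for y :: "real^'n"
    proof (cases "y \<in> ?B")
      case True
      then have "(norm y)\<^sup>2 \<le> (1/2)\<^sup>2" by (intro power_mono) auto
      then have "3/4 \<le> bump 1 0 y" by (simp add: bump_def power2_eq_square)
      then have "(3/4)\<^sup>2 \<le> bump 1 0 y ^ 2" by (intro power_mono) auto
      then show ?thesis using True by (simp add: power2_eq_square)
    qed simp
  qed (simp add: integrable_bump)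
  finally show ?thesis by (simp add: bump_mass_def)
qed

lemma measure_ball_vec:
  "0 \<le> r \<Longrightarrow> measure lborel (ball (x::real^'n::finite) r) = unit_ball_vol (CARD('n)) * r ^ CARD('n)"
  by (simp add: content_ball)

lemma integrable_indicator_ball:
  "integrable lborel (\<lambda>y. c * indicator (ball (x::'a::euclidean_space) r) y :: real)"
  using emeasure_lborel_ball_finite[of x r]
  by (intro integrable_mult_right integrable_real_indicator) auto

lemma integral_bump_le:
  fixes x :: "real^'n::finite"
  assumes "open \<Omega>" "continuous_on \<Omega> h" "0 < \<rho>" "cball x \<rho> \<subseteq> \<Omega>" "0 < k"
    and B: "\<And>y. y \<in> ball x \<rho> \<Longrightarrow> \<bar>h y\<bar> \<le> B"
  shows "\<bar>\<integral>y. h y * bump \<rho> x y ^ k \<partial>lborel\<bar> \<le> B * unit_ball_vol (CARD('n)) * \<rho> ^ (CARD('n) + 2 * k)"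
proof -
  have i: "integrable lborel (\<lambda>y. h y * bump \<rho> x y ^ k)"
    using assms by (intro integrable_mult_bump) auto
  have "\<bar>\<integral>y. h y * bump \<rho> x y ^ k \<partial>lborel\<bar> \<le> (\<integral>y. \<bar>h y * bump \<rho> x y ^ k\<bar> \<partial>lborel)"
    by (rule integral_abs_bound)
  also have "\<dots> \<le> (\<integral>y. (B * \<rho> ^ (2 * k)) * indicator (ball x \<rho>) y \<partial>lborel)"
  proof (rule integral_mono)
    fix y
    show "\<bar>h y * bump \<rho> x y ^ k\<bar> \<le> (B * \<rho> ^ (2 * k)) * indicator (ball x \<rho>) y"
    proof (cases "y \<in> ball x \<rho>")
      case True
      have "bump \<rho> x y ^ k \<le> (\<rho>\<^sup>2) ^ k" by (intro power_mono bump_le bump_nonneg)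
      then have "\<bar>h y\<bar> * bump \<rho> x y ^ k \<le> B * \<rho> ^ (2 * k)"
        using B[OF True] bump_nonneg[of \<rho> x y] by (intro mult_mono) (auto simp: power_mult)
      then show ?thesis using True bump_nonneg[of \<rho> x y] by (simp add: abs_mult)
    next
      case False then show ?thesis using bump_eq_0[of \<rho> y x] assms by simp
    qed
  qed (use i integrable_indicator_ball in auto)
  also have "\<dots> = B * unit_ball_vol (CARD('n)) * \<rho> ^ (CARD('n) + 2 * k)"
    using measure_ball_vec[of \<rho> x] assms by (simp add: power_add)
  finally show ?thesis .
qed

lemma tendsto_avg:
  fixes x :: "real^'n::finite"
  assumes \<Omega>: "open \<Omega>" and u: "continuous_on \<Omega> u" and x: "x \<in> \<Omega>"
  shows "(avg u x \<longlongrightarrow> bump_mass TYPE('n) * u x) (at_right 0)"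
proof (rule tendstoI)
  fix e :: real assume e: "0 < e"
  let ?V = "unit_ball_vol (CARD('n))"
  have V: "0 < ?V" by simp
  \<comment> \<open>The normalised weight has integral at most \<open>?V\<close>, so an oscillation
    of \<open>u\<close> by \<open>e'\<close> moves the average by at most e / 2.\<close>
  define e' where "e' = e / (2 * ?V)"
  have e': "0 < e'" using e V by (simp add: e'_def)
  obtain R where R: "0 < R" "ball x R \<subseteq> \<Omega>" using \<Omega> x by (meson open_contains_ball)
  obtain d where d: "0 < d" "\<And>y. y \<in> \<Omega> \<Longrightarrow> dist y x < d \<Longrightarrow> \<bar>u y - u x\<bar> < e'"
    using u x e' unfolding continuous_on_iff dist_real_def by metis
  have "dist (avg u x \<rho>) (bump_mass TYPE('n) * u x) < e" if \<rho>: "0 < \<rho>" "\<rho> < min d R" for \<rho>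
  proof -
    have sub: "cball x \<rho> \<subseteq> \<Omega>" using R \<rho> by (auto simp: subset_iff)
    have i: "integrable lborel (\<lambda>y. u y * bump \<rho> x y ^ 2)" "integrable lborel (\<lambda>y. bump \<rho> x y ^ 2)"
      using integrable_mult_bump[OF \<Omega> u _ sub, of 2] integrable_bump[of \<rho> 2] \<rho> by auto
    have b: "\<bar>\<integral>y. (u y - u x) * bump \<rho> x y ^ 2 \<partial>lborel\<bar> \<le> e' * ?V * \<rho> ^ (CARD('n) + 2 * 2)"
    proof (rule integral_bump_le[OF \<Omega> _ \<rho>(1) sub])
      show "continuous_on \<Omega> (\<lambda>y. u y - u x)" by (intro continuous_intros u)
      show "\<bar>u y - u x\<bar> \<le> e'" if "y \<in> ball x \<rho>" for y
      proof (rule less_imp_le, rule d(2))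
        show "y \<in> \<Omega>" using that sub by auto
        show "dist y x < d" using that \<rho> by (simp add: dist_commute)
      qed
    qed simp
    have "(\<integral>y. (u y - u x) * bump \<rho> x y ^ 2 \<partial>lborel) =
        (\<integral>y. u y * bump \<rho> x y ^ 2 - u x * bump \<rho> x y ^ 2 \<partial>lborel)" by (simp add: algebra_simps)
    also have "\<dots> = (\<integral>y. u y * bump \<rho> x y ^ 2 \<partial>lborel) - u x * (bump_mass TYPE('n) * \<rho> ^ (CARD('n) + 4))"
      using i integral_bump_sq[OF \<rho>(1), of x] by simp
    finally have "avg u x \<rho> - bump_mass TYPE('n) * u x =
        (\<integral>y. (u y - u x) * bump \<rho> x y ^ 2 \<partial>lborel) / \<rho> ^ (CARD('n) + 4)"
      using \<rho> by (simp add: avg_def field_simps)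
    then have "\<bar>avg u x \<rho> - bump_mass TYPE('n) * u x\<bar> \<le> (e' * ?V * \<rho> ^ (CARD('n) + 4)) / \<rho> ^ (CARD('n) + 4)"
      using b \<rho> by (simp add: divide_le_eq)
    also have "\<dots> = e / 2" using \<rho> less_imp_neq[OF V, symmetric] by (simp add: e'_def)
    finally show ?thesis using e by (simp add: dist_real_def)
  qed
  then show "\<forall>\<^sub>F \<rho> in at_right 0. dist (avg u x \<rho>) (bump_mass TYPE('n) * u x) < e"
    using d(1) R(1) unfolding eventually_at_right_field by (intro exI[of _ "min d R"]) auto
qed

text \<open>Takes the place of integration over the radii: \<open>G\<close> is a primitive of the
  error bound and vanishes at 0, so \<open>A + G\<close> is nondecreasing, and integrability of the
  derivative of \<open>A\<close> never comes up. It is applied with \<open>G\<close> zero, linear,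
  and a multiple of a positive power of the radius.\<close>

lemma limit_le_of_DERIV_nonneg:
  fixes A G :: "real \<Rightarrow> real"
  assumes r: "0 < r"
    and A: "\<And>\<rho>. 0 < \<rho> \<Longrightarrow> \<rho> \<le> r \<Longrightarrow> (A has_real_derivative A' \<rho>) (at \<rho>)"
    and G: "\<And>\<rho>. 0 < \<rho> \<Longrightarrow> \<rho> \<le> r \<Longrightarrow> (G has_real_derivative G' \<rho>) (at \<rho>)"
    and nn: "\<And>\<rho>. 0 < \<rho> \<Longrightarrow> \<rho> \<le> r \<Longrightarrow> 0 \<le> A' \<rho> + G' \<rho>"
    and lim: "(A \<longlongrightarrow> a) (at_right 0)" "(G \<longlongrightarrow> 0) (at_right 0)"
  shows "a \<le> A r + G r"
proof -
  have "A s + G s \<le> A r + G r" if "0 < s" "s < r" for s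
  proof (rule DERIV_nonneg_imp_nondecreasing[where f="\<lambda>s. A s + G s"])
    fix \<rho> assume "s \<le> \<rho>" "\<rho> \<le> r"
    then show "\<exists>y. ((\<lambda>s. A s + G s) has_real_derivative y) (at \<rho>) \<and> 0 \<le> y"
      using that A[of \<rho>] G[of \<rho>] nn[of \<rho>] by (intro exI[of _ "A' \<rho> + G' \<rho>"]) (auto intro: DERIV_add)
  qed (use that in auto)
  then have "\<forall>\<^sub>F s in at_right 0. A s + G s \<le> A r + G r"
    unfolding eventually_at_right_field using r by blast
  moreover have "((\<lambda>s. A s + G s) \<longlongrightarrow> a + 0) (at_right 0)" by (intro tendsto_add lim)
  ultimately have "a + 0 \<le> A r + G r" using tendsto_upperbound trivial_limit_at_right_real by blast
  then show ?thesis by simp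
qed

text \<open>The derivative of the averages has the sign of \<open>g\<close>, so they decrease from
  their limit at radius 0. They are negated in the proof because the comparison lemma bounds limits
  from above.\<close>

lemma superharmonic_mean_value:
  fixes x :: "real^'n::finite"
  assumes \<Omega>: "open \<Omega>" and u: "has_laplacian_on \<Omega> u g" and R: "ball x R \<subseteq> \<Omega>" and r: "0 < r" "r < R"
    and g: "\<And>y. y \<in> ball x R \<Longrightarrow> g y \<le> 0"
  shows "avg u x r \<le> bump_mass TYPE('n) * u x"
proof -
  have x: "x \<in> \<Omega>" using R r by auto
  have "- (bump_mass TYPE('n) * u x) \<le> - avg u x r + 0"
  proof (rule limit_le_of_DERIV_nonneg[OF r(1), where G'="\<lambda>_. 0"])
    fix \<rho> assume \<rho>: "0 < \<rho>" "\<rho> \<le> r"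
    show "((\<lambda>\<rho>. - avg u x \<rho>) has_real_derivative
        - ((\<integral>y. g y * bump \<rho> x y ^ 3 \<partial>lborel) / (6 * \<rho> ^ (CARD('n) + 5)))) (at \<rho>)"
      by (rule DERIV_minus[OF DERIV_avg[OF \<Omega> u R]]) (use \<rho> r in auto)
    have "(\<integral>y. g y * bump \<rho> x y ^ 3 \<partial>lborel) \<le> (\<integral>y. 0 \<partial>(lborel :: (real^'n) measure))"
    proof (rule integral_mono_AE')
      show "AE y in lborel. g y * bump \<rho> x y ^ 3 \<le> 0"
      proof (rule AE_I2)
        fix y show "g y * bump \<rho> x y ^ 3 \<le> 0"
          using g[of y] bump_nonneg[of \<rho> x y] bump_eq_0[of \<rho> y x] \<rho> r
          by (cases "y \<in> ball x \<rho>") (auto simp: mult_nonpos_nonneg)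
      qed
    qed auto
    then show "0 \<le> - ((\<integral>y. g y * bump \<rho> x y ^ 3 \<partial>lborel) / (6 * \<rho> ^ (CARD('n) + 5))) + 0"
      using \<rho> by (simp add: divide_le_0_iff)
  next
    show "((\<lambda>\<rho>. - avg u x \<rho>) \<longlongrightarrow> - (bump_mass TYPE('n) * u x)) (at_right 0)"
      by (intro tendsto_minus tendsto_avg[OF \<Omega> _ x] has_laplacian_on_continuous[OF u])
  qed auto
  then show ?thesis by simp
qed

section \<open>Dependence of the averages on the centre, and interior derivative bounds\<close>

text \<open>The weight is \<rho>^2 minus the square of the distance truncated at \<rho>. A
  difference of two such squares factors as (t + s)(t - s), where t + s is at most 2 \<rho> and the
  truncated distance is 1-Lipschitz in the centre.\<close>

lemma bump_Lipschitz:
  assumes "0 < \<rho>"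
  shows "\<bar>bump \<rho> x z - bump \<rho> y z\<bar> \<le> 2 * \<rho> * dist x y"
proof -
  have eq: "bump \<rho> v z = \<rho>\<^sup>2 - (min \<rho> (dist v z))\<^sup>2" for v
    using assms abs_le_square_iff[of \<rho> "dist v z"] abs_le_square_iff[of "dist v z" \<rho>]
    unfolding bump_def by (auto simp: min_def max_def)
  define s t where "s = min \<rho> (dist x z)" and "t = min \<rho> (dist y z)"
  have st: "0 \<le> s" "s \<le> \<rho>" "0 \<le> t" "t \<le> \<rho>" using assms by (auto simp: s_def t_def)
  have "\<bar>s - t\<bar> \<le> \<bar>dist x z - dist y z\<bar>" unfolding s_def t_def by (auto simp: min_def)
  also have "\<dots> \<le> dist x y"
    using dist_triangle[of x z y] dist_triangle[of y z x] by (simp add: dist_commute)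
  finally have 1: "\<bar>s - t\<bar> \<le> dist x y" .
  have "\<bar>bump \<rho> x z - bump \<rho> y z\<bar> = \<bar>(t + s) * (t - s)\<bar>"
    unfolding eq s_def[symmetric] t_def[symmetric] by (simp add: power2_eq_square algebra_simps)
  also have "\<dots> = (t + s) * \<bar>s - t\<bar>" using st by (simp add: abs_mult abs_minus_commute)
  also have "\<dots> \<le> (2 * \<rho>) * dist x y" using 1 st by (intro mult_mono) auto
  finally show ?thesis .
qed

lemma power_diff_le:
  fixes a b :: real
  assumes "0 \<le> a" "a \<le> M" "0 \<le> b" "b \<le> M"
  shows "\<bar>a ^ Suc k - b ^ Suc k\<bar> \<le> real (Suc k) * M ^ k * \<bar>a - b\<bar>"
proof -
  have "\<bar>\<Sum>i<Suc k. a ^ i * b ^ (k - i)\<bar> \<le> (\<Sum>i<Suc k. M ^ k)"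
  proof (rule order_trans[OF sum_abs sum_mono])
    fix i assume i: "i \<in> {..<Suc k}"
    have "a ^ i * b ^ (k - i) \<le> M ^ i * M ^ (k - i)"
      using assms by (intro mult_mono power_mono) auto
    also have "\<dots> = M ^ k" using i by (simp flip: power_add)
    finally show "\<bar>a ^ i * b ^ (k - i)\<bar> \<le> M ^ k" using assms by simp
  qed
  then show ?thesis
    using mult_left_mono[of _ _ "\<bar>a - b\<bar>"] unfolding power_diff_sumr2 by (fastforce simp: abs_mult mult.commute)
qed

lemma bump_power_Lipschitz:
  assumes "0 < \<rho>"
  shows "\<bar>bump \<rho> x z ^ Suc k - bump \<rho> y z ^ Suc k\<bar> \<le> 2 * real (Suc k) * \<rho> ^ (2 * k + 1) * dist x y"
proof -
  have "\<bar>bump \<rho> x z ^ Suc k - bump \<rho> y z ^ Suc k\<bar> \<le> real (Suc k) * (\<rho>\<^sup>2) ^ k * \<bar>bump \<rho> x z - bump \<rho> y z\<bar>"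
    by (rule power_diff_le) (auto simp: bump_nonneg bump_le)
  also have "\<dots> \<le> real (Suc k) * (\<rho>\<^sup>2) ^ k * (2 * \<rho> * dist x y)"
    by (intro mult_left_mono bump_Lipschitz assms) auto
  also have "\<dots> = 2 * real (Suc k) * \<rho> ^ (2 * k + 1) * dist x y"
    by (simp add: power_mult[symmetric])
  finally show ?thesis .
qed

text \<open>The integrand lives on the union of two balls, whose volume is at most twice that of
  one; together with the factor 2 of the Lipschitz bound this produces the 4.\<close>

lemma integral_bump_diff_le:
  fixes x y :: "real^'n::finite"
  assumes \<Omega>: "open \<Omega>" "continuous_on \<Omega> h" "0 < \<rho>" "cball x \<rho> \<subseteq> \<Omega>" "cball y \<rho> \<subseteq> \<Omega>"
    and B: "\<And>z. z \<in> ball x \<rho> \<union> ball y \<rho> \<Longrightarrow> \<bar>h z\<bar> \<le> B" "0 \<le> B"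
  shows "\<bar>(\<integral>z. h z * bump \<rho> x z ^ Suc k \<partial>lborel) - (\<integral>z. h z * bump \<rho> y z ^ Suc k \<partial>lborel)\<bar>
    \<le> 4 * real (Suc k) * B * unit_ball_vol (CARD('n)) * \<rho> ^ (CARD('n) + 2 * k + 1) * dist x y"
proof -
  define L where "L = 2 * real (Suc k) * \<rho> ^ (2 * k + 1) * dist x y"
  have L: "0 \<le> L" using assms by (simp add: L_def)
  have i: "integrable lborel (\<lambda>z. h z * bump \<rho> x z ^ Suc k)" "integrable lborel (\<lambda>z. h z * bump \<rho> y z ^ Suc k)"
    using integrable_mult_bump[OF \<Omega>(1,2) _ \<Omega>(4), of "Suc k"] integrable_mult_bump[OF \<Omega>(1,2) _ \<Omega>(5), of "Suc k"] \<Omega>(3)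
    by (simp_all del: power_Suc)
  have "\<bar>(\<integral>z. h z * bump \<rho> x z ^ Suc k \<partial>lborel) - (\<integral>z. h z * bump \<rho> y z ^ Suc k \<partial>lborel)\<bar>
     = \<bar>\<integral>z. h z * bump \<rho> x z ^ Suc k - h z * bump \<rho> y z ^ Suc k \<partial>lborel\<bar>"
    using i by simp
  also have "\<dots> \<le> (\<integral>z. \<bar>h z * bump \<rho> x z ^ Suc k - h z * bump \<rho> y z ^ Suc k\<bar> \<partial>lborel)"
    by (rule integral_abs_bound)
  also have "\<dots> \<le> (\<integral>z. (B * L) * indicator (ball x \<rho>) z + (B * L) * indicator (ball y \<rho>) z \<partial>lborel)"
  proof (rule integral_mono)
    fix z
    show "\<bar>h z * bump \<rho> x z ^ Suc k - h z * bump \<rho> y z ^ Suc k\<bar> \<le> (B * L) * indicator (ball x \<rho>) z + (B * L) * indicator (ball y \<rho>) z"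
    proof (cases "z \<in> ball x \<rho> \<union> ball y \<rho>")
      case True
      have "\<bar>h z * bump \<rho> x z ^ Suc k - h z * bump \<rho> y z ^ Suc k\<bar> = \<bar>h z\<bar> * \<bar>bump \<rho> x z ^ Suc k - bump \<rho> y z ^ Suc k\<bar>"
        by (metis abs_mult right_diff_distrib)
      also have "\<dots> \<le> B * L"
        unfolding L_def by (intro mult_mono B True bump_power_Lipschitz assms) auto
      also have "\<dots> \<le> (B * L) * indicator (ball x \<rho>) z + (B * L) * indicator (ball y \<rho>) z"
        using True L B by (auto simp: indicator_def)
      finally show ?thesis .
    next
      case False then show ?thesis using bump_eq_0[of \<rho> z x] bump_eq_0[of \<rho> z y] assms by simp
    qed
  qed (use i in \<open>auto intro!: integrable_indicator_ball Bochner_Integration.integrable_add simp del: power_Suc\<close>)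
  also have "\<dots> = B * L * (2 * unit_ball_vol (CARD('n)) * \<rho> ^ CARD('n))"
    using integrable_indicator_ball[of "B * L" x \<rho>] integrable_indicator_ball[of "B * L" y \<rho>]
      measure_ball_vec[of \<rho> x] measure_ball_vec[of \<rho> y] \<open>0 < \<rho>\<close>
    by (subst Bochner_Integration.integral_add) simp_all
  also have "\<dots> = 4 * real (Suc k) * B * unit_ball_vol (CARD('n)) * \<rho> ^ (CARD('n) + 2 * k + 1) * dist x y"
    by (simp add: L_def power_add)
  finally show ?thesis .
qed

text \<open>The 16 is 8 A / r at r = R / 2; the other term, 2 B r = B R, is enlarged to the same
  factor.\<close>

definition grad_const :: "'n::finite itself \<Rightarrow> real" where
  "grad_const _ = 16 * unit_ball_vol (CARD('n)) / bump_mass TYPE('n)"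

lemma grad_const_pos: "0 < grad_const TYPE('n::finite)"
  by (simp add: grad_const_def bump_mass_pos)

text \<open>The averages about \<open>x\<close> and about \<open>y\<close> are compared. The
  Lipschitz bound for the cubed weight scales as \<rho>^(N + 5) and cancels the denominator, so with
  V the volume of the unit ball the \<rho>-derivative of their difference is at most 2 B V |x - y|
  at every radius. At the final radius r they differ by at most 8 A V |x - y| / r.\<close>

lemma interior_Lipschitz_estimate:
  fixes x y :: "real^'n::finite"
  assumes \<Omega>: "open \<Omega>" and u: "has_laplacian_on \<Omega> u g" and R: "0 < R" "ball x R \<subseteq> \<Omega>" "ball y R \<subseteq> \<Omega>"
    and A: "\<And>z. z \<in> ball x R \<union> ball y R \<Longrightarrow> \<bar>u z\<bar> \<le> A"
    and B: "\<And>z. z \<in> ball x R \<union> ball y R \<Longrightarrow> \<bar>g z\<bar> \<le> B"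
  shows "\<bar>u x - u y\<bar> \<le> grad_const TYPE('n) * (A / R + R * B) * dist x y"
proof -
  let ?V = "unit_ball_vol (CARD('n))" and ?N = "CARD('n)" and ?c = "bump_mass TYPE('n)"
  define r where "r = R / 2"
  have r: "0 < r" "r < R" "R = 2 * r" using R by (auto simp: r_def)
  have AB: "0 \<le> A" "0 \<le> B" using A[of x] B[of x] R by auto
  have cont: "continuous_on \<Omega> u" "continuous_on \<Omega> g" using has_laplacian_on_continuous[OF u] .
  \<comment> \<open>A one-sided bound, stated for arbitrary centres so that it can be used again
    with \<open>x\<close> and \<open>y\<close> exchanged.\<close>
  have one: "?c * u x - ?c * u y \<le> (8 * A * ?V / r + 2 * B * ?V * r) * dist x y"
    if R: "ball x R \<subseteq> \<Omega>" "ball y R \<subseteq> \<Omega>" and A: "\<And>z. z \<in> ball x R \<union> ball y R \<Longrightarrow> \<bar>u z\<bar> \<le> A"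
      and B: "\<And>z. z \<in> ball x R \<union> ball y R \<Longrightarrow> \<bar>g z\<bar> \<le> B" for x y :: "real^'n"
  proof -
    have xy: "x \<in> \<Omega>" "y \<in> \<Omega>" using that r by auto
    have sub: "cball x \<rho> \<subseteq> \<Omega>" "cball y \<rho> \<subseteq> \<Omega>" "ball x \<rho> \<union> ball y \<rho> \<subseteq> ball x R \<union> ball y R" if "\<rho> \<le> r" for \<rho>
      using R that r by (auto simp: subset_iff)
    define g' where "g' \<rho> = (\<integral>z. g z * bump \<rho> x z ^ 3 \<partial>lborel) / (6 * \<rho> ^ (?N + 5))
        - (\<integral>z. g z * bump \<rho> y z ^ 3 \<partial>lborel) / (6 * \<rho> ^ (?N + 5))" for \<rho>
    have "?c * u x - ?c * u y \<le> (avg u x r - avg u y r) + (2 * B * ?V * dist x y) * r"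
    proof (rule limit_le_of_DERIV_nonneg[OF r(1), where A="\<lambda>\<rho>. avg u x \<rho> - avg u y \<rho>" and A'=g' and G'="\<lambda>_. 2 * B * ?V * dist x y"])
      fix \<rho> assume \<rho>: "0 < \<rho>" "\<rho> \<le> r"
      show "((\<lambda>\<rho>. avg u x \<rho> - avg u y \<rho>) has_real_derivative g' \<rho>) (at \<rho>)"
        unfolding g'_def by (intro DERIV_diff DERIV_avg[OF \<Omega> u R(1)] DERIV_avg[OF \<Omega> u R(2)]) (use \<rho> r in auto)
      show "((\<lambda>\<rho>. (2 * B * ?V * dist x y) * \<rho>) has_real_derivative 2 * B * ?V * dist x y) (at \<rho>)"
        using DERIV_cmult_Id by blast
      have "\<bar>(\<integral>z. g z * bump \<rho> x z ^ Suc 2 \<partial>lborel) - (\<integral>z. g z * bump \<rho> y z ^ Suc 2 \<partial>lborel)\<bar>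
          \<le> 4 * real (Suc 2) * B * ?V * \<rho> ^ (?N + 2 * 2 + 1) * dist x y"
        by (rule integral_bump_diff_le[OF \<Omega> cont(2) \<rho>(1)])
          (use sub[OF \<rho>(2)] AB in \<open>auto intro: B\<close>)
      then have "\<bar>(\<integral>z. g z * bump \<rho> x z ^ 3 \<partial>lborel) - (\<integral>z. g z * bump \<rho> y z ^ 3 \<partial>lborel)\<bar>
          \<le> 2 * B * ?V * dist x y * (6 * \<rho> ^ (?N + 5))"
        by (simp add: ac_simps)
      then have "\<bar>g' \<rho>\<bar> \<le> 2 * B * ?V * dist x y"
        using \<rho> unfolding g'_def diff_divide_distrib[symmetric] abs_divide by (simp add: divide_le_eq)
      then show "0 \<le> g' \<rho> + 2 * B * ?V * dist x y" by simp
    next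
      show "((\<lambda>\<rho>. avg u x \<rho> - avg u y \<rho>) \<longlongrightarrow> ?c * u x - ?c * u y) (at_right 0)"
        by (intro tendsto_diff tendsto_avg[OF \<Omega> cont(1)] xy)
      show "((\<lambda>\<rho>. (2 * B * ?V * dist x y) * \<rho>) \<longlongrightarrow> 0) (at_right 0)"
        by (rule tendsto_mult_right_zero) (rule tendsto_ident_at)
    qed
    also have "avg u x r - avg u y r \<le> 8 * A * ?V / r * dist x y"
    proof -
      have "\<bar>(\<integral>z. u z * bump r x z ^ Suc 1 \<partial>lborel) - (\<integral>z. u z * bump r y z ^ Suc 1 \<partial>lborel)\<bar>
          \<le> 4 * real (Suc 1) * A * ?V * r ^ (?N + 2 * 1 + 1) * dist x y"
        by (rule integral_bump_diff_le[OF \<Omega> cont(1) r(1)])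
          (use sub[OF order_refl] AB in \<open>auto intro: A\<close>)
      then have "(\<integral>z. u z * bump r x z ^ 2 \<partial>lborel) - (\<integral>z. u z * bump r y z ^ 2 \<partial>lborel)
          \<le> 8 * A * ?V * r ^ (?N + 3) * dist x y" by (simp add: numeral_2_eq_2 numeral_3_eq_3)
      also have "\<dots> = 8 * A * ?V / r * dist x y * r ^ (?N + 4)"
        using r by (simp add: power_add field_simps eval_nat_numeral)
      finally show ?thesis
        using r unfolding avg_def diff_divide_distrib[symmetric] by (simp add: divide_le_eq)
    qed
    finally show ?thesis by (simp add: algebra_simps)
  qed
  have "?c * \<bar>u x - u y\<bar> \<le> (8 * A * ?V / r + 2 * B * ?V * r) * dist x y"
    using one[of x y] one[of y x] R A B bump_mass_pos[where 'n='n]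
    by (cases "u x \<ge> u y") (auto simp: dist_commute Un_commute algebra_simps abs_if)
  also have "\<dots> \<le> 16 * ?V * (A / R + R * B) * dist x y"
  proof (rule mult_right_mono)
    have "B * ?V * r \<ge> 0" using AB r by simp
    then show "8 * A * ?V / r + 2 * B * ?V * r \<le> 16 * ?V * (A / R + R * B)"
      unfolding r(3) by (simp add: algebra_simps)
  qed simp
  finally show ?thesis
    using bump_mass_pos[where 'n='n] by (simp add: grad_const_def field_simps)
qed

lemma pderiv_le_of_Lipschitz:
  assumes u: "pderiv_on S i u u'" and x: "x \<in> S" and e: "0 < e"
    and L: "\<And>y. y \<in> ball x e \<Longrightarrow> \<bar>u y - u x\<bar> \<le> L * dist x y"
  shows "\<bar>u' x\<bar> \<le> L"
proof -
  have "((\<lambda>t. (u (x + t *\<^sub>R axis i 1) - u x) / t) \<longlongrightarrow> u' x) (at 0)"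
    using pderiv_onD(3)[OF u x] by (simp add: has_field_derivative_iff)
  then have "((\<lambda>t. \<bar>(u (x + t *\<^sub>R axis i 1) - u x) / t\<bar>) \<longlongrightarrow> \<bar>u' x\<bar>) (at 0)"
    by (rule tendsto_rabs)
  moreover have "\<forall>\<^sub>F t in at 0. \<bar>(u (x + t *\<^sub>R axis i 1) - u x) / t\<bar> \<le> L"
    unfolding eventually_at
  proof (intro exI[of _ e] conjI ballI impI e)
    fix t :: real assume t: "t \<noteq> 0 \<and> dist t 0 < e"
    have d: "dist x (x + t *\<^sub>R axis i 1) = \<bar>t\<bar>" by (simp add: dist_norm)
    then have "\<bar>u (x + t *\<^sub>R axis i 1) - u x\<bar> \<le> L * \<bar>t\<bar>" using L[of "x + t *\<^sub>R axis i 1"] t by simp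
    then show "\<bar>(u (x + t *\<^sub>R axis i 1) - u x) / t\<bar> \<le> L" using t by (simp add: abs_divide divide_le_eq)
  qed
  ultimately show ?thesis using tendsto_upperbound trivial_limit_at by blast
qed

text \<open>The radius doubles because the Lipschitz estimate is applied to \<open>x\<close> and a
  point \<open>y\<close> closer than \<open>R\<close>, with balls of radius \<open>R\<close> about
  both.\<close>

lemma gradient_estimate:
  fixes x :: "real^'n::finite"
  assumes \<Omega>: "open \<Omega>" and u: "has_laplacian_on \<Omega> u g" and R: "0 < R" "ball x (2 * R) \<subseteq> \<Omega>"
    and A: "\<And>z. z \<in> ball x (2 * R) \<Longrightarrow> \<bar>u z\<bar> \<le> A"
    and B: "\<And>z. z \<in> ball x (2 * R) \<Longrightarrow> \<bar>g z\<bar> \<le> B"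
    and d: "pderiv_on \<Omega> i u u'"
  shows "\<bar>u' x\<bar> \<le> grad_const TYPE('n) * (A / R + R * B)"
proof (rule pderiv_le_of_Lipschitz[OF d _ R(1)])
  show "x \<in> \<Omega>" using R by auto
  fix y assume y: "y \<in> ball x R"
  have sub: "ball y R \<subseteq> ball x (2 * R)" "ball x R \<subseteq> ball x (2 * R)"
    using y R by (simp_all add: ball_subset_ball_iff dist_commute)
  show "\<bar>u y - u x\<bar> \<le> grad_const TYPE('n) * (A / R + R * B) * dist x y"
    using interior_Lipschitz_estimate[OF \<Omega> u R(1), of x y A B] sub R A B
    by (subst abs_minus_commute) blast
qed

text \<open>Here \<open>u'\<close> need not be twice differentiable, but the difference quotients of \<open>u\<close> are, with
  Laplacian the difference quotients of \<open>g\<close>.\<close>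

lemma second_derivative_estimate:
  fixes x :: "real^'n::finite"
  assumes \<Omega>: "open \<Omega>" and u: "has_laplacian_on \<Omega> u g" and R: "0 < R" "ball x (3 * R) \<subseteq> \<Omega>"
    and d: "pderiv_on \<Omega> i u u'" "pderiv_on \<Omega> i g g'" "pderiv_on \<Omega> j u' u''"
    and A: "\<And>z. z \<in> ball x (3 * R) \<Longrightarrow> \<bar>u' z\<bar> \<le> A"
    and B: "\<And>z. z \<in> ball x (3 * R) \<Longrightarrow> \<bar>g' z\<bar> \<le> B"
  shows "\<bar>u'' x\<bar> \<le> grad_const TYPE('n) * (A / R + R * B)"
proof (rule pderiv_le_of_Lipschitz[OF d(3) _ R(1)])
  let ?e = "axis i (1::real)"
  show x: "x \<in> \<Omega>" using R by auto
  fix y assume y: "y \<in> ball x R"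
  have sub: "ball y R \<subseteq> ball x (2 * R)" "ball x R \<subseteq> ball x (2 * R)"
    using y R by (simp_all add: ball_subset_ball_iff dist_commute)
  have yO: "y \<in> \<Omega>" using y R by auto
  \<comment> \<open>The factor 3: \<open>y\<close> lies within \<open>R\<close> of \<open>x\<close>,
    the ball about \<open>y\<close> adds \<open>R\<close>, and the increment \<open>h\<close> adds
    less than another \<open>R\<close>.\<close>
  have shift: "z + h *\<^sub>R ?e \<in> ball x (3 * R)" if "z \<in> ball x (2 * R)" "\<bar>h\<bar> < R" for z h
  proof -
    have "dist x (z + h *\<^sub>R ?e) \<le> dist x z + dist z (z + h *\<^sub>R ?e)" by (rule dist_triangle)
    also have "dist z (z + h *\<^sub>R ?e) = \<bar>h\<bar>" by (simp add: dist_norm)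
    finally show ?thesis using that by simp
  qed
  have quot_le: "\<bar>inverse h * (v (z + h *\<^sub>R ?e) - v z)\<bar> \<le> M"
    if v: "pderiv_on \<Omega> i v v'" and M: "\<And>z. z \<in> ball x (3 * R) \<Longrightarrow> \<bar>v' z\<bar> \<le> M"
      and z: "z \<in> ball x (2 * R)" and h: "0 < h" "h < R" for v v' M z h
  proof -
    have "((\<lambda>t. v (z + t *\<^sub>R ?e)) has_real_derivative v' (z + t *\<^sub>R ?e)) (at t)" if "0 \<le> t" "t \<le> h" for t
      by (rule pderiv_on_DERIV[OF v subsetD[OF R(2) shift[OF z]]]) (use that h in simp)
    from MVT2[OF h(1) this] obtain \<xi>
      where \<xi>: "0 < \<xi>" "\<xi> < h" "v (z + h *\<^sub>R ?e) - v (z + 0 *\<^sub>R ?e) = (h - 0) * v' (z + \<xi> *\<^sub>R ?e)"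
      by blast
    then have eq: "inverse h * (v (z + h *\<^sub>R ?e) - v z) = v' (z + \<xi> *\<^sub>R ?e)" using h by (simp add: field_simps)
    show ?thesis unfolding eq by (rule M[OF shift[OF z]]) (use \<xi> h in simp)
  qed
  have est: "\<bar>inverse h * (u (x + h *\<^sub>R ?e) - u x) - inverse h * (u (y + h *\<^sub>R ?e) - u y)\<bar>
      \<le> grad_const TYPE('n) * (A / R + R * B) * dist x y" if h: "0 < h" "h < R" for h
  proof (rule interior_Lipschitz_estimate[OF open_ball[of x "2 * R"] _ R(1)])
    have "has_laplacian_on (ball x (2 * R)) (\<lambda>z. u (z + h *\<^sub>R ?e)) (\<lambda>z. g (z + h *\<^sub>R ?e))"
      by (rule has_laplacian_on_translate[OF u]) (use shift h R in \<open>auto simp del: mem_ball\<close>)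
    moreover have "has_laplacian_on (ball x (2 * R)) u g"
      by (rule has_laplacian_on_mono[OF u]) (use R in auto)
    ultimately show "has_laplacian_on (ball x (2 * R)) (\<lambda>z. inverse h * (u (z + h *\<^sub>R ?e) - u z))
        (\<lambda>z. inverse h * (g (z + h *\<^sub>R ?e) - g z))"
      by (intro has_laplacian_on_cmult has_laplacian_on_diff)
    show "\<bar>inverse h * (u (z + h *\<^sub>R ?e) - u z)\<bar> \<le> A" if "z \<in> ball x R \<union> ball y R" for z
      by (rule quot_le[OF d(1) A]) (use that sub h in auto)
    show "\<bar>inverse h * (g (z + h *\<^sub>R ?e) - g z)\<bar> \<le> B" if "z \<in> ball x R \<union> ball y R" for z
      by (rule quot_le[OF d(2) B]) (use that sub h in auto)
  qed (use sub in auto)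
  have lim: "((\<lambda>h. inverse h * (u (z + h *\<^sub>R ?e) - u z)) \<longlongrightarrow> u' z) (at_right 0)" if "z \<in> \<Omega>" for z
  proof -
    have "((\<lambda>t. (u (z + t *\<^sub>R ?e) - u z) / t) \<longlongrightarrow> u' z) (at 0)"
      using pderiv_onD(3)[OF d(1) that] by (simp add: has_field_derivative_iff)
    then have "((\<lambda>t. (u (z + t *\<^sub>R ?e) - u z) / t) \<longlongrightarrow> u' z) (at_right 0)"
      unfolding filterlim_at_split by (rule conjunct2)
    then show ?thesis by (simp only: divide_inverse mult.commute)
  qed
  have "\<bar>u' x - u' y\<bar> \<le> grad_const TYPE('n) * (A / R + R * B) * dist x y"
  proof (rule tendsto_upperbound[OF tendsto_rabs[OF tendsto_diff[OF lim[OF x] lim[OF yO]]]])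
    show "\<forall>\<^sub>F h in at_right 0. \<bar>inverse h * (u (x + h *\<^sub>R ?e) - u x) - inverse h * (u (y + h *\<^sub>R ?e) - u y)\<bar>
      \<le> grad_const TYPE('n) * (A / R + R * B) * dist x y"
      unfolding eventually_at_right_field using est R by blast
  qed simp
  then show "\<bar>u' y - u' x\<bar> \<le> grad_const TYPE('n) * (A / R + R * B) * dist x y"
    by (simp add: abs_minus_commute)
qed

section \<open>A priori bounds for superlinear solutions\<close>

text \<open>By the mean value inequality it suffices to bound an average from below. It is at least
  minus the integral of the negative part against the normalised weight, and at radius s that weight
  is at most s^(-N).\<close>

lemma superharmonic_lower_bound:
  fixes x :: "real^'n::finite"
  assumes \<Omega>: "open \<Omega>" and u: "has_laplacian_on \<Omega> u g" and g: "\<And>y. y \<in> \<Omega> \<Longrightarrow> g y \<le> 0"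
    and C: "(\<integral>\<^sup>+ y\<in>\<Omega>. ennreal (max (- u y) 0) \<partial>lborel) \<le> ennreal C"
    and r: "0 < r" "cball x r \<subseteq> \<Omega>"
  shows "- u x \<le> max C 0 / (bump_mass TYPE('n) * (r / 2) ^ CARD('n))"
proof -
  \<comment> \<open>The mean value inequality wants a radius strictly below that of a ball contained
    in \<Omega>.\<close>
  define s where "s = r / 2"
  have s: "0 < s" "s < r" using r by (auto simp: s_def)
  have sub: "ball x r \<subseteq> \<Omega>" "cball x s \<subseteq> \<Omega>" using r s by (auto simp: subset_iff)
  have cu: "continuous_on \<Omega> u" using has_laplacian_on_continuous(1)[OF u] .
  let ?h = "\<lambda>y. max (- u y) 0"
  have ch: "continuous_on \<Omega> ?h" by (intro continuous_on_max continuous_on_minus cu continuous_on_const)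
  have meas: "(\<lambda>y. ennreal (?h y) * indicator \<Omega> y) \<in> borel_measurable lborel"
  proof -
    have "(\<lambda>y. indicator \<Omega> y *\<^sub>R ?h y) \<in> borel_measurable borel"
      using borel_measurable_continuous_on_indicator[OF _ ch] \<Omega> by simp
    then have "(\<lambda>y. ennreal (indicator \<Omega> y *\<^sub>R ?h y)) \<in> borel_measurable lborel" by simp
    moreover have "(\<lambda>y. ennreal (indicator \<Omega> y *\<^sub>R ?h y)) = (\<lambda>y. ennreal (?h y) * indicator \<Omega> y)"
      by (auto simp: indicator_def fun_eq_iff)
    ultimately show ?thesis by metis
  qed
  have i: "integrable lborel (\<lambda>y. u y * bump s x y ^ 2)" "integrable lborel (\<lambda>y. ?h y * bump s x y ^ 2)"
    using integrable_mult_bump[OF \<Omega> cu _ sub(2), of 2] integrable_mult_bump[OF \<Omega> ch _ sub(2), of 2] s by auto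
  have "ennreal (\<integral>y. ?h y * bump s x y ^ 2 \<partial>lborel) = (\<integral>\<^sup>+ y. ennreal (?h y * bump s x y ^ 2) \<partial>lborel)"
    by (rule nn_integral_eq_integral[symmetric, OF i(2)]) (simp add: bump_nonneg)
  also have "\<dots> \<le> (\<integral>\<^sup>+ y. ennreal (s ^ 4) * (ennreal (?h y) * indicator \<Omega> y) \<partial>lborel)"
  proof (rule nn_integral_mono)
    fix y
    show "ennreal (?h y * bump s x y ^ 2) \<le> ennreal (s ^ 4) * (ennreal (?h y) * indicator \<Omega> y)"
    proof (cases "y \<in> ball x s")
      case True
      have "bump s x y ^ 2 \<le> (s\<^sup>2) ^ 2" by (intro power_mono bump_le bump_nonneg)
      then have "?h y * bump s x y ^ 2 \<le> s ^ 4 * ?h y"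
        by (subst mult.commute) (intro mult_right_mono, auto simp: power_mult[symmetric])
      moreover have "y \<in> \<Omega>" using True sub by auto
      ultimately show ?thesis using s by (simp add: ennreal_mult[symmetric] ennreal_leI)
    next
      case False then show ?thesis using bump_eq_0[of s y x] s by simp
    qed
  qed
  also have "\<dots> = ennreal (s ^ 4) * (\<integral>\<^sup>+ y\<in>\<Omega>. ennreal (?h y) \<partial>lborel)"
    by (rule nn_integral_cmult[OF meas])
  \<comment> \<open>\<open>ennreal\<close> sends a negative \<open>C\<close> to 0, so
    \<open>max C 0\<close> is the real number that the hypothesis speaks of.\<close>
  also have "\<dots> \<le> ennreal (s ^ 4) * ennreal (max C 0)"
    by (intro mult_left_mono order_trans[OF C] ennreal_leI) auto
  also have "\<dots> = ennreal (s ^ 4 * max C 0)" using s by (simp add: ennreal_mult)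
  finally have 1: "(\<integral>y. ?h y * bump s x y ^ 2 \<partial>lborel) \<le> s ^ 4 * max C 0" using s by simp
  have "(\<integral>y. - (?h y * bump s x y ^ 2) \<partial>lborel) \<le> (\<integral>y. u y * bump s x y ^ 2 \<partial>lborel)"
  proof (rule integral_mono)
    show "- (?h y * bump s x y ^ 2) \<le> u y * bump s x y ^ 2" for y
      unfolding minus_mult_left by (intro mult_right_mono) auto
  qed (use i in auto)
  then have "- (s ^ 4 * max C 0) \<le> (\<integral>y. u y * bump s x y ^ 2 \<partial>lborel)" using 1 by simp
  then have "- (s ^ 4 * max C 0) / s ^ (CARD('n) + 4) \<le> avg u x s"
    unfolding avg_def using s by (intro divide_right_mono) auto
  moreover have "(s ^ 4 * max C 0) / s ^ (CARD('n) + 4) = max C 0 / s ^ CARD('n)"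
    using s by (simp add: power_add)
  moreover have "avg u x s \<le> bump_mass TYPE('n) * u x"
    by (rule superharmonic_mean_value[OF \<Omega> u sub(1) s]) (use g sub in auto)
  ultimately have "- (max C 0 / s ^ CARD('n)) \<le> bump_mass TYPE('n) * u x" by simp
  then have "bump_mass TYPE('n) * (- u x) \<le> max C 0 / s ^ CARD('n)" by simp
  then have "- u x \<le> (max C 0 / s ^ CARD('n)) / bump_mass TYPE('n)"
    using bump_mass_pos[where 'n='n] by (simp only: pos_le_divide_eq mult.commute)
  then show ?thesis unfolding s_def[symmetric] by (simp add: mult.commute)
qed

section \<open>The nonlinearity and its local integral bound\<close>

definition pos_power :: "real \<Rightarrow> real \<Rightarrow> real" where
  "pos_power p t = max (t - 1) 0 powr p"

lemma pos_power_nonneg: "0 \<le> pos_power p t"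
  by (simp add: pos_power_def)

lemma continuous_on_pos_power:
  assumes "0 < p"
  shows "continuous_on A (pos_power p)"
  unfolding pos_power_def[abs_def] using assms by (intro continuous_intros continuous_on_powr') auto

lemma continuous_on_pos_power_comp:
  assumes "0 < p" "continuous_on A u"
  shows "continuous_on A (\<lambda>x. pos_power p (u x))"
  by (rule continuous_on_compose2[OF continuous_on_pos_power[OF assms(1)] assms(2), of UNIV]) simp

text \<open>Either the power \<open>t\<^sup>p\<close> absorbs the linear term, or \<open>t\<close> is so small compared with \<open>b\<close>
  that the left-hand side is bounded.\<close>

lemma linear_absorbed_by_power:
  fixes t b p \<kappa> :: real
  assumes "0 \<le> t" "0 \<le> b" "b \<le> 1" "1 < p" "0 < \<kappa>" and k: "1 / (p - 1) \<le> real k"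
  shows "\<kappa> * t * b ^ k \<le> t powr p * b ^ Suc k / 2 + \<kappa> * (2 * \<kappa>) powr (1 / (p - 1))"
proof (cases "b = 0 \<or> t = 0")
  case True
  \<comment> \<open>If b = 0 the exponent has to be positive, since 0 ^ 0 = 1; the lower bound 1 /
    (p - 1) for \<open>k\<close> ensures this.\<close>
  then have "\<kappa> * t * b ^ k = 0" using k assms by (auto simp: zero_less_divide_iff not_le intro: Nat.gr0I)
  moreover have "0 \<le> t powr p * b ^ Suc k / 2" "0 \<le> \<kappa> * (2 * \<kappa>) powr (1 / (p - 1))"
    using assms by simp_all
  ultimately show ?thesis by linarith
next
  case False
  then have pos: "0 < b" "0 < t" using assms by auto
  show ?thesis
  proof (cases "2 * \<kappa> \<le> t powr (p - 1) * b")
    case True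
    have "\<kappa> * t * b ^ k = (2 * \<kappa>) * (t * b ^ k) / 2" by simp
    also have "\<dots> \<le> (t powr (p - 1) * b) * (t * b ^ k) / 2"
      using True pos by (intro divide_right_mono mult_right_mono) auto
    also have "\<dots> = (t powr (p - 1) * t powr 1) * b ^ Suc k / 2" using pos by simp
    also have "\<dots> = t powr p * b ^ Suc k / 2" unfolding powr_add[symmetric] by simp
    finally have "\<kappa> * t * b ^ k \<le> t powr p * b ^ Suc k / 2" .
    moreover have "0 \<le> \<kappa> * (2 * \<kappa>) powr (1 / (p - 1))" using assms by simp
    ultimately show ?thesis by linarith
  next
    case False
    then have "t powr (p - 1) \<le> 2 * \<kappa> / b" using pos by (simp add: field_simps)
    then have "(t powr (p - 1)) powr (1 / (p - 1)) \<le> (2 * \<kappa> / b) powr (1 / (p - 1))"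
      using assms by (intro powr_mono2) auto
    then have "t \<le> (2 * \<kappa> / b) powr (1 / (p - 1))" using assms pos by (simp add: powr_powr)
    also have "\<dots> = (2 * \<kappa>) powr (1 / (p - 1)) / b powr (1 / (p - 1))" using pos assms by (simp add: powr_divide)
    finally have "t * b powr (1 / (p - 1)) \<le> (2 * \<kappa>) powr (1 / (p - 1))" using pos by (simp add: field_simps)
    \<comment> \<open>As \<open>b\<close> is at most 1, the larger exponent gives the smaller
      power.\<close>
    moreover have "b ^ k \<le> b powr (1 / (p - 1))"
      using pos assms k by (simp add: powr_realpow[symmetric] powr_mono')
    ultimately have "t * b ^ k \<le> (2 * \<kappa>) powr (1 / (p - 1))"
      using pos by (smt (verit) mult_left_mono)
    then have "\<kappa> * (t * b ^ k) \<le> \<kappa> * (2 * \<kappa>) powr (1 / (p - 1))" using assms by (intro mult_left_mono) auto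
    moreover have "0 \<le> t powr p * b ^ Suc k / 2" using pos by simp
    ultimately show ?thesis by (simp add: mult.assoc)
  qed
qed

lemma integrable_mult_indicator_ball:
  assumes "continuous_on \<Omega> h" "cball x r \<subseteq> \<Omega>"
  shows "integrable lborel (\<lambda>y. h y * indicator (ball x r) y :: real)"
proof -
  have "integrable lborel (\<lambda>y. indicator (cball x r) y *\<^sub>R h y)"
    by (rule borel_integrable_compact) (use assms continuous_on_subset in auto)
  then have "integrable lborel (\<lambda>y. indicator (ball x r) y *\<^sub>R (indicator (cball x r) y *\<^sub>R h y))"
    by (rule integrable_mult_indicator[rotated]) simp
  moreover have "(\<lambda>y. indicator (ball x r) y *\<^sub>R (indicator (cball x r) y *\<^sub>R h y)) = (\<lambda>y. h y * indicator (ball x r) y)"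
    by (auto simp: fun_eq_iff indicator_def)
  ultimately show ?thesis by simp
qed

text \<open>\<open>F\<close> is fixed before the solution, so one constant serves a whole sequence.
  Green's identity turns the integral of the nonlinearity against b^m into that of - u
  \<Delta>(b^m), whose two parts behave differently. The gradient part of \<Delta>(b^m) is
  nonnegative and costs only the lower bound \<open>- L\<close>. The part - 2 m N b^(m - 1) meets
  large values of \<open>u\<close> and is absorbed by half of the integral on the left.\<close>

lemma local_L1_bound:
  fixes x :: "real^'n::finite"
  assumes \<Omega>: "open \<Omega>" and p: "1 < p" and R: "0 < R" "R \<le> 1" "cball x R \<subseteq> \<Omega>" and L: "0 \<le> L"
  obtains F where "0 < F" and "\<And>u. has_laplacian_on \<Omega> u (\<lambda>y. - pos_power p (u y)) \<Longrightarrow>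
    (\<And>y. y \<in> ball x R \<Longrightarrow> - L \<le> u y) \<Longrightarrow>
    (\<integral>y. pos_power p (u y) * indicator (ball x (R / 2)) y \<partial>lborel) \<le> F"
proof -
  \<comment> \<open>This makes \<open>k + 2\<close>, the power of the weight next to
    \<open>u\<close> in the term to be absorbed, at least 1 / (p - 1).\<close>
  define k where "k = nat \<lceil>1 / (p - 1)\<rceil>"
  have k: "1 / (p - 1) \<le> real (k + 2)" unfolding k_def by linarith
  define m where "m = real (k + 3)"
  have m: "m \<ge> 3" by (simp add: m_def)
  let ?V = "unit_ball_vol (CARD('n))"
  define \<kappa> where "\<kappa> = 2 * m * CARD('n)"
  have \<kappa>: "0 < \<kappa>" using m by (simp add: \<kappa>_def)
  \<comment> \<open>The pointwise remainders: from \<open>u y \<le> 1 + t\<close>, from the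
    absorption, and from the lower bound \<open>- L\<close>. Since \<open>R \<le> 1\<close>, weight
    and distance are at most 1.\<close>
  define E where "E = \<kappa> + \<kappa> * (2 * \<kappa>) powr (1 / (p - 1)) + 4 * m * (m - 1) * L"
  have E: "0 < E" using \<kappa> m L by (simp add: E_def add_pos_nonneg)
  define F where "F = 2 * E * ?V * R ^ CARD('n) / ((3 / 4 * R\<^sup>2) ^ (k + 3))"
  have bound: "(\<integral>y. pos_power p (u y) * indicator (ball x (R / 2)) y \<partial>lborel) \<le> F"
    if u: "has_laplacian_on \<Omega> u (\<lambda>y. - pos_power p (u y))" and low: "\<And>y. y \<in> ball x R \<Longrightarrow> - L \<le> u y" for u
  proof -
    let ?f = "\<lambda>y. pos_power p (u y)" and ?b = "bump R x"
    have cu: "continuous_on \<Omega> u" using has_laplacian_on_continuous(1)[OF u] .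
    have cf: "continuous_on \<Omega> ?f" by (rule continuous_on_pos_power_comp[OF _ cu]) (use p in simp)
    define I where "I = (\<integral>y. ?f y * ?b y ^ (k + 3) \<partial>lborel)"
    have i: "integrable lborel (\<lambda>y. ?f y * ?b y ^ (k + 3))"
      by (rule integrable_mult_bump[OF \<Omega> cf]) (use R in auto)
    have pt: "- (u y * (4 * m * (m - 1) * (dist x y)\<^sup>2 * ?b y ^ (k + 1) - 2 * m * CARD('n) * ?b y ^ (k + 2)))
        \<le> ?f y * ?b y ^ (k + 3) / 2 + E * indicator (ball x R) y" for y
    proof (cases "y \<in> ball x R")
      case False then show ?thesis using bump_eq_0[of R y x] R by (simp add: power_add)
    next
      case True
      have b: "0 \<le> ?b y" "?b y \<le> 1"
        using bump_nonneg[of R x y] bump_le[of R x y] power_mono[of R 1 2] R by auto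
      have d: "(dist x y)\<^sup>2 \<le> 1" using True R power_mono[of "dist x y" 1 2] by auto
      define t where "t = max (u y - 1) 0"
      have t: "0 \<le> t" "u y \<le> 1 + t" by (auto simp: t_def)
      have "\<kappa> * u y * ?b y ^ (k + 2) \<le> \<kappa> * (1 + t) * ?b y ^ (k + 2)"
        using t \<kappa> b by (intro mult_right_mono mult_left_mono) auto
      also have "\<dots> = \<kappa> * ?b y ^ (k + 2) + \<kappa> * t * ?b y ^ (k + 2)" by (simp add: algebra_simps)
      also have "\<kappa> * ?b y ^ (k + 2) \<le> \<kappa> * 1"
        using b \<kappa> by (intro mult_left_mono power_le_one) auto
      also have "\<kappa> * t * ?b y ^ (k + 2) \<le> t powr p * ?b y ^ Suc (k + 2) / 2 + \<kappa> * (2 * \<kappa>) powr (1 / (p - 1))"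
        by (rule linear_absorbed_by_power[OF t(1) b p \<kappa> k])
      finally have 1: "\<kappa> * u y * ?b y ^ (k + 2) \<le> \<kappa> + (?f y * ?b y ^ (k + 3) / 2 + \<kappa> * (2 * \<kappa>) powr (1 / (p - 1)))"
        by (simp add: t_def pos_power_def numeral_3_eq_3)
      have q: "0 \<le> 4 * m * (m - 1) * ((dist x y)\<^sup>2 * ?b y ^ (k + 1))" using m b by simp
      have q': "(dist x y)\<^sup>2 * ?b y ^ (k + 1) \<le> 1 * 1"
        by (rule mult_mono[OF d power_le_one]) (use b in auto)
      have "(- u y) * (4 * m * (m - 1) * ((dist x y)\<^sup>2 * ?b y ^ (k + 1))) \<le> L * (4 * m * (m - 1) * ((dist x y)\<^sup>2 * ?b y ^ (k + 1)))"
        using low[OF True] q by (intro mult_right_mono) auto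
      also have "\<dots> \<le> L * (4 * m * (m - 1) * (1 * 1))"
        using q' m L by (intro mult_left_mono) auto
      finally have 2: "(- u y) * (4 * m * (m - 1) * ((dist x y)\<^sup>2 * ?b y ^ (k + 1))) \<le> 4 * m * (m - 1) * L" by simp
      show ?thesis using 1 2 True unfolding E_def \<kappa>_def by (simp add: algebra_simps)
    qed
    have "I = - (\<integral>y. - ?f y * ?b y ^ (k + 3) \<partial>lborel)" by (simp add: I_def)
    also have "\<dots> = - (\<integral>y. u y * (4 * m * (m - 1) * (dist x y)\<^sup>2 * ?b y ^ (k + 1) - 2 * m * CARD('n) * ?b y ^ (k + 2)) \<partial>lborel)"
      using Green_bump[OF \<Omega> u _ R(3), of k] R by (simp add: m_def)
    also have "\<dots> = (\<integral>y. - (u y * (4 * m * (m - 1) * (dist x y)\<^sup>2 * ?b y ^ (k + 1) - 2 * m * CARD('n) * ?b y ^ (k + 2))) \<partial>lborel)"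
      by simp
    also have "\<dots> \<le> (\<integral>y. ?f y * ?b y ^ (k + 3) / 2 + E * indicator (ball x R) y \<partial>lborel)"
    proof (rule integral_mono[OF _ _ pt])
      show "integrable lborel (\<lambda>y. - (u y * (4 * m * (m - 1) * (dist x y)\<^sup>2 * ?b y ^ (k + 1) - 2 * m * CARD('n) * ?b y ^ (k + 2))))"
        by (rule integrable_minus, rule integrable_mult_support[OF \<Omega> cu _ compact_cball R(3)])
          (use R in \<open>auto intro!: continuous_on_diff continuous_on_mult continuous_on_power continuous_on_bump continuous_on_dist continuous_on_id continuous_on_const simp: bump_eq_0\<close>)
      show "integrable lborel (\<lambda>y. ?f y * ?b y ^ (k + 3) / 2 + E * indicator (ball x R) y)"
        by (intro Bochner_Integration.integrable_add integrable_divide i integrable_indicator_ball)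
    qed
    also have "\<dots> = I / 2 + E * (?V * R ^ CARD('n))"
      using i integrable_indicator_ball[of E x R] measure_ball_vec[of R x] R
      by (subst Bochner_Integration.integral_add) (simp_all add: I_def)
    finally have I: "I \<le> 2 * E * ?V * R ^ CARD('n)" by simp
    \<comment> \<open>On the ball of half the radius |x - y|^2 is at most R^2 / 4, which leaves at
      least 3/4 R^2 for the weight.\<close>
    define q where "q = (3 / 4 * R\<^sup>2) ^ (k + 3)"
    have q: "0 < q" using R by (simp add: q_def)
    have "(\<integral>y. q * (?f y * indicator (ball x (R / 2)) y) \<partial>lborel) \<le> I"
      unfolding I_def
    proof (rule integral_mono[OF _ i])
      show "integrable lborel (\<lambda>y. q * (?f y * indicator (ball x (R / 2)) y))"
        by (intro integrable_mult_right integrable_mult_indicator_ball[OF cf]) (use R in auto)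
      fix y
      show "q * (?f y * indicator (ball x (R / 2)) y) \<le> ?f y * ?b y ^ (k + 3)"
      proof (cases "y \<in> ball x (R / 2)")
        case True
        then have "(dist x y)\<^sup>2 \<le> (R / 2)\<^sup>2" by (intro power_mono) auto
        then have "3 / 4 * R\<^sup>2 \<le> R\<^sup>2 - (dist x y)\<^sup>2" by (simp add: power_divide)
        then have "3 / 4 * R\<^sup>2 \<le> ?b y" by (simp add: bump_def le_max_iff_disj)
        then have "q \<le> ?b y ^ (k + 3)" unfolding q_def by (intro power_mono) auto
        from mult_left_mono[OF this pos_power_nonneg] show ?thesis using True
          by (simp add: mult.commute)
      qed (simp add: pos_power_nonneg bump_nonneg)
    qed
    then show ?thesis using I q unfolding F_def q_def[symmetric] by (simp add: field_simps)
  qed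
  have "0 < F" using E R by (simp add: F_def)
  then show ?thesis using that bound by blast
qed

section \<open>From the integral bound to a pointwise bound\<close>

lemma interpolate_le:
  fixes X F Y e :: real
  assumes "0 \<le> X" "X \<le> F" "X \<le> Y" "0 \<le> e" "e \<le> 1"
  shows "X \<le> F powr (1 - e) * Y powr e"
proof (cases "X = 0")
  case False
  then have "X = X powr (1 - e) * X powr e" using assms by (simp flip: powr_add)
  also have "\<dots> \<le> F powr (1 - e) * Y powr e"
    using assms by (intro mult_mono powr_mono2) auto
  finally show ?thesis .
qed simp

text \<open>For S > 1 the constant \<open>K1\<close> is at most \<open>K1 * S powr \<theta>\<close>;
  dividing by S^\<theta> then leaves a bound on S^(1 - \<theta>).\<close>

lemma sublinear_absorption:
  fixes S :: real
  assumes "0 \<le> S" "0 < c" "0 \<le> K1" "0 \<le> K2" "0 < \<theta>" "\<theta> < 1" and le: "c * S \<le> K1 + K2 * S powr \<theta>"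
  shows "S \<le> max 1 (((K1 + K2) / c) powr (1 / (1 - \<theta>)))"
proof (cases "S \<le> 1")
  case False
  then have S: "1 < S" by simp
  have "1 \<le> S powr \<theta>" using S assms by (simp add: ge_one_powr_ge_zero)
  then have "c * S \<le> (K1 + K2) * S powr \<theta>"
    using le mult_left_mono[of 1 "S powr \<theta>" K1] assms by (simp add: algebra_simps)
  moreover have "S = S powr (1 - \<theta>) * S powr \<theta>" using S by (simp flip: powr_add)
  ultimately have "c * S powr (1 - \<theta>) * S powr \<theta> \<le> (K1 + K2) * S powr \<theta>" by (metis mult.assoc)
  then have "c * S powr (1 - \<theta>) \<le> K1 + K2" using S by simp
  then have "S powr (1 - \<theta>) \<le> (K1 + K2) / c" using assms by (simp add: field_simps)
  then have "(S powr (1 - \<theta>)) powr (1 / (1 - \<theta>)) \<le> ((K1 + K2) / c) powr (1 / (1 - \<theta>))"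
    using assms by (intro powr_mono2) auto
  then show ?thesis using S assms by (simp add: powr_powr)
qed simp

text \<open>\<open>M\<close> again precedes the solution. The weight is the N-th power of the
  distance to the sphere because, by the integral bound, averages over a ball of radius d cost
  d^(-N). Multiplying the estimate at the maximum point by (2 d)^N leaves K1 + K2 S^\<theta>, free
  of d, however close to the sphere the maximum is attained.\<close>

lemma local_sup_bound:
  fixes x\<^sub>0 :: "real^'n::finite"
  assumes \<Omega>: "open \<Omega>" and p: "1 < p" and s: "p < s" "real CARD('n) - 2 < CARD('n) / s"
    and R: "0 < R" "R \<le> 1" "cball x\<^sub>0 R \<subseteq> \<Omega>" and F: "0 < F"
  obtains M where "\<And>u y. has_laplacian_on \<Omega> u (\<lambda>y. - pos_power p (u y)) \<Longrightarrow>
    (\<integral>y. pos_power p (u y) * indicator (ball x\<^sub>0 R) y \<partial>lborel) \<le> F \<Longrightarrow> y \<in> cball x\<^sub>0 (R / 2) \<Longrightarrow> u y \<le> M"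
proof -
  let ?V = "unit_ball_vol (CARD('n))" and ?N = "CARD('n)" and ?c = "bump_mass TYPE('n)"
  have s0: "0 < s" "1 < s" using p s by auto
  \<comment> \<open>The local supremum T enters the interpolation as (T^p)^(1/s), so p < s makes it
    sublinear.\<close>
  define \<theta> where "\<theta> = p / s"
  have \<theta>: "0 < \<theta>" "\<theta> < 1" using p s s0 by (auto simp: \<theta>_def)
  \<comment> \<open>The derivative of the averages is of order \<rho>^(1 - N) \<rho>^(N / s) =
    \<rho>^(\<beta> - 1), with primitive a multiple of \<rho>^\<beta>, which tends to 0 since
    \<beta> > 0.\<close>
  define \<beta> where "\<beta> = 2 - real ?N + ?N / s"
  have \<beta>: "0 < \<beta>" using s by (simp add: \<beta>_def)
  define \<kappa> where "\<kappa> = F powr (1 - 1 / s) * ?V powr (1 / s) / 6"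
  have \<kappa>: "0 \<le> \<kappa>" by (simp add: \<kappa>_def)
  define K1 where "K1 = 2 ^ ?N * (2 * ?V + F)"
  define K2 where "K2 = 2 ^ ?N * (\<kappa> / \<beta>)"
  have K: "0 \<le> K1" "0 \<le> K2" using F \<kappa> \<beta> by (auto simp: K1_def K2_def)
  define S0 where "S0 = max 1 (((K1 + K2) / ?c) powr (1 / (1 - \<theta>)))"
  have S0: "0 \<le> S0" by (simp add: S0_def)
  have bound: "u y \<le> 1 + S0 / (R / 2) ^ ?N"
    if u: "has_laplacian_on \<Omega> u (\<lambda>y. - pos_power p (u y))"
      and Fu: "(\<integral>y. pos_power p (u y) * indicator (ball x\<^sub>0 R) y \<partial>lborel) \<le> F"
      and y: "y \<in> cball x\<^sub>0 (R / 2)" for u y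
  proof -
    let ?f = "\<lambda>y. pos_power p (u y)"
    define t where "t y = max (u y - 1) 0" for y
    have t0: "0 \<le> t y" for y by (simp add: t_def)
    have cu: "continuous_on \<Omega> u" using has_laplacian_on_continuous(1)[OF u] .
    have cf: "continuous_on \<Omega> ?f" by (rule continuous_on_pos_power_comp[OF _ cu]) (use p in simp)
    let ?w = "\<lambda>y. (R - dist x\<^sub>0 y) ^ ?N * t y"
    have "continuous_on (cball x\<^sub>0 R) ?w"
      unfolding t_def
      by (intro continuous_on_mult continuous_on_power continuous_on_diff continuous_on_dist continuous_on_max
          continuous_on_id continuous_on_const continuous_on_subset[OF cu R(3)])
    \<comment> \<open>near a maximum point \<open>x\<^sub>1\<close> of the weighted function, \<open>t\<close> exceeds \<open>t x\<^sub>1\<close> at most by a constant factor\<close>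
    then obtain x\<^sub>1 where x\<^sub>1: "x\<^sub>1 \<in> cball x\<^sub>0 R" and max: "\<And>y. y \<in> cball x\<^sub>0 R \<Longrightarrow> ?w y \<le> ?w x\<^sub>1"
      using continuous_attains_sup[of "cball x\<^sub>0 R" ?w] R by auto
    define S where "S = ?w x\<^sub>1"
    have S_nonneg: "0 \<le> S" using x\<^sub>1 t0 by (simp add: S_def)
    have "S \<le> S0"
    proof (cases "S = 0")
      case True then show ?thesis using S0 by simp
    next
      case False
      \<comment> \<open>Half the distance to the sphere: the closed ball of radius \<open>d\<close>
        about \<open>x\<^sub>1\<close> keeps distance at least \<open>d\<close> from it, and the
        averages can be differentiated at all radii below \<open>2 * d\<close>.\<close>
      define d where "d = (R - dist x\<^sub>0 x\<^sub>1) / 2"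
      have "dist x\<^sub>0 x\<^sub>1 \<noteq> R" using False by (auto simp: S_def)
      then have d: "0 < d" "d \<le> 1" using x\<^sub>1 R zero_le_dist[of x\<^sub>0 x\<^sub>1] by (auto simp: d_def simp del: zero_le_dist)
      have t1: "0 < t x\<^sub>1" using False t0[of x\<^sub>1] by (auto simp: S_def less_le)
      have dist_d: "d \<le> R - dist x\<^sub>0 y" if "y \<in> cball x\<^sub>1 d" for y
        using that dist_triangle[of x\<^sub>0 y x\<^sub>1] by (simp add: d_def)
      have sub: "cball x\<^sub>1 \<rho> \<subseteq> \<Omega>" if "\<rho> \<le> d" for \<rho>
      proof
        fix y assume "y \<in> cball x\<^sub>1 \<rho>"
        then show "y \<in> \<Omega>" using dist_d[of y] that d R(3) by auto
      qed
      have ball2: "ball x\<^sub>1 (2 * d) \<subseteq> \<Omega>"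
      proof
        fix y assume "y \<in> ball x\<^sub>1 (2 * d)"
        then have "dist x\<^sub>0 y \<le> R" using dist_triangle[of x\<^sub>0 y x\<^sub>1] by (simp add: d_def)
        then show "y \<in> \<Omega>" using R(3) by auto
      qed
      define T where "T = S / d ^ ?N"
      have T: "0 \<le> T" using S_nonneg d by (simp add: T_def)
      have t_le: "t y \<le> T" if "y \<in> cball x\<^sub>1 d" for y
      proof -
        have "d ^ ?N * t y \<le> ?w y"
          using dist_d[OF that] d t0 by (intro mult_right_mono power_mono) auto
        also have "\<dots> \<le> S" unfolding S_def by (rule max) (use dist_d[OF that] d in auto)
        finally show ?thesis using d by (simp add: T_def field_simps)
      qed
      have f_le: "?f y \<le> T powr p" if "y \<in> cball x\<^sub>1 d" for y
        using t_le[OF that] t0 p by (auto simp: pos_power_def t_def intro!: powr_mono2)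
      have ind_le: "indicator (ball x\<^sub>1 \<rho>) y \<le> (indicator (ball x\<^sub>0 R) y :: real)" if "\<rho> \<le> d" for \<rho> y
        using dist_d[of y] that d by (auto simp: indicator_def)
      have x\<^sub>1O: "x\<^sub>1 \<in> \<Omega>" using x\<^sub>1 R(3) by auto
      have int_ind: "integrable lborel (\<lambda>y. ?f y * indicator (ball x\<^sub>0 R) y)"
        by (rule integrable_mult_indicator_ball[OF cf R(3)])
      have main: "?c * u x\<^sub>1 \<le> avg u x\<^sub>1 d + \<kappa> * T powr \<theta> / \<beta> * d powr \<beta>"
      proof (rule limit_le_of_DERIV_nonneg[OF d(1)])
        fix \<rho> assume \<rho>: "0 < \<rho>" "\<rho> \<le> d"
        show "(avg u x\<^sub>1 has_real_derivative (\<integral>y. - ?f y * bump \<rho> x\<^sub>1 y ^ 3 \<partial>lborel) / (6 * \<rho> ^ (?N + 5))) (at \<rho>)"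
          by (rule DERIV_avg[OF \<Omega> u ball2]) (use \<rho> d in auto)
        show "((\<lambda>\<rho>. \<kappa> * T powr \<theta> / \<beta> * \<rho> powr \<beta>) has_real_derivative \<kappa> * T powr \<theta> * \<rho> powr (\<beta> - 1)) (at \<rho>)"
          using DERIV_cmult[OF has_real_derivative_powr[OF \<rho>(1), of \<beta>], of "\<kappa> * T powr \<theta> / \<beta>"] \<beta> by (simp add: mult.assoc)
        define I where "I = (\<integral>y. ?f y * bump \<rho> x\<^sub>1 y ^ 3 \<partial>lborel)"
        \<comment> \<open>The cubed weight is at most \<rho>^6. After division by this bound, both
          the integral bound \<open>F\<close> and the bound \<open>T powr p\<close> times the volume
          of the ball apply.\<close>
        define X where "X = I / \<rho> ^ 6"
        have i: "integrable lborel (\<lambda>y. ?f y * bump \<rho> x\<^sub>1 y ^ 3)"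
          by (rule integrable_mult_bump[OF \<Omega> cf]) (use \<rho> sub in auto)
        have I0: "0 \<le> I" unfolding I_def
          by (rule Bochner_Integration.integral_nonneg) (simp add: pos_power_nonneg bump_nonneg)
        then have X0: "0 \<le> X" using \<rho> by (simp add: X_def)
        have "I \<le> (\<integral>y. \<rho> ^ 6 * (?f y * indicator (ball x\<^sub>0 R) y) \<partial>lborel)"
          unfolding I_def
        proof (rule integral_mono[OF i])
          show "integrable lborel (\<lambda>y. \<rho> ^ 6 * (?f y * indicator (ball x\<^sub>0 R) y))"
            by (rule integrable_mult_right[OF int_ind])
          fix y
          have "bump \<rho> x\<^sub>1 y ^ 3 \<le> \<rho> ^ 6 * indicator (ball x\<^sub>1 \<rho>) y"
          proof (cases "y \<in> ball x\<^sub>1 \<rho>")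
            case True
            have "bump \<rho> x\<^sub>1 y ^ 3 \<le> (\<rho>\<^sup>2) ^ 3" by (intro power_mono bump_le bump_nonneg)
            then show ?thesis using True by (simp add: power_mult[symmetric])
          qed (use bump_eq_0[of \<rho> y x\<^sub>1] \<rho> in simp)
          also have "\<dots> \<le> \<rho> ^ 6 * indicator (ball x\<^sub>0 R) y"
            using ind_le[OF \<rho>(2)] \<rho> by (intro mult_left_mono) auto
          finally have "?f y * bump \<rho> x\<^sub>1 y ^ 3 \<le> ?f y * (\<rho> ^ 6 * indicator (ball x\<^sub>0 R) y)"
            by (intro mult_left_mono pos_power_nonneg)
          then show "?f y * bump \<rho> x\<^sub>1 y ^ 3 \<le> \<rho> ^ 6 * (?f y * indicator (ball x\<^sub>0 R) y)"
            by (simp only: mult.left_commute)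
        qed
        also have "\<dots> \<le> \<rho> ^ 6 * F" using Fu \<rho> by simp
        finally have X1: "X \<le> F" using \<rho> by (simp add: X_def field_simps)
        have "\<bar>I\<bar> \<le> T powr p * ?V * \<rho> ^ (?N + 2 * 3)"
          unfolding I_def
          by (rule integral_bump_le[OF \<Omega> cf \<rho>(1) sub[OF \<rho>(2)]]) (use f_le \<rho> in \<open>auto simp: pos_power_nonneg\<close>)
        then have X2: "X \<le> T powr p * (?V * \<rho> powr ?N)"
          using \<rho> I0 by (simp add: X_def power_add field_simps powr_realpow)
        have "X \<le> F powr (1 - 1 / s) * (T powr p * (?V * \<rho> powr ?N)) powr (1 / s)"
          by (rule interpolate_le[OF X0 X1 X2]) (use s0 in auto)
        also have "(T powr p * (?V * \<rho> powr ?N)) powr (1 / s) = T powr \<theta> * (?V powr (1 / s) * \<rho> powr (?N / s))"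
          by (simp add: powr_mult powr_powr \<theta>_def)
        finally have X3: "X \<le> 6 * \<kappa> * T powr \<theta> * \<rho> powr (?N / s)"
          by (simp add: \<kappa>_def mult.commute mult.left_commute)
        have "I / (6 * \<rho> ^ (?N + 5)) = X / 6 * \<rho> powr (1 - real ?N)"
          using \<rho> by (simp add: X_def powr_diff powr_realpow power_add field_simps eval_nat_numeral)
        also have "\<dots> \<le> (6 * \<kappa> * T powr \<theta> * \<rho> powr (?N / s)) / 6 * \<rho> powr (1 - real ?N)"
          using X3 by (intro mult_right_mono divide_right_mono) auto
        also have "\<dots> = \<kappa> * T powr \<theta> * \<rho> powr (\<beta> - 1)"
        proof -
          have "\<rho> powr (\<beta> - 1) = \<rho> powr (?N / s) * \<rho> powr (1 - real ?N)"
            unfolding powr_add[symmetric] \<beta>_def by (simp add: algebra_simps)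
          then show ?thesis by simp
        qed
        finally show "0 \<le> (\<integral>y. - ?f y * bump \<rho> x\<^sub>1 y ^ 3 \<partial>lborel) / (6 * \<rho> ^ (?N + 5)) + \<kappa> * T powr \<theta> * \<rho> powr (\<beta> - 1)"
          by (simp add: I_def)
      next
        show "(avg u x\<^sub>1 \<longlongrightarrow> ?c * u x\<^sub>1) (at_right 0)" by (rule tendsto_avg[OF \<Omega> cu x\<^sub>1O])
        have "((\<lambda>\<rho>. \<rho> powr \<beta>) \<longlongrightarrow> 0 powr \<beta>) (at_right 0)"
          by (rule tendsto_powr'[OF tendsto_ident_at tendsto_const])
            (use \<beta> in \<open>auto simp: eventually_at_right_field intro: exI[of _ 1]\<close>)
        then show "((\<lambda>\<rho>. \<kappa> * T powr \<theta> / \<beta> * \<rho> powr \<beta>) \<longlongrightarrow> 0) (at_right 0)"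
          by (intro tendsto_mult_right_zero) simp
      qed
      \<comment> \<open>The pointwise inequality t \<le> 1 + t^p gives u \<le> 2 + t^p, so the
        integral bound on the nonlinearity also controls averages of \<open>u\<close> from
        above.\<close>
      have avg_le: "avg u x\<^sub>1 d \<le> (2 * ?V + F) / d ^ ?N"
      proof -
        have "(\<integral>y. u y * bump d x\<^sub>1 y ^ 2 \<partial>lborel)
          \<le> (\<integral>y. (2 * d ^ 4) * indicator (ball x\<^sub>1 d) y + d ^ 4 * (?f y * indicator (ball x\<^sub>0 R) y) \<partial>lborel)"
        proof (rule integral_mono)
          show "integrable lborel (\<lambda>y. u y * bump d x\<^sub>1 y ^ 2)"
            by (rule integrable_mult_bump[OF \<Omega> cu]) (use d sub in auto)
          show "integrable lborel (\<lambda>y. (2 * d ^ 4) * indicator (ball x\<^sub>1 d) y + d ^ 4 * (?f y * indicator (ball x\<^sub>0 R) y))"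
            by (intro Bochner_Integration.integrable_add integrable_indicator_ball integrable_mult_right int_ind)
          fix y
          show "u y * bump d x\<^sub>1 y ^ 2 \<le> (2 * d ^ 4) * indicator (ball x\<^sub>1 d) y + d ^ 4 * (?f y * indicator (ball x\<^sub>0 R) y)"
          proof (cases "y \<in> ball x\<^sub>1 d")
            case False
            then show ?thesis using bump_eq_0[of d y x\<^sub>1] d pos_power_nonneg[of p "u y"] by simp
          next
            case True
            have "t y \<le> 1 + t y powr p"
              using t0[of y] p powr_mono[of 1 p "t y"] by (cases "t y \<le> 1") (auto simp: add_increasing2)
            then have "u y \<le> 2 + ?f y" by (simp add: t_def pos_power_def)
            moreover have "bump d x\<^sub>1 y ^ 2 \<le> (d\<^sup>2) ^ 2" by (intro power_mono bump_le bump_nonneg)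
            ultimately have "u y * bump d x\<^sub>1 y ^ 2 \<le> (2 + ?f y) * d ^ 4"
              using pos_power_nonneg[of p "u y"]
              by (intro order_trans[OF mult_right_mono[of "u y" "2 + ?f y"] mult_left_mono]) (auto simp: power_mult[symmetric])
            moreover have "y \<in> ball x\<^sub>0 R" using ind_le[OF order_refl, of y] True by (auto simp: indicator_def split: if_splits)
            ultimately show ?thesis using True by (simp add: algebra_simps)
          qed
        qed
        also have "\<dots> = 2 * d ^ 4 * (?V * d ^ ?N) + d ^ 4 * (\<integral>y. ?f y * indicator (ball x\<^sub>0 R) y \<partial>lborel)"
          using integrable_indicator_ball[of "2 * d ^ 4" x\<^sub>1 d] int_ind measure_ball_vec[of d x\<^sub>1] d
          by (subst Bochner_Integration.integral_add) simp_all
        also have "\<dots> \<le> 2 * d ^ 4 * (?V * 1) + d ^ 4 * F"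
          using d Fu by (intro add_mono mult_left_mono power_le_one) auto
        also have "\<dots> = (2 * ?V + F) * d ^ 4" by (simp add: algebra_simps)
        finally have "avg u x\<^sub>1 d \<le> (2 * ?V + F) * d ^ 4 / d ^ (?N + 4)"
          unfolding avg_def using d by (intro divide_right_mono) auto
        then show ?thesis using d by (simp add: power_add)
      qed
      have "R - dist x\<^sub>0 x\<^sub>1 = 2 * d" by (simp add: d_def)
      then have "?c * S = (2 * d) ^ ?N * (?c * t x\<^sub>1)" by (simp add: S_def)
      also have "\<dots> \<le> (2 * d) ^ ?N * (?c * u x\<^sub>1)"
        using t1 d bump_mass_pos[where 'n='n] by (intro mult_left_mono) (auto simp: t_def)
      also have "\<dots> \<le> (2 * d) ^ ?N * ((2 * ?V + F) / d ^ ?N + \<kappa> / \<beta> * T powr \<theta>)"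
      proof (intro mult_left_mono order_trans[OF main add_mono[OF avg_le]])
        have "d powr \<beta> \<le> 1" using d \<beta> powr_mono2[of \<beta> d 1] by simp
        then have "\<kappa> * T powr \<theta> / \<beta> * d powr \<beta> \<le> \<kappa> * T powr \<theta> / \<beta> * 1"
          using \<kappa> \<beta> by (intro mult_left_mono) auto
        then show "\<kappa> * T powr \<theta> / \<beta> * d powr \<beta> \<le> \<kappa> / \<beta> * T powr \<theta>" by simp
      qed (use d in auto)
      also have "\<dots> = K1 + K2 * (d ^ ?N * T powr \<theta>)"
        using d by (simp add: K1_def K2_def field_simps power_mult_distrib)
      \<comment> \<open>With T = S / d^N the left side is S^\<theta> (d^N)^(1 - \<theta>), and
        \<open>d \<le> 1\<close>.\<close>
      also have "d ^ ?N * T powr \<theta> \<le> S powr \<theta>"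
      proof -
        have "d ^ ?N * T powr \<theta> = d ^ ?N * S powr \<theta> / (d ^ ?N) powr \<theta>"
          using d S_nonneg by (simp add: T_def powr_divide)
        also have "\<dots> = S powr \<theta> * (d ^ ?N) powr (1 - \<theta>)" using d by (simp add: powr_diff)
        also have "(d ^ ?N) powr (1 - \<theta>) \<le> 1"
          using d \<theta> powr_mono2[of "1 - \<theta>" "d ^ ?N" 1] by (simp add: power_le_one)
        then have "S powr \<theta> * (d ^ ?N) powr (1 - \<theta>) \<le> S powr \<theta> * 1" by (intro mult_left_mono) auto
        finally show ?thesis by simp
      qed
      finally have "?c * S \<le> K1 + K2 * S powr \<theta>" using K by (simp add: mult_left_mono)
      from sublinear_absorption[OF S_nonneg bump_mass_pos K \<theta> this] show ?thesis by (simp add: S0_def)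
    qed
    have yR: "y \<in> cball x\<^sub>0 R" using y R by auto
    \<comment> \<open>Points of the half ball are at distance at least R / 2 from the sphere, so the
      weight can be removed.\<close>
    have "(R / 2) ^ ?N * t y \<le> ?w y"
      using y R t0 by (intro mult_right_mono power_mono) auto
    also have "\<dots> \<le> S0" using max[OF yR] \<open>S \<le> S0\<close> unfolding S_def by simp
    finally have "t y \<le> S0 / (R / 2) ^ ?N" using R by (simp add: pos_le_divide_eq mult.commute)
    then show ?thesis by (simp add: t_def)
  qed
  show ?thesis by (rule that) (rule bound)
qed

section \<open>Locally uniform limits\<close>

text \<open>At the threshold 1 the Caratheodory slope is \<open>pos_power (p - 1)\<close>,
  continuous because p > 1. For p < 2 this slope is only Hoelder continuous, so the equation can be
  differentiated once but in general not twice.\<close>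

lemma DERIV_pos_power:
  assumes p: "1 < p"
  shows "(pos_power p has_real_derivative p * pos_power (p - 1) t) (at t)"
proof (cases t "1::real" rule: linorder_cases)
  case less
  have "eventually (\<lambda>s. s \<in> {..<1}) (nhds t)" using less by (intro eventually_nhds_in_open) auto
  then have "eventually (\<lambda>s. pos_power p s = 0) (nhds t)"
    by eventually_elim (simp add: pos_power_def max_def)
  then have "(pos_power p has_real_derivative 0) (at t)"
    by (rule DERIV_cong_ev[OF refl _ refl, THEN iffD2]) simp
  moreover have "pos_power (p - 1) t = 0" using less by (simp add: pos_power_def max_def)
  ultimately show ?thesis by simp
next
  case greater
  have "eventually (\<lambda>s. s \<in> {1<..}) (nhds t)" using greater by (intro eventually_nhds_in_open) auto
  then have ev: "eventually (\<lambda>s. pos_power p s = (s - 1) powr p) (nhds t)"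
    by eventually_elim (simp add: pos_power_def max_def)
  have "((\<lambda>s. s - 1) has_real_derivative 1) (at t)" by (auto intro!: derivative_eq_intros)
  from DERIV_chain2[OF has_real_derivative_powr this] greater
  have "((\<lambda>s. (s - 1) powr p) has_real_derivative p * (t - 1) powr (p - 1)) (at t)" by simp
  with ev have "(pos_power p has_real_derivative p * (t - 1) powr (p - 1)) (at t)"
    by (rule DERIV_cong_ev[OF refl _ refl, THEN iffD2])
  then show ?thesis using greater by (simp add: pos_power_def max_def)
next
  case equal
  have "isCont (pos_power (p - 1)) 1"
    using continuous_on_pos_power[of "p - 1" UNIV] p by (simp add: continuous_on_eq_continuous_at)
  then have "isCont (\<lambda>z. pos_power (p - 1) z) 1" .
  moreover have "pos_power p z = pos_power (p - 1) z * (z - 1)" for z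
  proof (cases "1 < z")
    case True
    have "(z - 1) powr p = (z - 1) powr ((p - 1) + 1)" by simp
    also have "\<dots> = (z - 1) powr (p - 1) * (z - 1) powr 1" by (rule powr_add)
    finally show ?thesis using True by (simp add: pos_power_def)
  qed (simp add: pos_power_def)
  moreover have "pos_power (p - 1) 1 = 0" "pos_power p 1 = 0" by (simp_all add: pos_power_def)
  ultimately show ?thesis unfolding equal CARAT_DERIV
    by (intro exI[of _ "pos_power (p - 1)"]) simp
qed

lemma pderiv_on_pos_power:
  assumes p: "1 < p" and u: "pderiv_on S i u u'"
  shows "pderiv_on S i (\<lambda>x. pos_power p (u x)) (\<lambda>x. p * pos_power (p - 1) (u x) * u' x)"
proof (rule pderiv_onI)
  show "continuous_on S (\<lambda>x. pos_power p (u x))"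
    by (rule continuous_on_pos_power_comp[OF _ pderiv_onD(1)[OF u]]) (use p in simp)
  show "continuous_on S (\<lambda>x. p * pos_power (p - 1) (u x) * u' x)"
    by (intro continuous_on_mult continuous_on_const continuous_on_pos_power_comp pderiv_onD[OF u]) (use p in simp)
  fix x assume x: "x \<in> S"
  show "((\<lambda>t. pos_power p (u (x + t *\<^sub>R axis i 1))) has_real_derivative p * pos_power (p - 1) (u x) * u' x) (at 0)"
    using DERIV_chain2[OF DERIV_pos_power[OF p] pderiv_onD(3)[OF u x]] by simp
qed

lemma pderiv_on_cong_open:
  assumes "open S" "pderiv_on S i u u'" "\<And>x. x \<in> S \<Longrightarrow> u x = v x"
  shows "pderiv_on S i v u'"
proof (rule pderiv_onI)
  show "continuous_on S v" using pderiv_onD(1)[OF assms(2)] assms(3) by (simp cong: continuous_on_cong)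
  show "continuous_on S u'" using pderiv_onD(2)[OF assms(2)] .
  fix x assume x: "x \<in> S"
  have "eventually (\<lambda>t. v (x + t *\<^sub>R axis i 1) = u (x + t *\<^sub>R axis i 1)) (nhds (0::real))"
    using eventually_line_mem[OF assms(1) x, where e="axis i 1"] by eventually_elim (simp add: assms(3))
  then show "((\<lambda>t. v (x + t *\<^sub>R axis i 1)) has_real_derivative u' x) (at 0)"
    using pderiv_onD(3)[OF assms(2) x] by (rule DERIV_cong_ev[OF refl _ refl, THEN iffD2])
qed

text \<open>\<open>pdiff j (pdiff i v)\<close> differentiates the total function
  \<open>pdiff i v\<close>, which is known only on \<open>S\<close>; since \<open>S\<close> is open,
  short segments stay where it agrees with \<open>V i\<close>.\<close>

lemma C2_onI:
  assumes S: "open S" and V: "\<And>i. pderiv_on S i v (V i)" and W: "\<And>i j. pderiv_on S j (V i) (W i j)"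
  shows "C2_on S v" "x \<in> S \<Longrightarrow> pdiff i v x = V i x" "x \<in> S \<Longrightarrow> pdiff j (pdiff i v) x = W i j x"
proof -
  have 1: "pdiff i v x = V i x" if "x \<in> S" for i x by (rule pderiv_on_eq_pdiff[OF V that])
  have 2: "pderiv_on S j (pdiff i v) (W i j)" for i j
    by (rule pderiv_on_cong_open[OF S W]) (simp add: 1)
  have 3: "pdiff j (pdiff i v) x = W i j x" if "x \<in> S" for i j x by (rule pderiv_on_eq_pdiff[OF 2 that])
  have hp: "has_pdiff_on S u" if "\<And>i. pderiv_on S i u (U i)" for u U
    using pderiv_onD(3)[OF that] unfolding has_pdiff_on_def field_differentiable_def by blast
  have "continuous_on S (pdiff j (pdiff i v))" for i j
    using pderiv_onD(2)[OF W[of j i]] 3[of _ j i] by (simp cong: continuous_on_cong)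
  moreover have "has_pdiff_on S v" by (rule hp[OF V])
  moreover have "has_pdiff_on S (pdiff i v)" for i by (rule hp[OF 2])
  ultimately show "C2_on S v"
    using pderiv_onD(1)[OF V] pderiv_onD(1)[OF 2] unfolding C2_on_def by blast
  show "x \<in> S \<Longrightarrow> pdiff i v x = V i x" "x \<in> S \<Longrightarrow> pdiff j (pdiff i v) x = W i j x"
    using 1 3 by auto
qed

lemma continuous_on_locally_uniform_limit:
  fixes f :: "nat \<Rightarrow> 'a::euclidean_space \<Rightarrow> real"
  assumes \<Omega>: "open \<Omega>" and c: "\<And>n. continuous_on \<Omega> (f n)"
    and l: "\<And>K. compact K \<Longrightarrow> K \<subseteq> \<Omega> \<Longrightarrow> uniform_limit K f l sequentially"
  shows "continuous_on \<Omega> l"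
proof (rule continuous_at_imp_continuous_on, rule ballI)
  fix x assume "x \<in> \<Omega>"
  then obtain r where r: "0 < r" "cball x r \<subseteq> \<Omega>" using \<Omega> by (meson open_contains_cball)
  have "continuous_on (cball x r) l"
    by (rule uniform_limit_theorem[OF _ l[OF compact_cball r(2)]])
      (simp_all add: continuous_on_subset[OF c r(2)])
  then show "isCont l x" using r by (intro continuous_on_interior) auto
qed

text \<open>On a segment in direction \<open>i\<close> this is the one-dimensional theorem on
  uniformly convergent derivatives; the limit function which that theorem supplies is identified
  with \<open>v\<close> by uniqueness of limits.\<close>

lemma pderiv_on_locally_uniform_limit:
  fixes \<Omega> :: "(real^'n::finite) set"
  assumes \<Omega>: "open \<Omega>" and u: "\<And>n. pderiv_on \<Omega> i (u n) (u' n)"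
    and v: "\<And>K. compact K \<Longrightarrow> K \<subseteq> \<Omega> \<Longrightarrow> uniform_limit K u v sequentially"
    and v': "\<And>K. compact K \<Longrightarrow> K \<subseteq> \<Omega> \<Longrightarrow> uniform_limit K u' v' sequentially"
  shows "pderiv_on \<Omega> i v v'"
proof (rule pderiv_onI)
  let ?e = "axis i (1::real)"
  show "continuous_on \<Omega> v" by (rule continuous_on_locally_uniform_limit[OF \<Omega> pderiv_onD(1)[OF u] v])
  show "continuous_on \<Omega> v'" by (rule continuous_on_locally_uniform_limit[OF \<Omega> pderiv_onD(2)[OF u] v'])
  fix x assume x: "x \<in> \<Omega>"
  then obtain r where r: "0 < r" "cball x r \<subseteq> \<Omega>" using \<Omega> by (meson open_contains_cball)
  let ?S = "{-r<..<r}"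
  have mem: "x + t *\<^sub>R ?e \<in> cball x r" if "t \<in> ?S" for t
    using that by (auto simp: dist_norm)
  have "\<exists>g. \<forall>t\<in>?S. (\<lambda>n. u n (x + t *\<^sub>R ?e)) \<longlonglongrightarrow> g t \<and>
      (g has_derivative (\<lambda>h. v' (x + t *\<^sub>R ?e) * h)) (at t within ?S)"
  proof (rule has_derivative_sequence)
    show "((\<lambda>t. u n (x + t *\<^sub>R ?e)) has_derivative (\<lambda>h. u' n (x + t *\<^sub>R ?e) * h)) (at t within ?S)"
      if "t \<in> ?S" for n t
      using has_field_derivative_at_within[OF pderiv_on_DERIV[OF u subsetD[OF r(2) mem[OF that]]]]
      by (simp only: has_field_derivative_def)
    show "\<forall>\<^sub>F n in sequentially. \<forall>t\<in>?S. \<forall>h. norm (u' n (x + t *\<^sub>R ?e) * h - v' (x + t *\<^sub>R ?e) * h) \<le> e * norm h"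
      if "0 < e" for e
      using uniform_limitD[OF v'[OF compact_cball r(2)] that]
    proof eventually_elim
      case (elim n)
      show ?case
      proof (intro ballI allI)
        fix t h :: real assume "t \<in> ?S"
        then have "\<bar>u' n (x + t *\<^sub>R ?e) - v' (x + t *\<^sub>R ?e)\<bar> \<le> e"
          using elim mem by (auto simp: dist_real_def intro: less_imp_le)
        then show "norm (u' n (x + t *\<^sub>R ?e) * h - v' (x + t *\<^sub>R ?e) * h) \<le> e * norm h"
          by (simp add: abs_mult mult_right_mono flip: left_diff_distrib)
      qed
    qed
    show "0 \<in> ?S" using r by simp
    show "(\<lambda>n. u n (x + 0 *\<^sub>R ?e)) \<longlonglongrightarrow> v x"
      using tendsto_uniform_limitI[OF v[OF compact_cball r(2)], of x] r by simp
  qed simp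
  then obtain g where g: "\<And>t. t \<in> ?S \<Longrightarrow> (\<lambda>n. u n (x + t *\<^sub>R ?e)) \<longlonglongrightarrow> g t"
    "\<And>t. t \<in> ?S \<Longrightarrow> (g has_derivative (\<lambda>h. v' (x + t *\<^sub>R ?e) * h)) (at t within ?S)" by blast
  have gv: "g t = v (x + t *\<^sub>R ?e)" if "t \<in> ?S" for t
    using LIMSEQ_unique[OF g(1)[OF that] tendsto_uniform_limitI[OF v[OF compact_cball r(2)] mem[OF that]]] .
  have "(g has_real_derivative v' x) (at 0 within ?S)"
    using g(2)[of 0] r by (simp add: has_field_derivative_def)
  then have "(g has_real_derivative v' x) (at 0)" using r by (subst (asm) at_within_open) auto
  moreover have "eventually (\<lambda>t. v (x + t *\<^sub>R ?e) = g t) (nhds 0)"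
    using eventually_nhds_in_open[of ?S 0] r by (auto elim!: eventually_mono simp: gv)
  ultimately show "((\<lambda>t. v (x + t *\<^sub>R ?e)) has_real_derivative v' x) (at 0)"
    by (rule DERIV_cong_ev[OF refl _ refl, THEN iffD2, rotated])
qed

section \<open>Convergence of derivatives through linear estimates, and the choice of a
  subsequence\<close>

text \<open>A linear interior estimate for differences of members passes the Cauchy property from
  the larger set \<open>K'\<close> to \<open>K\<close>, because \<open>C\<close> is the same for all
  pairs.\<close>

lemma uniformly_convergent_on_by_estimate:
  fixes a b c :: "nat \<Rightarrow> 'a \<Rightarrow> real"
  assumes "uniformly_convergent_on K' a" "uniformly_convergent_on K' b" and C: "0 < C"
    and est: "\<And>n m x A. x \<in> K \<Longrightarrow> (\<And>z. z \<in> K' \<Longrightarrow> \<bar>a n z - a m z\<bar> \<le> A) \<Longrightarrow>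
      (\<And>z. z \<in> K' \<Longrightarrow> \<bar>b n z - b m z\<bar> \<le> A) \<Longrightarrow> \<bar>c n x - c m x\<bar> \<le> C * A"
  shows "uniformly_convergent_on K c"
proof (rule Cauchy_uniformly_convergent, rule uniformly_Cauchy_onI)
  fix e :: real assume e: "0 < e"
  define A where "A = e / (2 * C)"
  have A: "0 < A" using e C by (simp add: A_def)
  obtain N1 where N1: "\<And>n m z. z \<in> K' \<Longrightarrow> N1 \<le> n \<Longrightarrow> N1 \<le> m \<Longrightarrow> dist (a n z) (a m z) < A"
    using uniformly_convergent_Cauchy[OF assms(1)] A unfolding uniformly_Cauchy_on_def by metis
  obtain N2 where N2: "\<And>n m z. z \<in> K' \<Longrightarrow> N2 \<le> n \<Longrightarrow> N2 \<le> m \<Longrightarrow> dist (b n z) (b m z) < A"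
    using uniformly_convergent_Cauchy[OF assms(2)] A unfolding uniformly_Cauchy_on_def by metis
  have "dist (c m x) (c n x) < e" if "x \<in> K" "max N1 N2 \<le> m" "max N1 N2 \<le> n" for x m n
  proof -
    have "\<bar>c m x - c n x\<bar> \<le> C * A"
      by (rule est[OF that(1)]) (use N1 N2 that in \<open>auto simp: dist_real_def intro!: less_imp_le\<close>)
    also have "\<dots> < e" using C e by (simp add: A_def)
    finally show ?thesis by (simp add: dist_real_def)
  qed
  then show "\<exists>M. \<forall>x\<in>K. \<forall>m\<ge>M. \<forall>n\<ge>M. dist (c m x) (c n x) < e" by blast
qed

lemma compact_cball_nbhd:
  fixes K :: "'a::euclidean_space set"
  assumes "compact K" "K \<subseteq> \<Omega>" "open \<Omega>"
  obtains R K' where "0 < R" "compact K'" "K' \<subseteq> \<Omega>" "\<And>x. x \<in> K \<Longrightarrow> cball x R \<subseteq> K'"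
proof -
  obtain R where R: "0 < R" "(\<Union>x\<in>K. cball x R) \<subseteq> \<Omega>"
    using compact_subset_open_imp_cball_epsilon_subset assms by blast
  have "compact {x + y |x y. x \<in> K \<and> y \<in> cball 0 R}" by (rule compact_sums[OF assms(1) compact_cball])
  also have "{x + y |x y. x \<in> K \<and> y \<in> cball 0 R} = (\<Union>x\<in>K. cball x R)"
  proof (intro set_eqI iffI)
    fix z assume "z \<in> (\<Union>x\<in>K. cball x R)"
    then obtain x where "x \<in> K" "z \<in> cball x R" by blast
    then show "z \<in> {x + y |x y. x \<in> K \<and> y \<in> cball 0 R}"
      by (intro CollectI exI[of _ x] exI[of _ "z - x"]) (auto simp: dist_norm norm_minus_commute)
  next
    fix z assume "z \<in> {x + y |x y. x \<in> K \<and> y \<in> cball 0 R}"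
    then obtain x y where "z = x + y" "x \<in> K" "norm y \<le> R" by auto
    then show "z \<in> (\<Union>x\<in>K. cball x R)" by (intro UN_I[of x]) (auto simp: dist_norm)
  qed
  finally show ?thesis using that[OF R(1) _ R(2)] by blast
qed

lemma pderiv_locally_convergent:
  fixes \<Omega> :: "(real^'n::finite) set"
  assumes \<Omega>: "open \<Omega>" and u: "\<And>n. has_laplacian_on \<Omega> (u n) (g n)"
    and d: "\<And>n. pderiv_on \<Omega> i (u n) (u' n)"
    and cu: "\<And>K. compact K \<Longrightarrow> K \<subseteq> \<Omega> \<Longrightarrow> uniformly_convergent_on K u"
    and cg: "\<And>K. compact K \<Longrightarrow> K \<subseteq> \<Omega> \<Longrightarrow> uniformly_convergent_on K g"
    and K: "compact K" "K \<subseteq> \<Omega>"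
  shows "uniformly_convergent_on K u'"
proof -
  obtain R K' where R: "0 < R" and K': "compact K'" "K' \<subseteq> \<Omega>" "\<And>x. x \<in> K \<Longrightarrow> cball x R \<subseteq> K'"
    using compact_cball_nbhd[OF K \<Omega>] by blast
  \<comment> \<open>The gradient estimate is used with parameter R / 2, because it looks at a ball
    of twice its parameter.\<close>
  define C where "C = grad_const TYPE('n) * (2 / R + R / 2)"
  have C: "0 < C" using R grad_const_pos[where 'n='n] by (simp add: C_def add_pos_pos)
  show ?thesis
  proof (rule uniformly_convergent_on_by_estimate[OF cu[OF K'(1,2)] cg[OF K'(1,2)] C])
    fix n m x A
    assume x: "x \<in> K" and A: "\<And>z. z \<in> K' \<Longrightarrow> \<bar>u n z - u m z\<bar> \<le> A" "\<And>z. z \<in> K' \<Longrightarrow> \<bar>g n z - g m z\<bar> \<le> A"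
    have sub: "ball x (2 * (R / 2)) \<subseteq> K'" using K'(3)[OF x] by auto
    have "\<bar>u' n x - u' m x\<bar> \<le> grad_const TYPE('n) * (A / (R / 2) + (R / 2) * A)"
      by (rule gradient_estimate[OF \<Omega> has_laplacian_on_diff[OF u u] _ _ _ _ pderiv_on_diff[OF d d]])
        (use R sub K' A in auto)
    then show "\<bar>u' n x - u' m x\<bar> \<le> C * A" by (simp add: C_def algebra_simps)
  qed
qed

text \<open>The input is convergence of the first derivatives of both the functions and their
  Laplacians. The parameter of the estimate becomes R / 3, as it looks at a ball of three times its
  parameter.\<close>

lemma second_pderiv_locally_convergent:
  fixes \<Omega> :: "(real^'n::finite) set"
  assumes \<Omega>: "open \<Omega>" and u: "\<And>n. has_laplacian_on \<Omega> (u n) (g n)"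
    and d: "\<And>n. pderiv_on \<Omega> i (u n) (u' n)" "\<And>n. pderiv_on \<Omega> i (g n) (g' n)" "\<And>n. pderiv_on \<Omega> j (u' n) (u'' n)"
    and cu: "\<And>K. compact K \<Longrightarrow> K \<subseteq> \<Omega> \<Longrightarrow> uniformly_convergent_on K u'"
    and cg: "\<And>K. compact K \<Longrightarrow> K \<subseteq> \<Omega> \<Longrightarrow> uniformly_convergent_on K g'"
    and K: "compact K" "K \<subseteq> \<Omega>"
  shows "uniformly_convergent_on K u''"
proof -
  obtain R K' where R: "0 < R" and K': "compact K'" "K' \<subseteq> \<Omega>" "\<And>x. x \<in> K \<Longrightarrow> cball x R \<subseteq> K'"
    using compact_cball_nbhd[OF K \<Omega>] by blast
  define C where "C = grad_const TYPE('n) * (3 / R + R / 3)"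
  have C: "0 < C" using R grad_const_pos[where 'n='n] by (simp add: C_def add_pos_pos)
  show ?thesis
  proof (rule uniformly_convergent_on_by_estimate[OF cu[OF K'(1,2)] cg[OF K'(1,2)] C])
    fix n m x A
    assume x: "x \<in> K" and A: "\<And>z. z \<in> K' \<Longrightarrow> \<bar>u' n z - u' m z\<bar> \<le> A" "\<And>z. z \<in> K' \<Longrightarrow> \<bar>g' n z - g' m z\<bar> \<le> A"
    have sub: "ball x (3 * (R / 3)) \<subseteq> K'" using K'(3)[OF x] by auto
    have "\<bar>u'' n x - u'' m x\<bar> \<le> grad_const TYPE('n) * (A / (R / 3) + (R / 3) * A)"
      by (rule second_derivative_estimate[OF \<Omega> has_laplacian_on_diff[OF u u] _ _
            pderiv_on_diff[OF d(1) d(1)] pderiv_on_diff[OF d(2) d(2)] pderiv_on_diff[OF d(3) d(3)]])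
        (use R sub K' A in auto)
    then show "\<bar>u'' n x - u'' m x\<bar> \<le> C * A" by (simp add: C_def algebra_simps)
  qed
qed

text \<open>Arzela-Ascoli on each member of a compact exhaustion, followed by a diagonal choice.
  Only convergence is asserted: the limit is recovered pointwise afterwards, so limits on different
  compact sets need not be glued.\<close>

lemma locally_equicontinuous_subsequence:
  fixes u :: "nat \<Rightarrow> 'a::euclidean_space \<Rightarrow> real"
  assumes \<Omega>: "open \<Omega>"
    and bd: "\<And>K. compact K \<Longrightarrow> K \<subseteq> \<Omega> \<Longrightarrow> \<exists>M. \<forall>n. \<forall>x\<in>K. \<bar>u n x\<bar> \<le> M"
    and eq: "\<And>x e. x \<in> \<Omega> \<Longrightarrow> 0 < e \<Longrightarrow> \<exists>d>0. \<forall>n. \<forall>y\<in>ball x d. \<bar>u n x - u n y\<bar> < e"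
  shows "\<exists>r. strict_mono r \<and>
    (\<forall>K. compact K \<and> K \<subseteq> \<Omega> \<longrightarrow> uniformly_convergent_on K (\<lambda>n. u (r n)))"
proof -
  obtain D :: "nat \<Rightarrow> 'a set" where D: "\<And>n. compact (D n)" "\<And>n. D n \<subseteq> \<Omega>" "\<And>K. \<lbrakk>compact K; K \<subseteq> \<Omega>\<rbrakk> \<Longrightarrow> \<exists>N. \<forall>n\<ge>N. K \<subseteq> D n"
    using open_Union_compact_subsets[OF \<Omega>] by metis
  let ?P = "\<lambda>i r. uniformly_convergent_on (D i) (\<lambda>n. u (r n))"
  have "\<exists>k. strict_mono (k :: nat \<Rightarrow> nat) \<and> (\<forall>i. ?P i (id \<circ> k))"
  proof (rule subsequence_diagonalization_lemma[of ?P id])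
    fix i and r :: "nat \<Rightarrow> nat"
    obtain M where M: "\<And>n x. x \<in> D i \<Longrightarrow> \<bar>u n x\<bar> \<le> M" using bd[OF D(1,2)] by blast
    have "\<exists>g k. strict_mono (k :: nat \<Rightarrow> nat) \<and>
        (\<forall>e>0. \<exists>N. \<forall>n x. n \<ge> N \<and> x \<in> D i \<longrightarrow> norm (u (r (k n)) x - g x) < e)"
    proof (rule Arzela_Ascoli[of "D i" "\<lambda>n. u (r n)" M])
      show "compact (D i)" by (rule D(1))
      show "norm (u (r n) x) \<le> M" if "x \<in> D i" for n x using M[OF that] by simp
      show "\<exists>d>0. \<forall>n y. y \<in> D i \<and> norm (x - y) < d \<longrightarrow> norm (u (r n) x - u (r n) y) < e"
        if xe: "x \<in> D i" "0 < e" for x e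
      proof -
        obtain d where d: "d > 0" "\<forall>n. \<forall>y\<in>ball x d. \<bar>u n x - u n y\<bar> < e"
          using eq[OF subsetD[OF D(2) xe(1)] xe(2)] by blast
        show ?thesis by (rule exI[of _ d]) (use d in \<open>simp add: dist_norm\<close>)
      qed
    next
      fix g and k :: "nat \<Rightarrow> nat"
      assume k: "strict_mono k"
        "\<And>e. 0 < e \<Longrightarrow> \<exists>N. \<forall>n x. n \<ge> N \<and> x \<in> D i \<longrightarrow> norm (u (r (k n)) x - g x) < e"
      show ?thesis
        by (rule exI[of _ g], rule exI[of _ k], rule conjI[OF k(1)], rule allI, rule impI, rule k(2))
    qed
    then obtain g k where gk: "strict_mono (k :: nat \<Rightarrow> nat)"
      "\<forall>e>0. \<exists>N. \<forall>n x. n \<ge> N \<and> x \<in> D i \<longrightarrow> norm (u (r (k n)) x - g x) < e" by blast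
    have "uniform_limit (D i) (\<lambda>n. u ((r \<circ> k) n)) g sequentially"
      unfolding uniform_limit_sequentially_iff o_def dist_norm
    proof (intro allI impI)
      fix e :: real assume "0 < e"
      with gk(2) obtain N where "\<forall>n x. n \<ge> N \<and> x \<in> D i \<longrightarrow> norm (u (r (k n)) x - g x) < e" by blast
      then show "\<exists>N. \<forall>n\<ge>N. \<forall>x\<in>D i. norm (u (r (k n)) x - g x) < e" by blast
    qed
    then have "?P i (r \<circ> k)" unfolding uniformly_convergent_on_def by (intro exI[of _ g])
    with gk(1) show "\<exists>k. strict_mono (k :: nat \<Rightarrow> nat) \<and> ?P i (r \<circ> k)" by (intro exI conjI)
  next
    \<comment> \<open>Diagonalization asks that the property survive when only a tail of the new
      sequence is drawn from the old one; uniform convergence ignores the initial terms.\<close>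
    fix i N and r k1 k2 :: "nat \<Rightarrow> nat"
    assume P: "?P i (r \<circ> k1)" and k2: "\<And>j. N \<le> j \<Longrightarrow> \<exists>j'. j \<le> j' \<and> k2 j = k1 j'"
    from P obtain l where l: "uniform_limit (D i) (\<lambda>n. u ((r \<circ> k1) n)) l sequentially"
      unfolding uniformly_convergent_on_def by blast
    have "uniform_limit (D i) (\<lambda>n. u ((r \<circ> k2) n)) l sequentially"
      unfolding uniform_limit_sequentially_iff
    proof (intro allI impI)
      fix e :: real assume "0 < e"
      then obtain M where M: "\<And>n x. n \<ge> M \<Longrightarrow> x \<in> D i \<Longrightarrow> dist (u ((r \<circ> k1) n) x) (l x) < e"
        using l unfolding uniform_limit_sequentially_iff by blast
      have "dist (u ((r \<circ> k2) n) x) (l x) < e" if n: "n \<ge> max M N" and x: "x \<in> D i" for n x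
      proof -
        obtain j' where "n \<le> j'" "k2 n = k1 j'" using k2[of n] n by auto
        then show ?thesis using M[OF _ x, of j'] n by simp
      qed
      then show "\<exists>N. \<forall>n\<ge>N. \<forall>x\<in>D i. dist (u ((r \<circ> k2) n) x) (l x) < e" by blast
    qed
    then show "?P i (r \<circ> k2)" unfolding uniformly_convergent_on_def by (intro exI[of _ l])
  next
    fix k :: "nat \<Rightarrow> nat"
    assume k: "strict_mono k" "\<And>i. ?P i (id \<circ> k)"
    show ?thesis by (rule exI[of _ k], rule conjI[OF k(1)], rule allI, rule k(2))
  qed
  then obtain k where k: "strict_mono (k :: nat \<Rightarrow> nat)" "\<And>i. ?P i (id \<circ> k)" by (elim exE conjE) simp
  show ?thesis
  proof (rule exI[of _ k], intro conjI k(1) allI impI, elim conjE)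
    fix K assume "compact K" "K \<subseteq> \<Omega>"
    then obtain N where "K \<subseteq> D N" using D(3)[of K] by blast
    obtain l where "uniform_limit (D N) (\<lambda>n. u ((id \<circ> k) n)) l sequentially"
      using k(2)[of N] unfolding uniformly_convergent_on_def by (rule exE)
    then have "uniform_limit K (\<lambda>n. u ((id \<circ> k) n)) l sequentially"
      using \<open>K \<subseteq> D N\<close> by (rule uniform_limit_on_subset)
    then show "uniformly_convergent_on K (\<lambda>n. u (k n))"
      unfolding uniformly_convergent_on_def by (intro exI[of _ l]) simp
  qed
qed

text \<open>Continuity of \<open>h\<close> is uniform only on bounded intervals. The limit is
  bounded by \<open>B\<close> on \<open>K\<close>, and from some index on all members stay within 1
  of it.\<close>

lemma uniform_limit_compose_continuous:
  fixes u :: "nat \<Rightarrow> 'a::topological_space \<Rightarrow> real" and h :: "real \<Rightarrow> real"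
  assumes u: "uniform_limit K u v sequentially" and K: "compact K" "continuous_on K v"
    and h: "continuous_on UNIV h"
  shows "uniform_limit K (\<lambda>n x. h (u n x)) (\<lambda>x. h (v x)) sequentially"
proof -
  obtain B where B: "\<And>x. x \<in> K \<Longrightarrow> \<bar>v x\<bar> \<le> B"
    using compact_imp_bounded[OF compact_continuous_image[OF K(2,1)]] by (auto simp: bounded_iff)
  have "uniformly_continuous_on {-(B + 1)..B + 1} h"
    by (rule compact_uniformly_continuous) (use h continuous_on_subset in auto)
  moreover have "\<forall>\<^sub>F n in sequentially. u n ` K \<subseteq> {-(B + 1)..B + 1}"
    using uniform_limitD[OF u zero_less_one]
  proof eventually_elim
    case (elim n)
    have "u n x \<in> {-(B + 1)..B + 1}" if "x \<in> K" for x
      using elim[rule_format, OF that] B[OF that] unfolding dist_real_def by (simp add: abs_less_iff abs_le_iff)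
    then show ?case by blast
  qed
  moreover have "v ` K \<subseteq> {-(B + 1)..B + 1}" using B by (fastforce simp: abs_le_iff)
  ultimately show ?thesis using uniform_limit_compose[OF u] by (simp add: o_def)
qed

section \<open>Compactness of the sequence of solutions\<close>

text \<open>The condition s < N / (N - 2) is kept in the form N - 2 < N / s, which covers N = 2 as
  well, where it holds for every s > 0.\<close>

lemma subcritical_exponent:
  assumes N: "2 \<le> N" and p: "1 < p" "ereal p < crit_exp N"
  obtains s where "p < s" "real N - 2 < real N / s"
proof (cases "N = 2")
  case True
  then show ?thesis using that[of "p + 1"] p by simp
next
  case False
  then have N3: "0 < real N - 2" using N by linarith
  have "p < real N / (real N - 2)" using p False by (simp add: crit_exp_def)
  then obtain s where s: "p < s" "s < real N / (real N - 2)" using dense by blast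
  then have "s * (real N - 2) < real N" using N3 by (simp add: pos_less_divide_eq)
  then have "real N - 2 < real N / s" using s p by (simp add: pos_less_divide_eq mult.commute)
  then show ?thesis using that s by blast
qed

lemma pos_power_mono: "0 < p \<Longrightarrow> s \<le> t \<Longrightarrow> pos_power p s \<le> pos_power p t"
  unfolding pos_power_def by (rule powr_mono2) auto

lemma uniformly_bounded_on_compact:
  fixes u :: "nat \<Rightarrow> 'a::metric_space \<Rightarrow> real"
  assumes K: "compact K" and loc: "\<And>x. x \<in> K \<Longrightarrow> \<exists>r>0. \<exists>M. \<forall>n. \<forall>y\<in>ball x r. \<bar>u n y\<bar> \<le> M"
  shows "\<exists>M. \<forall>n. \<forall>x\<in>K. \<bar>u n x\<bar> \<le> M"
proof -
  obtain r M where rM: "\<And>x. x \<in> K \<Longrightarrow> 0 < r x" "\<And>x n y. x \<in> K \<Longrightarrow> y \<in> ball x (r x) \<Longrightarrow> \<bar>u n y\<bar> \<le> M x"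
    using loc by metis
  obtain T where T: "T \<subseteq> K" "finite T" "K \<subseteq> (\<Union>x\<in>T. ball x (r x))"
    by (rule compactE_image[OF K, of K "\<lambda>x. ball x (r x)"]) (use rM(1) in \<open>auto intro: centre_in_ball[THEN iffD2]\<close>)
  define B where "B = (\<Sum>x\<in>T. \<bar>M x\<bar>)"
  have "\<bar>u n y\<bar> \<le> B" if y: "y \<in> K" for n y
  proof -
    obtain x where x: "x \<in> T" "y \<in> ball x (r x)" using T(3) y by blast
    have "\<bar>u n y\<bar> \<le> \<bar>M x\<bar>" using rM(2)[OF subsetD[OF T(1) x(1)] x(2), of n] by linarith
    also have "\<dots> \<le> B" unfolding B_def by (rule member_le_sum[OF x(1)]) (use T in auto)
    finally show ?thesis .
  qed
  then show ?thesis by (intro exI[of _ B]) simp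
qed

lemma superlinear_locally_bounded:
  fixes \<Omega> :: "(real^'n::finite) set" and u :: "nat \<Rightarrow> real^'n \<Rightarrow> real"
  assumes N: "2 \<le> CARD('n)" and \<Omega>: "open \<Omega>" and p: "1 < p" "ereal p < crit_exp CARD('n)"
    and u: "\<And>n. has_laplacian_on \<Omega> (u n) (\<lambda>x. - pos_power p (u n x))"
    and C: "\<And>n. (\<integral>\<^sup>+ x\<in>\<Omega>. ennreal (max (- u n x) 0) \<partial>lborel) \<le> ennreal C"
    and K: "compact K" "K \<subseteq> \<Omega>"
  shows "\<exists>M. \<forall>n. \<forall>x\<in>K. \<bar>u n x\<bar> \<le> M"
proof (rule uniformly_bounded_on_compact[OF K(1)])
  fix x\<^sub>0 assume "x\<^sub>0 \<in> K"
  then obtain \<rho> where \<rho>: "0 < \<rho>" "cball x\<^sub>0 \<rho> \<subseteq> \<Omega>" using K \<Omega> by (meson open_contains_cball subsetD)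
  obtain s where s: "p < s" "real CARD('n) - 2 < CARD('n) / s" using subcritical_exponent[OF N p] .
  \<comment> \<open>Every point of \<open>cball x\<^sub>0 R\<close> keeps a ball of radius \<rho> /
    2 inside \<Omega>, as the lower bound demands, and R \<le> 1 serves the next two estimates. Each
    of these halves the radius, down to R / 4.\<close>
  define R where "R = min (\<rho> / 2) 1"
  have R: "0 < R" "R \<le> 1" "R \<le> \<rho> / 2" using \<rho> by (auto simp: R_def)
  have sub: "cball x\<^sub>0 R \<subseteq> \<Omega>" "cball x\<^sub>0 (R / 2) \<subseteq> \<Omega>" using \<rho> R by (auto simp: subset_iff)
  define L where "L = max C 0 / (bump_mass TYPE('n) * (\<rho> / 2 / 2) ^ CARD('n))"
  have L: "0 \<le> L" using \<rho> bump_mass_pos[where 'n='n] by (simp add: L_def)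
  have low: "- L \<le> u n y" if "y \<in> cball x\<^sub>0 R" for n y
  proof -
    have "cball y (\<rho> / 2) \<subseteq> \<Omega>"
    proof
      fix z assume "z \<in> cball y (\<rho> / 2)"
      then have "dist x\<^sub>0 z \<le> \<rho>" using that R dist_triangle[of x\<^sub>0 z y] by simp
      then show "z \<in> \<Omega>" using \<rho> by auto
    qed
    then have "- u n y \<le> L"
      unfolding L_def by (intro superharmonic_lower_bound[OF \<Omega> u _ C]) (use \<rho> in \<open>simp_all add: pos_power_nonneg\<close>)
    then show ?thesis by simp
  qed
  obtain F where F: "0 < F" "\<And>v. has_laplacian_on \<Omega> v (\<lambda>y. - pos_power p (v y)) \<Longrightarrow>
    (\<And>y. y \<in> ball x\<^sub>0 R \<Longrightarrow> - L \<le> v y) \<Longrightarrow>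
    (\<integral>y. pos_power p (v y) * indicator (ball x\<^sub>0 (R / 2)) y \<partial>lborel) \<le> F"
    by (rule local_L1_bound[OF \<Omega> p(1) R(1,2) sub(1) L]) blast
  obtain M where M: "\<And>v y. has_laplacian_on \<Omega> v (\<lambda>y. - pos_power p (v y)) \<Longrightarrow>
    (\<integral>y. pos_power p (v y) * indicator (ball x\<^sub>0 (R / 2)) y \<partial>lborel) \<le> F \<Longrightarrow> y \<in> cball x\<^sub>0 (R / 2 / 2) \<Longrightarrow> v y \<le> M"
    by (rule local_sup_bound[OF \<Omega> p(1) s _ _ sub(2) F(1)]) (use R in \<open>simp, simp, blast\<close>)
  show "\<exists>r>0. \<exists>M. \<forall>n. \<forall>y\<in>ball x\<^sub>0 r. \<bar>u n y\<bar> \<le> M"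
  proof (rule exI[of _ "R / 2 / 2"], intro conjI exI[of _ "max L M"] allI ballI)
    fix n y assume y: "y \<in> ball x\<^sub>0 (R / 2 / 2)"
    have "u n y \<le> M"
      by (rule M[OF u F(2)[OF u low]]) (use y in auto)
    moreover have "- L \<le> u n y" by (rule low) (use y R in auto)
    ultimately show "\<bar>u n y\<bar> \<le> max L M" by linarith
  qed (use R in simp)
qed

text \<open>Where all members are bounded by \<open>M\<close>, monotonicity of the nonlinearity
  bounds their Laplacians by \<open>pos_power p M\<close>, so the interior Lipschitz constant does
  not depend on \<open>n\<close>.\<close>

lemma superlinear_equicontinuous:
  fixes \<Omega> :: "(real^'n::finite) set" and u :: "nat \<Rightarrow> real^'n \<Rightarrow> real"
  assumes \<Omega>: "open \<Omega>" and p: "0 < p"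
    and u: "\<And>n. has_laplacian_on \<Omega> (u n) (\<lambda>x. - pos_power p (u n x))"
    and bd: "\<And>K. compact K \<Longrightarrow> K \<subseteq> \<Omega> \<Longrightarrow> \<exists>M. \<forall>n. \<forall>x\<in>K. \<bar>u n x\<bar> \<le> M"
    and x: "x \<in> \<Omega>" and e: "0 < e"
  shows "\<exists>d>0. \<forall>n. \<forall>y\<in>ball x d. \<bar>u n x - u n y\<bar> < e"
proof -
  obtain \<rho> where \<rho>: "0 < \<rho>" "cball x \<rho> \<subseteq> \<Omega>" using x \<Omega> by (meson open_contains_cball)
  obtain M where M: "\<And>n y. y \<in> cball x \<rho> \<Longrightarrow> \<bar>u n y\<bar> \<le> M" using bd[OF compact_cball \<rho>(2)] by blast
  define R where "R = \<rho> / 2"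
  have R: "0 < R" "\<rho> = 2 * R" using \<rho> by (auto simp: R_def)
  have M0: "0 \<le> M" using M[of x 0] \<rho> by simp
  define L where "L = grad_const TYPE('n) * (M / R + R * pos_power p M)"
  have L: "0 \<le> L" using M0 R grad_const_pos[where 'n='n] pos_power_nonneg[of p M] by (simp add: L_def)
  \<comment> \<open>\<open>L + 1\<close> excludes division by 0 and makes the final inequality
    strict.\<close>
  define d where "d = min R (e / (L + 1))"
  have d: "0 < d" "d \<le> R" "d \<le> e / (L + 1)" using R e L by (auto simp: d_def)
  have "\<bar>u n x - u n y\<bar> < e" if y: "y \<in> ball x d" for n y
  proof -
    have sub: "ball x R \<union> ball y R \<subseteq> cball x \<rho>"
    proof
      fix z assume "z \<in> ball x R \<union> ball y R"
      then show "z \<in> cball x \<rho>" using y d R dist_triangle[of x z y] by auto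
    qed
    have "\<bar>u n x - u n y\<bar> \<le> L * dist x y"
      unfolding L_def
    proof (rule interior_Lipschitz_estimate[OF \<Omega> u R(1)])
      fix z assume "z \<in> ball x R \<union> ball y R"
      then have "\<bar>u n z\<bar> \<le> M" using sub M by blast
      then show "\<bar>u n z\<bar> \<le> M" "\<bar>- pos_power p (u n z)\<bar> \<le> pos_power p M"
        using pos_power_mono[OF p, of "u n z" M] pos_power_nonneg[of p "u n z"] by auto
    qed (use sub \<rho> in auto)
    also have "\<dots> \<le> L * (e / (L + 1))" using y d L by (intro mult_left_mono) auto
    also have "\<dots> < e" using L e by (simp add: field_simps)
    finally show ?thesis .
  qed
  then show ?thesis using d(1) by (intro exI[of _ d]) simp
qed

lemma uniform_limit_lim:
  "uniformly_convergent_on K f \<Longrightarrow> uniform_limit K f (\<lambda>x. lim (\<lambda>n. f n x)) sequentially"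
  by (simp add: uniformly_convergent_uniform_limit_iff)

text \<open>A bootstrap without further subsequences: convergence of the functions gives that of
  their Laplacians by continuity of the nonlinearity, hence of the first derivatives; these give
  convergence of the differentiated Laplacians, hence of the second derivatives.\<close>

lemma C2_loc_conv_of_locally_convergent:
  fixes \<Omega> :: "(real^'n::finite) set"
  assumes \<Omega>: "open \<Omega>" and p: "1 < p" and C2: "\<And>n. C2_on \<Omega> (u n)"
    and u: "\<And>n. has_laplacian_on \<Omega> (u n) (\<lambda>x. - pos_power p (u n x))"
    and cu: "\<And>K. compact K \<Longrightarrow> K \<subseteq> \<Omega> \<Longrightarrow> uniformly_convergent_on K u"
  shows "\<exists>v. C2_loc_conv \<Omega> u v"
proof -
  define v where "v x = lim (\<lambda>n. u n x)" for x
  define V where "V i x = lim (\<lambda>n. pdiff i (u n) x)" for i x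
  define W where "W i j x = lim (\<lambda>n. pdiff j (pdiff i (u n)) x)" for i j x
  note pd = C2_on_pderiv_on[OF C2]
  have lu: "uniform_limit K u v sequentially" if "compact K" "K \<subseteq> \<Omega>" for K
    unfolding v_def by (rule uniform_limit_lim[OF cu[OF that]])
  have cont_v: "continuous_on \<Omega> v"
    by (rule continuous_on_locally_uniform_limit[OF \<Omega> pderiv_onD(1)[OF pd(1)] lu])
  have lf: "uniform_limit K (\<lambda>n x. h (u n x)) (\<lambda>x. h (v x)) sequentially"
    if "compact K" "K \<subseteq> \<Omega>" "continuous_on UNIV h" for K and h :: "real \<Rightarrow> real"
    by (rule uniform_limit_compose_continuous[OF lu[OF that(1,2)] that(1) continuous_on_subset[OF cont_v that(2)] that(3)])
  have cg: "uniformly_convergent_on K (\<lambda>n x. - pos_power p (u n x))" if "compact K" "K \<subseteq> \<Omega>" for K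
    unfolding uniformly_convergent_on_def
    by (rule exI, rule lf[OF that continuous_on_minus[OF continuous_on_pos_power]]) (use p in simp)
  have cV: "uniformly_convergent_on K (\<lambda>n. pdiff i (u n))" if "compact K" "K \<subseteq> \<Omega>" for K i
    by (rule pderiv_locally_convergent[OF \<Omega> u pd(1) cu cg that])
  then have lV: "uniform_limit K (\<lambda>n. pdiff i (u n)) (V i) sequentially" if "compact K" "K \<subseteq> \<Omega>" for K i
    unfolding V_def using that by (intro uniform_limit_lim)
  have pV: "pderiv_on \<Omega> i v (V i)" for i
    by (rule pderiv_on_locally_uniform_limit[OF \<Omega> pd(1) lu lV])
  let ?g' = "\<lambda>i n x. (-1) * (p * pos_power (p - 1) (u n x) * pdiff i (u n) x)"
  have pg: "pderiv_on \<Omega> i (\<lambda>x. - pos_power p (u n x)) (?g' i n)" for i n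
    using pderiv_on_cmult[OF pderiv_on_pos_power[OF p pd(1)], where c = "-1"] by simp
  have cg': "uniformly_convergent_on K (?g' i)" if K: "compact K" "K \<subseteq> \<Omega>" for K i
  proof -
    have ch: "continuous_on UNIV (\<lambda>t. - (p * pos_power (p - 1) t))"
      by (intro continuous_on_minus continuous_on_mult continuous_on_const continuous_on_pos_power) (use p in simp)
    have bdd: "bounded (h ` K)" if "continuous_on \<Omega> h" for h :: "real^'n \<Rightarrow> real"
      by (rule compact_imp_bounded[OF compact_continuous_image[OF continuous_on_subset[OF that K(2)] K(1)]])
    have "uniform_limit K (\<lambda>n x. - (p * pos_power (p - 1) (u n x)) * pdiff i (u n) x)
        (\<lambda>x. - (p * pos_power (p - 1) (v x)) * V i x) sequentially"
    proof (rule uniform_lim_mult[OF lf[OF K ch] lV[OF K]])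
      show "bounded ((\<lambda>x. - (p * pos_power (p - 1) (v x))) ` K)"
        by (rule bdd[OF continuous_on_compose2[OF ch cont_v]]) simp
      show "bounded (V i ` K)" by (rule bdd[OF pderiv_onD(2)[OF pV]])
    qed
    then show ?thesis unfolding uniformly_convergent_on_def by (intro exI) simp
  qed
  have cW: "uniformly_convergent_on K (\<lambda>n. pdiff j (pdiff i (u n)))" if "compact K" "K \<subseteq> \<Omega>" for K i j
    by (rule second_pderiv_locally_convergent[OF \<Omega> u pd(1) pg pd(2) cV cg' that])
  then have lW: "uniform_limit K (\<lambda>n. pdiff j (pdiff i (u n))) (W i j) sequentially" if "compact K" "K \<subseteq> \<Omega>" for K i j
    unfolding W_def using that by (intro uniform_limit_lim)
  have pW: "pderiv_on \<Omega> j (V i) (W i j)" for i j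
    by (rule pderiv_on_locally_uniform_limit[OF \<Omega> pd(2) lV lW])
  note C2v = C2_onI[OF \<Omega> pV pW]
  have "uniform_limit K (\<lambda>n. pdiff i (u n)) (pdiff i v) sequentially" if "compact K" "K \<subseteq> \<Omega>" for K i
  proof -
    have "uniform_limit K (\<lambda>n. pdiff i (u n)) (pdiff i v) sequentially \<longleftrightarrow> uniform_limit K (\<lambda>n. pdiff i (u n)) (V i) sequentially"
      by (rule uniform_limit_cong') (use C2v(2) that in auto)
    then show ?thesis using lV[OF that] by simp
  qed
  moreover have "uniform_limit K (\<lambda>n. pdiff j (pdiff i (u n))) (pdiff j (pdiff i v)) sequentially"
    if "compact K" "K \<subseteq> \<Omega>" for K i j
  proof -
    have "uniform_limit K (\<lambda>n. pdiff j (pdiff i (u n))) (pdiff j (pdiff i v)) sequentially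
        \<longleftrightarrow> uniform_limit K (\<lambda>n. pdiff j (pdiff i (u n))) (W i j) sequentially"
      by (rule uniform_limit_cong') (use C2v(3) that in auto)
    then show ?thesis using lW[OF that] by simp
  qed
  ultimately have "C2_loc_conv \<Omega> u v" unfolding C2_loc_conv_def using C2v(1) lu by blast
  then show ?thesis by (intro exI[of _ v])
qed

lemma L1loc_bounded_pos_power:
  assumes p: "0 < p" and bd: "\<And>K. compact K \<Longrightarrow> K \<subseteq> \<Omega> \<Longrightarrow> \<exists>M. \<forall>n. \<forall>x\<in>K. \<bar>u n x\<bar> \<le> M"
  shows "L1loc_bounded \<Omega> (\<lambda>n x. pos_power p (u n x))"
  unfolding L1loc_bounded_def
proof (intro allI impI, elim conjE)
  fix K assume K: "compact K" "K \<subseteq> \<Omega>"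
  obtain M where M: "\<And>n x. x \<in> K \<Longrightarrow> \<bar>u n x\<bar> \<le> M" using bd[OF K] by blast
  have "(\<integral>\<^sup>+ x\<in>K. ennreal \<bar>pos_power p (u n x)\<bar> \<partial>lborel) \<le> ennreal (pos_power p M * measure lborel K)" for n
  proof -
    have "(\<integral>\<^sup>+ x\<in>K. ennreal \<bar>pos_power p (u n x)\<bar> \<partial>lborel) \<le> (\<integral>\<^sup>+ x. ennreal (pos_power p M) * indicator K x \<partial>lborel)"
    proof (rule nn_integral_mono)
      fix x
      show "ennreal \<bar>pos_power p (u n x)\<bar> * indicator K x \<le> ennreal (pos_power p M) * indicator K x"
        using M[of x n] pos_power_mono[OF p, of "u n x" M] pos_power_nonneg[of p "u n x"]
        by (auto simp: indicator_def intro!: ennreal_leI)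
    qed
    also have "\<dots> = ennreal (pos_power p M) * emeasure lborel K"
      by (rule nn_integral_cmult_indicator) (use K in \<open>simp add: borel_compact\<close>)
    also have "emeasure lborel K = ennreal (measure lborel K)"
      using emeasure_compact_finite[OF K(1)] by (simp add: emeasure_eq_ennreal_measure)
    also have "ennreal (pos_power p M) * \<dots> = ennreal (pos_power p M * measure lborel K)"
      by (simp add: ennreal_mult pos_power_nonneg)
    finally show ?thesis .
  qed
  then show "\<exists>M. \<forall>n. (\<integral>\<^sup>+ x\<in>K. ennreal \<bar>pos_power p (u n x)\<bar> \<partial>lborel) \<le> ennreal M" by (intro exI allI)
qed

theorem theorem6p1:
  fixes \<Omega> :: "(real^'n::finite) set" and p C :: real and w :: "nat \<Rightarrow> real^'n \<Rightarrow> real"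
  assumes "CARD('n) \<ge> 2"
    and "open \<Omega>"
    and "1 < p" and "ereal p < crit_exp CARD('n)"
    and "\<And>n. C2_on \<Omega> (w n)"
    and "\<And>n x. x \<in> \<Omega> \<Longrightarrow> - laplacian (w n) x = (max (w n x - 1) 0) powr p"
    and "\<And>n. (\<integral>\<^sup>+ x\<in>\<Omega>. ennreal (max (- w n x) 0) \<partial>lborel) \<le> ennreal C"
  shows "(\<forall>K. compact K \<and> K \<subseteq> \<Omega> \<longrightarrow> (\<exists>M. \<forall>n. \<forall>x\<in>K. max (- w n x) 0 \<le> M))
    \<and> (\<exists>r. strict_mono r \<and>
          ((\<forall>K. compact K \<and> K \<subseteq> \<Omega> \<longrightarrow>
              (\<forall>M. eventually (\<lambda>n. \<forall>x\<in>K. M \<le> w (r n) x) sequentially))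
           \<or> (\<exists>v. C2_loc_conv \<Omega> (\<lambda>n. w (r n)) v)) \<and>
          ((\<exists>v. C2_loc_conv \<Omega> (\<lambda>n. w (r n)) v) \<longleftrightarrow>
             L1loc_bounded \<Omega> (\<lambda>n x. (max (w (r n) x - 1) 0) powr p)))"
proof -
  note \<Omega> = assms(2) and p = assms(3)
  have lap: "has_laplacian_on \<Omega> (w n) (\<lambda>x. - pos_power p (w n x))" for n
  proof (rule has_laplacian_on_cong[OF C2_on_has_laplacian_on[OF assms(5)]])
    show "laplacian (w n) x = - pos_power p (w n x)" if "x \<in> \<Omega>" for x
      using assms(6)[OF that, of n] unfolding pos_power_def by linarith
  qed
  have bd: "\<exists>M. \<forall>n. \<forall>x\<in>K. \<bar>w n x\<bar> \<le> M" if "compact K" "K \<subseteq> \<Omega>" for K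
    by (rule superlinear_locally_bounded[OF assms(1) \<Omega> p assms(4) lap assms(7) that])
  have neg: "\<exists>M. \<forall>n. \<forall>x\<in>K. max (- w n x) 0 \<le> M" if K: "compact K" "K \<subseteq> \<Omega>" for K
  proof -
    obtain M where M: "\<And>n x. x \<in> K \<Longrightarrow> \<bar>w n x\<bar> \<le> M" using bd[OF K] by blast
    have "max (- w n x) 0 \<le> M" if "x \<in> K" for n x using M[OF that, of n] by linarith
    then show ?thesis by blast
  qed
  have "\<exists>r. strict_mono r \<and>
    (\<forall>K. compact K \<and> K \<subseteq> \<Omega> \<longrightarrow> uniformly_convergent_on K (\<lambda>n. w (r n)))"
  proof (rule locally_equicontinuous_subsequence[OF \<Omega> bd])
    show "\<exists>d>0. \<forall>n. \<forall>y\<in>ball x d. \<bar>w n x - w n y\<bar> < e" if "x \<in> \<Omega>" "0 < e" for x e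
      by (rule superlinear_equicontinuous[OF \<Omega> _ lap bd that]) (use p in simp_all)
  qed
  then obtain r where r: "strict_mono r"
    "\<And>K. compact K \<Longrightarrow> K \<subseteq> \<Omega> \<Longrightarrow> uniformly_convergent_on K (\<lambda>n. w (r n))"
    by (elim exE conjE) simp
  \<comment> \<open>For this \<open>r\<close> alternative (ii) and the integral bound are proved
    separately, so the equivalence holds with both sides true.\<close>
  have "\<exists>v. C2_loc_conv \<Omega> (\<lambda>n. w (r n)) v"
    by (rule C2_loc_conv_of_locally_convergent[OF \<Omega> p assms(5) lap r(2)])
  moreover have "L1loc_bounded \<Omega> (\<lambda>n x. (max (w (r n) x - 1) 0) powr p)"
  proof -
    have "L1loc_bounded \<Omega> (\<lambda>n x. pos_power p (w (r n) x))"
    proof (rule L1loc_bounded_pos_power)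
      show "\<exists>M. \<forall>n. \<forall>x\<in>K. \<bar>w (r n) x\<bar> \<le> M" if "compact K" "K \<subseteq> \<Omega>" for K
        using bd[OF that] by blast
    qed (use p in simp)
    then show ?thesis by (simp only: pos_power_def)
  qed
  ultimately show ?thesis using neg r(1) by blast
qed

end
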